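(* Set $M=e^{2\varpi_1}Y_{1,1}Y_{1,-1}Y_{0,2}^{-1}Y_{0,0}^{-1}$. The representation $V(M)$ of $\mathcal U_q(sl_4^{tor})$ is an extremal loop weight module generated by the vector $v_M$ of $\ell$-weight $M$.
   Context: Here $\mathbb N=\{0,1,2,\dots\}$. Root data. Let $n=3$, $I=\{0,1,2,3\}$ identified with $\mathbb Z/4\mathbb Z$, $C=(C_{i,j})_{i,j\in I}$ the Cartan matrix of type $A_3^{(1)}$ ($C_{i,i}=2$, $C_{i,i\pm1}=-1$, other entries $0$), $\mathfrak h=\bigoplus_{i\in I}\mathbb Q h_i\oplus\mathbb Q d$; $\alpha_i(h_j)=C_{j,i}$, $\alpha_i(d)=\delta_{0,i}$, $\Lambda_i(h_j)=\delta_{i,j}$, $\Lambda_i(d)=0$; $\delta=\sum_i\alpha_i$, $P=\{\lambda\in\mathfrak h^*:\lambda(h_i)\in\mathbb Z\ \forall i\}$, $\varpi_1=\Lambda_1-\Lambda_0$. $W$ is the affine Weyl group generated by $s_i(\lambda)=\lambda-\lambda(h_i)\alpha_i$, $i\in I$. Fix $q=e^t\in\mathbb C^*$ not a root of unity, $q^x=e^{tx}$ for $x\in\mathbb Q$, $[l]_q=\frac{q^l-q^{-l}}{q-q^{-1}}$. Monomial crystal. Consider monomials $m=e^{\omega(m)}\prod_{i\in I,l\in\mathbb Z}Y_{i,l}^{u_{i,l}(m)}$ with $u_{i,l}(m)\in\mathbb Z$ (finitely many non-zero), $\omega(m)\in P$, $\sum_l u_{i,l}(m)=\omega(m)(h_i)$.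 Put $A_{i,l}=e^{\alpha_i}Y_{i,l-1}Y_{i,l+1}Y_{i-1,l}^{-1}Y_{i+1,l}^{-1}$. $\mathcal M$ is the group of monomials with $u_{i,l}(m)=0$ whenever $l\not\equiv i\bmod 2$. Set $\mathrm{wt}(m)=\omega(m)$, $\varphi_{i,L}(m)=\sum_{l\le L}u_{i,l}(m)$, $\varphi_i(m)=\max_L\varphi_{i,L}(m)$, $\varepsilon_{i,L}(m)=-\sum_{l\ge L}u_{i,l}(m)$, $\varepsilon_i(m)=\max_L\varepsilon_{i,L}(m)$, $p_i(m)=\max\{L:\varepsilon_{i,L}(m)=\varepsilon_i(m)\}$, $q_i(m)=\min\{L:\varphi_{i,L}(m)=\varphi_i(m)\}$; $\tilde e_i\cdot m=0$ if $\varepsilon_i(m)=0$, else $\tilde e_i\cdot m=mA_{i,p_i(m)-1}$; $\tilde f_i\cdot m=0$ if $\varphi_i(m)=0$, else $\tilde f_i\cdot m=mA_{i,q_i(m)+1}^{-1}$. $\mathcal M(m)$ is the connected subcrystal generated by $m$. $\mathcal E$ denotes the set of monomials occurring in $\bigoplus_{s\in\mathbb N}\mathcal M(e^{2\varpi_1+s\delta}Y_{1,1}Y_{1,-1-4s}Y_{0,2}^{-1}Y_{0,-4s}^{-1})$. Quantum toroidal algebra. $\mathcal U_q(sl_4^{tor})$ is the $\mathbb C$-algebra with generators $x_{i,r}^\pm$ ($i\in I,r\in\mathbb Z$), $k_h$ ($h\in\mathfrak h$), $h_{i,m}$ ($i\in I,m\in\mathbb Z\setminus\{0\}$) and relations: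 $k_hk_{h'}=k_{h+h'}$, $k_0=1$, $[k_h,h_{j,m}]=0$, $[h_{i,m},h_{j,m'}]=0$; $k_hx_{j,r}^\pm k_{-h}=q^{\pm\alpha_j(h)}x_{j,r}^\pm$; $[h_{i,m},x_{j,r}^\pm]=\pm\frac1m[mC_{i,j}]_qx_{j,m+r}^\pm$; $[x_{i,r}^+,x_{j,r'}^-]=\delta_{ij}\frac{\phi^+_{i,r+r'}-\phi^-_{i,r+r'}}{q-q^{-1}}$; $x_{i,r+1}^\pm x_{j,r'}^\pm-q^{\pm C_{ij}}x_{j,r'}^\pm x_{i,r+1}^\pm=q^{\pm C_{ij}}x_{i,r}^\pm x_{j,r'+1}^\pm-x_{j,r'+1}^\pm x_{i,r}^\pm$; for $j=i+1$ and $j=i-1$ the expression $x_{i,r_1}^\pm x_{i,r_2}^\pm x_{j,r'}^\pm-(q+q^{-1})x_{i,r_1}^\pm x_{j,r'}^\pm x_{i,r_2}^\pm+x_{j,r'}^\pm x_{i,r_1}^\pm x_{i,r_2}^\pm$ plus the same expression with $r_1,r_2$ exchanged is $0$; $[x_{i,r_1}^\pm,x_{j,r_2}^\pm]=0$ if $i\ne j,j\pm1$. Here $\phi_i^\pm(z)=\sum_{m\ge0}\phi^\pm_{i,\pm m}z^{\pm m}=k_{h_i}^{\pm1}\exp\big(\pm(q-q^{-1})\sum_{m'\ge1}h_{i,\pm m'}z^{\pm m'}\big)$, $\phi^+_{i,m}=0$ for $m<0$, $\phi^-_{i,m}=0$ for $m>0$. The horizontal subalgebra $\mathcal U_q^h(sl_4^{tor})$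 is generated by $x_i^\pm:=x_{i,0}^\pm$ and $k_h$. For $j\in I$, $\mathcal U_q^{v,j}(sl_4^{tor})$ is generated by $x_{i,r}^\pm,h_{i,m}$ ($i\ne j$) and $k_h$ ($h\in\bigoplus_{i\ne j}\mathbb Qh_i$). Definitions. $V_\nu=\{v:k_hv=q^{\nu(h)}v\ \forall h\}$; $V$ is integrable if $V=\bigoplus_{\nu\in P}V_\nu$ and all $x_{i,0}^\pm$ are locally nilpotent. A vector $v\in V_{\omega(m)}$ has $\ell$-weight $m$ if for each $i$, $\phi_i^\pm(z)$ acts on $v$ with (generalized) eigenvalue the expansion in $z^{\pm1}$ of $\prod_l\big(q\frac{1-zq^{l-1}}{1-zq^{l+1}}\big)^{u_{i,l}(m)}$. A vector $v$ of weight $\lambda$ is extremal for $\mathcal U_q^h(sl_4^{tor})$ if there are $(v_w)_{w\in W}$ with $v_{\mathrm{Id}}=v$ and, whenever $\pm w(\lambda)(h_i)\ge0$, $x_i^\pm v_w=0$ and $(x_i^\mp)^{(\pm w(\lambda)(h_i))}v_w=v_{s_iw}$, where $x^{(k)}=x^k/([k]_q\cdots[1]_q)$. An extremal loop weight module is an integrable $V$ with an $\ell$-weight vector $v$ such that (i) $\mathcal U_q(sl_4^{tor})v=V$; (ii) $v$ is extremal for $\mathcal U_q^h(sl_4^{tor})$; (iii) $\mathcal U_q^{v,j}(sl_4^{tor})w$ is finite-dimensional for all $w\in V$, $j\in I$; $V$ is then said to be generated by $v$. The module $V(M)$. It has basis $(v_m)_{m\in\mathcal E}$; $k_hv_m=q^{\mathrm{wt}(m)(h)}v_m$;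 $\phi_i^\pm(z)$ acts on $v_m$ by the scalar series attached to $m$ above. For $i\in I$, the part $\Xi_i(m)$ of $m$ in the variables $Y_{i,l}$ is always of one of the following forms, and $x_{i,r}^\pm$ ($r\in\mathbb Z$) act as follows (unlisted actions are zero). (1) $\Xi_i(m)=1$: $x_{i,r}^\pm v_m=0$. (2) $\Xi_i(m)=Y_{i,a}$: $x_{i,r}^-v_m=q^{r(a+1)}v_{mA_{i,a+1}^{-1}}$. (3) $\Xi_i(m)=Y_{i,a+2}^{-1}$: $x_{i,r}^+v_m=q^{r(a+1)}v_{mA_{i,a+1}}$. (4) For $b=a-2$: if $\Xi_i(m)=Y_{i,a}Y_{i,b}$, $x_{i,r}^-v_m=q^{r(a+1)}v_{mA_{i,a+1}^{-1}}$; if $\Xi_i(m)=Y_{i,a+2}^{-1}Y_{i,b}$, $x_{i,r}^+v_m=[2]_qq^{r(a+1)}v_{mA_{i,a+1}}$ and $x_{i,r}^-v_m=[2]_qq^{r(b+1)}v_{mA_{i,b+1}^{-1}}$; if $\Xi_i(m)=Y_{i,a+2}^{-1}Y_{i,b+2}^{-1}$, $x_{i,r}^+v_m=q^{r(b+1)}v_{mA_{i,b+1}}$. (5) For $a-b=2+4s$ with $s\ge1$, put $c_1=\frac{q^{b-1}-q^{a+1}}{q^b-q^a}$, $c_2=\frac{q^{b+1}-q^{a-1}}{q^b-q^a}$: if $\Xi_i(m)=Y_{i,a}Y_{i,b}$, $x_{i,r}^-v_m=c_1q^{r(a+1)}v_{mA_{i,a+1}^{-1}}+c_2q^{r(b+1)}v_{mA_{i,b+1}^{-1}}$;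 if $\Xi_i(m)=Y_{i,a+2}^{-1}Y_{i,b}$, $x_{i,r}^+v_m=q^{r(a+1)}v_{mA_{i,a+1}}$ and $x_{i,r}^-v_m=q^{r(b+1)}v_{mA_{i,b+1}^{-1}}$; if $\Xi_i(m)=Y_{i,a}Y_{i,b+2}^{-1}$, $x_{i,r}^+v_m=q^{r(b+1)}v_{mA_{i,b+1}}$ and $x_{i,r}^-v_m=q^{r(a+1)}v_{mA_{i,a+1}^{-1}}$; if $\Xi_i(m)=Y_{i,a+2}^{-1}Y_{i,b+2}^{-1}$, $x_{i,r}^+v_m=c_1q^{r(b+1)}v_{mA_{i,b+1}}+c_2q^{r(a+1)}v_{mA_{i,a+1}}$. (This defines a $\mathcal U_q(sl_4^{tor})$-module.) *)

theory Defs
  imports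
    "HOL-Analysis.Analysis"
    "HOL-Library.Poly_Mapping"
    "HOL-Computational_Algebra.Formal_Power_Series"
begin

section \<open>Root data of type $A_3^{(1)}$\<close>

text \<open>
  The numeral type \<open>4\<close> is the ring of integers modulo 4, so \<open>i + 1\<close> and \<open>i - 1\<close> are the two
  neighbours of \<open>i\<close> in the cyclic Dynkin diagram.
\<close>

type_synonym node = "4"

text \<open>
  A pair \<open>(c, e)\<close> stands, as an element of the Cartan algebra, for the sum of all
  \<open>c $ i\<close> times \<open>h_i\<close> plus \<open>e\<close> times \<open>d\<close>; as an element of the dual space it stands for the
  linear form with values \<open>c $ i\<close> at \<open>h_i\<close> and \<open>e\<close> at \<open>d\<close>.
\<close>

type_synonym cartan = "(rat ^ 4) \<times> rat"
type_synonym weight = "(rat ^ 4) \<times> rat"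

definition pairing :: "weight \<Rightarrow> cartan \<Rightarrow> rat" where
  "pairing l h = (\<Sum>i\<in>UNIV. fst l $ i * fst h $ i) + snd l * snd h"

definition wscale :: "rat \<Rightarrow> weight \<Rightarrow> weight" where
  "wscale c l = (c *s fst l, c * snd l)"

definition cartan_matrix :: "node \<Rightarrow> node \<Rightarrow> int" where
  "cartan_matrix i j = (if i = j then 2 else if j = i + 1 \<or> j = i - 1 then -1 else 0)"

definition coroot :: "node \<Rightarrow> cartan" where
  "coroot i = (axis i 1, 0)"

definition simple_root :: "node \<Rightarrow> weight" where
  "simple_root i = ((\<chi> j. of_int (cartan_matrix j i)), if i = 0 then 1 else 0)"

definition fundamental_weight :: "node \<Rightarrow> weight" where
  "fundamental_weight i = (axis i 1, 0)"

definition null_root :: weight where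
  "null_root = (\<Sum>i\<in>UNIV. simple_root i)"

definition varpi1 :: weight where
  "varpi1 = fundamental_weight 1 - fundamental_weight 0"

definition weight_lattice :: "weight set" where
  "weight_lattice = {l. \<forall>i. pairing l (coroot i) \<in> \<int>}"

definition reflection :: "node \<Rightarrow> weight \<Rightarrow> weight" where
  "reflection i l = l - wscale (pairing l (coroot i)) (simple_root i)"

text \<open>The simple reflections are involutions, so the following monoid is the group they generate.\<close>

inductive_set weyl_group :: "(weight \<Rightarrow> weight) set" where
  id_mem: "id \<in> weyl_group"
| refl_mem: "w \<in> weyl_group \<Longrightarrow> reflection i \<circ> w \<in> weyl_group"


section \<open>The monomial crystal\<close>

text \<open>
  The group of monomials is written additively: the pair \<open>(l, u)\<close> is the monomial
  $e^l \prod_{i, a} Y_{i,a}^{u_{i,a}}$, where $u_{i,a}$ is \<open>lookup (u $ i) a\<close>. Hence products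
  of monomials are sums below, and inverses are negatives.
\<close>

type_synonym monom = "weight \<times> ((int \<Rightarrow>\<^sub>0 int) ^ 4)"

abbreviation (input) wt :: "monom \<Rightarrow> weight" where "wt \<equiv> fst"

definition expo :: "monom \<Rightarrow> node \<Rightarrow> int \<Rightarrow> int" where
  "expo m i l = Poly_Mapping.lookup (snd m $ i) l"

definition e_mon :: "weight \<Rightarrow> monom" where
  "e_mon l = (l, 0)"

definition Y_mon :: "node \<Rightarrow> int \<Rightarrow> monom" where
  "Y_mon i l = (0, axis i (Poly_Mapping.single l 1))"

definition A_mon :: "node \<Rightarrow> int \<Rightarrow> monom" where
  "A_mon i l = e_mon (simple_root i) + Y_mon i (l - 1) + Y_mon i (l + 1)
     - Y_mon (i - 1) l - Y_mon (i + 1) l"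

text \<open>Since 4 is even, \<open>of_int l \<in> {i, i + 2}\<close> says that \<open>l\<close> and \<open>i\<close> have the same parity.\<close>

definition monomial_group :: "monom set" where
  "monomial_group = {m. wt m \<in> weight_lattice
     \<and> (\<forall>i. of_int (\<Sum>l\<in>Poly_Mapping.keys (snd m $ i). expo m i l) = pairing (wt m) (coroot i))
     \<and> (\<forall>i l. of_int l \<notin> {i, i + 2} \<longrightarrow> expo m i l = 0)}"

text \<open>The infinite sums over \<open>l \<le> L\<close> and \<open>l \<ge> L\<close> are restricted to the finite support.\<close>

definition phi_upto :: "node \<Rightarrow> int \<Rightarrow> monom \<Rightarrow> int" where
  "phi_upto i L m = (\<Sum>l\<in>Poly_Mapping.keys (snd m $ i) \<inter> {..L}. expo m i l)"

definition eps_from :: "node \<Rightarrow> int \<Rightarrow> monom \<Rightarrow> int" where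
  "eps_from i L m = - (\<Sum>l\<in>Poly_Mapping.keys (snd m $ i) \<inter> {L..}. expo m i l)"

definition phi_max :: "node \<Rightarrow> monom \<Rightarrow> int" where
  "phi_max i m = Max (range (\<lambda>L. phi_upto i L m))"

definition eps_max :: "node \<Rightarrow> monom \<Rightarrow> int" where
  "eps_max i m = Max (range (\<lambda>L. eps_from i L m))"

definition p_pos :: "node \<Rightarrow> monom \<Rightarrow> int" where
  "p_pos i m = (GREATEST L. eps_from i L m = eps_max i m)"

definition q_pos :: "node \<Rightarrow> monom \<Rightarrow> int" where
  "q_pos i m = (LEAST L. phi_upto i L m = phi_max i m)"

definition e_crystal :: "node \<Rightarrow> monom \<Rightarrow> monom option" where
  "e_crystal i m = (if eps_max i m = 0 then None else Some (m + A_mon i (p_pos i m - 1)))"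

definition f_crystal :: "node \<Rightarrow> monom \<Rightarrow> monom option" where
  "f_crystal i m = (if phi_max i m = 0 then None else Some (m - A_mon i (q_pos i m + 1)))"

inductive_set subcrystal :: "monom \<Rightarrow> monom set" for m0 :: monom where
  base: "m0 \<in> subcrystal m0"
| e_step: "m \<in> subcrystal m0 \<Longrightarrow> e_crystal i m = Some m' \<Longrightarrow> m' \<in> subcrystal m0"
| f_step: "m \<in> subcrystal m0 \<Longrightarrow> f_crystal i m = Some m' \<Longrightarrow> m' \<in> subcrystal m0"

definition M_shift :: "nat \<Rightarrow> monom" where
  "M_shift s = e_mon (wscale 2 varpi1 + wscale (of_nat s) null_root)
     + Y_mon 1 1 + Y_mon 1 (- 1 - 4 * int s) - Y_mon 0 2 - Y_mon 0 (- 4 * int s)"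

definition crystal_E :: "monom set" where
  "crystal_E = (\<Union>s. subcrystal (M_shift s))"


section \<open>The quantum toroidal algebra\<close>

text \<open>
  The parameter is \<open>t\<close> with $q = e^t$; the power $q^x$ is $e^{tx}$ for rational \<open>x\<close>.
\<close>

definition qpow :: "complex \<Rightarrow> rat \<Rightarrow> complex" where
  "qpow t x = exp (t * of_rat x)"

definition qint :: "complex \<Rightarrow> int \<Rightarrow> complex" where
  "qint t l = (qpow t (of_int l) - qpow t (- of_int l)) / (qpow t 1 - qpow t (- 1))"

definition qfact :: "complex \<Rightarrow> nat \<Rightarrow> complex" where
  "qfact t n = (\<Prod>l=1..n. qint t (int l))"

datatype sign = Pls | Mns

primrec sg :: "sign \<Rightarrow> int" where
  "sg Pls = 1"
| "sg Mns = -1"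

primrec opp :: "sign \<Rightarrow> sign" where
  "opp Pls = Mns"
| "opp Mns = Pls"

text \<open>\<open>Gen_h i 0\<close> is a dummy generator, which the defining relations below set to 0.\<close>

datatype gen = Gen_x sign node int | Gen_k cartan | Gen_h node int

datatype word = Word (letters: "gen list")

instantiation word :: monoid_add
begin

definition zero_word_def: "0 = Word []"

definition plus_word_def: "v + w = Word (letters v @ letters w)"

instance
  by standard (simp_all add: zero_word_def plus_word_def)

end

text \<open>
  Words form a monoid under concatenation (written additively, as the library's convolution
  product requires), so finitely supported complex functions on words are the free associative
  unital algebra over the generators.
\<close>

type_synonym free_algebra = "word \<Rightarrow>\<^sub>0 complex"

definition cst :: "complex \<Rightarrow> free_algebra" where
  "cst c = Poly_Mapping.single 0 c"

definition gen_elt :: "gen \<Rightarrow> free_algebra" where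
  "gen_elt g = Poly_Mapping.single (Word [g]) 1"

abbreviation x_el :: "sign \<Rightarrow> node \<Rightarrow> int \<Rightarrow> free_algebra" where
  "x_el s i r \<equiv> gen_elt (Gen_x s i r)"

abbreviation k_el :: "cartan \<Rightarrow> free_algebra" where
  "k_el h \<equiv> gen_elt (Gen_k h)"

abbreviation h_el :: "node \<Rightarrow> int \<Rightarrow> free_algebra" where
  "h_el i m \<equiv> gen_elt (Gen_h i m)"

text \<open>The exponential of a power series without constant term.\<close>

definition series_exp :: "free_algebra fps \<Rightarrow> free_algebra fps" where
  "series_exp f = Abs_fps (\<lambda>n. \<Sum>j\<le>n. cst (1 / fact j) * fps_nth (f ^ j) n)"

text \<open>
  \<open>phi_el t s i m\<close> is the coefficient $\phi^{\pm}_{i,m}$ for the sign \<open>s\<close>; the power series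
  variable is $z$ for the sign plus and $z^{-1}$ for the sign minus.
\<close>

definition phi_el :: "complex \<Rightarrow> sign \<Rightarrow> node \<Rightarrow> int \<Rightarrow> free_algebra" where
  "phi_el t s i m = (if sg s * m < 0 then 0 else
     (case s of Pls \<Rightarrow> k_el (coroot i) | Mns \<Rightarrow> k_el (- coroot i)) *
     fps_nth
       (series_exp (Abs_fps (\<lambda>n. if n = 0 then 0 else
          cst (of_int (sg s) * (qpow t 1 - qpow t (- 1))) * h_el i (sg s * int n))))
       (nat (sg s * m)))"

inductive toroidal_rel :: "complex \<Rightarrow> free_algebra \<Rightarrow> free_algebra \<Rightarrow> bool" for t :: complex where
  h_dummy: "toroidal_rel t (h_el i 0) 0"
| k_mult: "toroidal_rel t (k_el h * k_el h') (k_el (h + h'))"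
| k_zero: "toroidal_rel t (k_el 0) 1"
| k_h: "m \<noteq> 0 \<Longrightarrow> toroidal_rel t (k_el h * h_el j m) (h_el j m * k_el h)"
| h_h: "m \<noteq> 0 \<Longrightarrow> m' \<noteq> 0 \<Longrightarrow> toroidal_rel t (h_el i m * h_el j m') (h_el j m' * h_el i m)"
| k_x: "toroidal_rel t (k_el h * x_el s j r * k_el (- h))
    (cst (qpow t (of_int (sg s) * pairing (simple_root j) h)) * x_el s j r)"
| h_x: "m \<noteq> 0 \<Longrightarrow> toroidal_rel t (h_el i m * x_el s j r - x_el s j r * h_el i m)
    (cst (of_int (sg s) / of_int m * qint t (m * cartan_matrix i j)) * x_el s j (m + r))"
| x_x_opposite: "toroidal_rel t
    (x_el Pls i r * x_el Mns j r' - x_el Mns j r' * x_el Pls i r)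
    (if i = j then cst (1 / (qpow t 1 - qpow t (- 1))) *
       (phi_el t Pls i (r + r') - phi_el t Mns i (r + r')) else 0)"
| x_x_quadratic: "g = cst (qpow t (of_int (sg s * cartan_matrix i j))) \<Longrightarrow> toroidal_rel t
    (x_el s i (r + 1) * x_el s j r' - g * x_el s j r' * x_el s i (r + 1))
    (g * x_el s i r * x_el s j (r' + 1) - x_el s j (r' + 1) * x_el s i r)"
| serre: "j = i + 1 \<or> j = i - 1 \<Longrightarrow> c = cst (qpow t 1 + qpow t (- 1)) \<Longrightarrow> toroidal_rel t
    ((x_el s i r1 * x_el s i r2 * x_el s j r' - c * x_el s i r1 * x_el s j r' * x_el s i r2
        + x_el s j r' * x_el s i r1 * x_el s i r2)
     + (x_el s i r2 * x_el s i r1 * x_el s j r' - c * x_el s i r2 * x_el s j r' * x_el s i r1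
        + x_el s j r' * x_el s i r2 * x_el s i r1))
    0"
| x_x_commute: "i \<noteq> j \<Longrightarrow> i \<noteq> j + 1 \<Longrightarrow> i \<noteq> j - 1 \<Longrightarrow> toroidal_rel t
    (x_el s i r1 * x_el s j r2) (x_el s j r2 * x_el s i r1)"

text \<open>
  The quantum toroidal algebra is the quotient of the free algebra by the two-sided ideal
  generated by \<open>toroidal_rel t\<close>. A module over it is a module over the free algebra on which both
  sides of each relation act in the same way. The underlying space is a subspace \<open>V\<close> of an ambient
  complex vector space with scalar multiplication \<open>scl\<close>.
\<close>

definition toroidal_module ::
  "complex \<Rightarrow> (complex \<Rightarrow> 'v::ab_group_add \<Rightarrow> 'v) \<Rightarrow> 'v set \<Rightarrow> (free_algebra \<Rightarrow> 'v \<Rightarrow> 'v) \<Rightarrow> bool"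
where
  "toroidal_module t scl V act \<longleftrightarrow>
     vector_space scl \<and> module.subspace scl V
     \<and> (\<forall>a. \<forall>v\<in>V. act a v \<in> V)
     \<and> (\<forall>a. \<forall>v\<in>V. \<forall>w\<in>V. act a (v + w) = act a v + act a w)
     \<and> (\<forall>a c. \<forall>v\<in>V. act a (scl c v) = scl c (act a v))
     \<and> (\<forall>a b. \<forall>v\<in>V. act (a + b) v = act a v + act b v)
     \<and> (\<forall>a b. \<forall>v\<in>V. act (a * b) v = act a (act b v))
     \<and> (\<forall>c. \<forall>v\<in>V. act (cst c) v = scl c v)
     \<and> (\<forall>a b. toroidal_rel t a b \<longrightarrow> (\<forall>v\<in>V. act a v = act b v))"

inductive_set subalgebra :: "free_algebra set \<Rightarrow> free_algebra set" for S :: "free_algebra set" where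
  gen_mem: "a \<in> S \<Longrightarrow> a \<in> subalgebra S"
| cst_mem: "cst c \<in> subalgebra S"
| add_mem: "a \<in> subalgebra S \<Longrightarrow> b \<in> subalgebra S \<Longrightarrow> a + b \<in> subalgebra S"
| mult_mem: "a \<in> subalgebra S \<Longrightarrow> b \<in> subalgebra S \<Longrightarrow> a * b \<in> subalgebra S"

text \<open>
  The free algebra elements representing $\mathcal{U}_q^{v,j}$; the Cartan elements are those in
  the span of the \<open>h_i\<close> with \<open>i \<noteq> j\<close>.
\<close>

definition vertical_subalgebra :: "node \<Rightarrow> free_algebra set" where
  "vertical_subalgebra j = subalgebra
     ({x_el s i r | s i r. i \<noteq> j} \<union> {h_el i m | i m. i \<noteq> j \<and> m \<noteq> 0}
      \<union> {k_el h | h. fst h $ j = 0 \<and> snd h = 0})"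


section \<open>Extremal loop weight modules\<close>

definition weight_space ::
  "complex \<Rightarrow> (complex \<Rightarrow> 'v::ab_group_add \<Rightarrow> 'v) \<Rightarrow> 'v set \<Rightarrow> (free_algebra \<Rightarrow> 'v \<Rightarrow> 'v)
    \<Rightarrow> weight \<Rightarrow> 'v set"
where
  "weight_space t scl V act l = {v \<in> V. \<forall>h. act (k_el h) v = scl (qpow t (pairing l h)) v}"

text \<open>
  The second conjunct states that \<open>V\<close> is the direct sum of its weight spaces for weights in the
  weight lattice: every vector has exactly one finite decomposition into weight vectors.
\<close>

definition integrable_module ::
  "complex \<Rightarrow> (complex \<Rightarrow> 'v::ab_group_add \<Rightarrow> 'v) \<Rightarrow> 'v set \<Rightarrow> (free_algebra \<Rightarrow> 'v \<Rightarrow> 'v) \<Rightarrow> bool"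
where
  "integrable_module t scl V act \<longleftrightarrow>
     toroidal_module t scl V act
     \<and> (\<forall>v\<in>V. \<exists>!f :: weight \<Rightarrow>\<^sub>0 'v.
          Poly_Mapping.keys f \<subseteq> weight_lattice
          \<and> (\<forall>l\<in>weight_lattice. Poly_Mapping.lookup f l \<in> weight_space t scl V act l)
          \<and> v = (\<Sum>l\<in>Poly_Mapping.keys f. Poly_Mapping.lookup f l))
     \<and> (\<forall>s i. \<forall>v\<in>V. \<exists>n. act (x_el s i 0 ^ n) v = 0)"

text \<open>
  The expansion of $q (1 - z q^{l-1}) / (1 - z q^{l+1})$ in powers of $z$ (sign plus) or of
  $w = z^{-1}$ (sign minus); in the latter case it equals $q (w - q^{l-1}) / (w - q^{l+1})$.
\<close>

primrec ell_factor :: "complex \<Rightarrow> int \<Rightarrow> sign \<Rightarrow> complex fps" where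
  "ell_factor t l Pls = fps_const (qpow t 1)
     * (1 - fps_const (qpow t (of_int (l - 1))) * fps_X)
     * inverse (1 - fps_const (qpow t (of_int (l + 1))) * fps_X)"
| "ell_factor t l Mns = fps_const (qpow t 1)
     * (fps_X - fps_const (qpow t (of_int (l - 1))))
     * inverse (fps_X - fps_const (qpow t (of_int (l + 1))))"

definition ell_series :: "complex \<Rightarrow> monom \<Rightarrow> sign \<Rightarrow> node \<Rightarrow> complex fps" where
  "ell_series t m s i =
     (\<Prod>l\<in>Poly_Mapping.keys (snd m $ i).
        if expo m i l \<ge> 0 then ell_factor t l s ^ nat (expo m i l)
        else inverse (ell_factor t l s) ^ nat (- expo m i l))"

definition has_ell_weight ::
  "complex \<Rightarrow> (complex \<Rightarrow> 'v::ab_group_add \<Rightarrow> 'v) \<Rightarrow> 'v set \<Rightarrow> (free_algebra \<Rightarrow> 'v \<Rightarrow> 'v)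
    \<Rightarrow> 'v \<Rightarrow> monom \<Rightarrow> bool"
where
  "has_ell_weight t scl V act v m \<longleftrightarrow>
     v \<noteq> 0 \<and> v \<in> weight_space t scl V act (wt m)
     \<and> (\<forall>s i n. \<exists>N. act ((phi_el t s i (sg s * int n) - cst (fps_nth (ell_series t m s i) n)) ^ N) v = 0)"

text \<open>
  For \<open>l\<close> in the weight lattice all the numbers \<open>w(l)(h_i)\<close> are integers, so the condition
  \<open>\<plusminus> w(l)(h_i) \<ge> 0\<close> is expressed by naming the natural number \<open>n\<close> that is its value.
\<close>

definition extremal_vector ::
  "complex \<Rightarrow> (complex \<Rightarrow> 'v::ab_group_add \<Rightarrow> 'v) \<Rightarrow> 'v set \<Rightarrow> (free_algebra \<Rightarrow> 'v \<Rightarrow> 'v)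
    \<Rightarrow> 'v \<Rightarrow> weight \<Rightarrow> bool"
where
  "extremal_vector t scl V act v l \<longleftrightarrow>
     l \<in> weight_lattice \<and> v \<in> weight_space t scl V act l
     \<and> (\<exists>vw :: (weight \<Rightarrow> weight) \<Rightarrow> 'v.
          vw id = v
          \<and> (\<forall>w\<in>weyl_group. vw w \<in> V)
          \<and> (\<forall>w\<in>weyl_group. \<forall>i s n.
               of_int (sg s) * pairing (w l) (coroot i) = of_nat n \<longrightarrow>
                 act (x_el s i 0) (vw w) = 0
                 \<and> act (cst (1 / qfact t n) * x_el (opp s) i 0 ^ n) (vw w) = vw (reflection i \<circ> w)))"

text \<open>\<open>V\<close> is an extremal loop weight module generated by the vector \<open>v\<close> of \<open>\<ell>\<close>-weight \<open>m\<close>.\<close>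

definition extremal_loop_weight_module ::
  "complex \<Rightarrow> (complex \<Rightarrow> 'v::ab_group_add \<Rightarrow> 'v) \<Rightarrow> 'v set \<Rightarrow> (free_algebra \<Rightarrow> 'v \<Rightarrow> 'v)
    \<Rightarrow> 'v \<Rightarrow> monom \<Rightarrow> bool"
where
  "extremal_loop_weight_module t scl V act v m \<longleftrightarrow>
     integrable_module t scl V act
     \<and> has_ell_weight t scl V act v m
     \<and> range (\<lambda>a. act a v) = V
     \<and> extremal_vector t scl V act v (wt m)
     \<and> (\<forall>w\<in>V. \<forall>j. \<exists>B. finite B \<and> (\<lambda>a. act a w) ` vertical_subalgebra j \<subseteq> module.span scl B)"


section \<open>The module $V(M)$\<close>

text \<open>
  Formal complex linear combinations of monomials; \<open>V(M)\<close> is the subspace of those supported on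
  \<open>crystal_E\<close>, and \<open>basis_vec m\<close> is $v_m$.
\<close>

type_synonym combination = "monom \<Rightarrow>\<^sub>0 complex"

definition vscale :: "complex \<Rightarrow> combination \<Rightarrow> combination" where
  "vscale c f = Poly_Mapping.map ((*) c) f"

definition VM_space :: "combination set" where
  "VM_space = {f. Poly_Mapping.keys f \<subseteq> crystal_E}"

definition basis_vec :: "monom \<Rightarrow> combination" where
  "basis_vec m = Poly_Mapping.single m 1"

text \<open>The part of a monomial in the variables $Y_{i,l}$, for fixed \<open>i\<close>, written additively.\<close>

definition Xi_part :: "node \<Rightarrow> monom \<Rightarrow> int \<Rightarrow>\<^sub>0 int" where
  "Xi_part i m = snd m $ i"

abbreviation Yv :: "int \<Rightarrow> int \<Rightarrow>\<^sub>0 int" where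
  "Yv a \<equiv> Poly_Mapping.single a 1"

definition coeff1 :: "complex \<Rightarrow> int \<Rightarrow> int \<Rightarrow> complex" where
  "coeff1 t a b = (qpow t (of_int (b - 1)) - qpow t (of_int (a + 1)))
     / (qpow t (of_int b) - qpow t (of_int a))"

definition coeff2 :: "complex \<Rightarrow> int \<Rightarrow> int \<Rightarrow> complex" where
  "coeff2 t a b = (qpow t (of_int (b + 1)) - qpow t (of_int (a - 1)))
     / (qpow t (of_int b) - qpow t (of_int a))"

text \<open>
  \<open>lower t i r m a c\<close> and \<open>raise t i r m a c\<close> are $c\,q^{r(a+1)}$ times the basis vectors of
  $m A_{i,a+1}^{-1}$ and $m A_{i,a+1}$.
\<close>

definition lower :: "complex \<Rightarrow> node \<Rightarrow> int \<Rightarrow> monom \<Rightarrow> int \<Rightarrow> complex \<Rightarrow> combination" where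
  "lower t i r m a c =
     vscale (c * qpow t (of_int (r * (a + 1)))) (basis_vec (m - A_mon i (a + 1)))"

definition raise :: "complex \<Rightarrow> node \<Rightarrow> int \<Rightarrow> monom \<Rightarrow> int \<Rightarrow> complex \<Rightarrow> combination" where
  "raise t i r m a c =
     vscale (c * qpow t (of_int (r * (a + 1)))) (basis_vec (m + A_mon i (a + 1)))"

inductive x_rule :: "complex \<Rightarrow> node \<Rightarrow> int \<Rightarrow> monom \<Rightarrow> sign \<Rightarrow> combination \<Rightarrow> bool"
  for t i r m where
  case2: "Xi_part i m = Yv a \<Longrightarrow> x_rule t i r m Mns (lower t i r m a 1)"
| case3: "Xi_part i m = - Yv (a + 2) \<Longrightarrow> x_rule t i r m Pls (raise t i r m a 1)"
| case4_top: "b = a - 2 \<Longrightarrow> Xi_part i m = Yv a + Yv b \<Longrightarrow>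
    x_rule t i r m Mns (lower t i r m a 1)"
| case4_mid_up: "b = a - 2 \<Longrightarrow> Xi_part i m = - Yv (a + 2) + Yv b \<Longrightarrow>
    x_rule t i r m Pls (raise t i r m a (qint t 2))"
| case4_mid_down: "b = a - 2 \<Longrightarrow> Xi_part i m = - Yv (a + 2) + Yv b \<Longrightarrow>
    x_rule t i r m Mns (lower t i r m b (qint t 2))"
| case4_bot: "b = a - 2 \<Longrightarrow> Xi_part i m = - Yv (a + 2) - Yv (b + 2) \<Longrightarrow>
    x_rule t i r m Pls (raise t i r m b 1)"
| case5_top: "s \<ge> 1 \<Longrightarrow> a - b = 2 + 4 * s \<Longrightarrow> Xi_part i m = Yv a + Yv b \<Longrightarrow>
    x_rule t i r m Mns (lower t i r m a (coeff1 t a b) + lower t i r m b (coeff2 t a b))"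
| case5_left_up: "s \<ge> 1 \<Longrightarrow> a - b = 2 + 4 * s \<Longrightarrow> Xi_part i m = - Yv (a + 2) + Yv b \<Longrightarrow>
    x_rule t i r m Pls (raise t i r m a 1)"
| case5_left_down: "s \<ge> 1 \<Longrightarrow> a - b = 2 + 4 * s \<Longrightarrow> Xi_part i m = - Yv (a + 2) + Yv b \<Longrightarrow>
    x_rule t i r m Mns (lower t i r m b 1)"
| case5_right_up: "s \<ge> 1 \<Longrightarrow> a - b = 2 + 4 * s \<Longrightarrow> Xi_part i m = Yv a - Yv (b + 2) \<Longrightarrow>
    x_rule t i r m Pls (raise t i r m b 1)"
| case5_right_down: "s \<ge> 1 \<Longrightarrow> a - b = 2 + 4 * s \<Longrightarrow> Xi_part i m = Yv a - Yv (b + 2) \<Longrightarrow>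
    x_rule t i r m Mns (lower t i r m a 1)"
| case5_bot: "s \<ge> 1 \<Longrightarrow> a - b = 2 + 4 * s \<Longrightarrow> Xi_part i m = - Yv (a + 2) - Yv (b + 2) \<Longrightarrow>
    x_rule t i r m Pls (raise t i r m b (coeff1 t a b) + raise t i r m a (coeff2 t a b))"

text \<open>
  At most one rule applies (see \<open>x_rule_unique\<close> below); all actions not listed are zero.
\<close>

definition x_action :: "complex \<Rightarrow> sign \<Rightarrow> node \<Rightarrow> int \<Rightarrow> monom \<Rightarrow> combination" where
  "x_action t s i r m =
     (if \<exists>v. x_rule t i r m s v then THE v. x_rule t i r m s v else 0)"

text \<open>
  The eigenvalue of $h_{i,n}$ on $v_m$. It is determined by the requirement that
  $\phi_i^{\pm}(z)$ acts on $v_m$ by \<open>ell_series\<close>; see \<open>phi_scalar_eq_ell_series\<close> and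
  \<open>VM_act_phi\<close> below.
\<close>

definition h_scalar :: "complex \<Rightarrow> node \<Rightarrow> int \<Rightarrow> monom \<Rightarrow> complex" where
  "h_scalar t i n m =
     (\<Sum>l\<in>Poly_Mapping.keys (snd m $ i). of_int (expo m i l) * qpow t (of_int (n * l)))
     * qint t n / of_int n"

primrec gen_on_basis :: "complex \<Rightarrow> gen \<Rightarrow> monom \<Rightarrow> combination" where
  "gen_on_basis t (Gen_x s i r) m = x_action t s i r m"
| "gen_on_basis t (Gen_k h) m = vscale (qpow t (pairing (wt m) h)) (basis_vec m)"
| "gen_on_basis t (Gen_h i n) m = vscale (h_scalar t i n m) (basis_vec m)"

definition gen_action :: "complex \<Rightarrow> gen \<Rightarrow> combination \<Rightarrow> combination" where
  "gen_action t g v =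
     (\<Sum>m\<in>Poly_Mapping.keys v. vscale (Poly_Mapping.lookup v m) (gen_on_basis t g m))"

definition VM_act :: "complex \<Rightarrow> free_algebra \<Rightarrow> combination \<Rightarrow> combination" where
  "VM_act t a v =
     (\<Sum>w\<in>Poly_Mapping.keys a. vscale (Poly_Mapping.lookup a w) (foldr (gen_action t) (letters w) v))"


section \<open>Consistency of the definitions\<close>

subsection \<open>The monomials of the crystal lie in the monomial group\<close>

definition expo_sum :: "(int \<Rightarrow>\<^sub>0 int) \<Rightarrow> int" where
  "expo_sum f = (\<Sum>l\<in>Poly_Mapping.keys f. Poly_Mapping.lookup f l)"

lemma expo_sum_add: "expo_sum (f + g) = expo_sum f + expo_sum g"
proof -
  let ?S = "Poly_Mapping.keys f \<union> Poly_Mapping.keys g"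
  have *: "expo_sum h = (\<Sum>l\<in>?S. Poly_Mapping.lookup h l)"
    if "Poly_Mapping.keys h \<subseteq> ?S" for h
    unfolding expo_sum_def using that by (intro sum.mono_neutral_left) (auto simp: in_keys_iff)
  show ?thesis
    using *[of f] *[of g] *[OF keys_add] by (simp add: lookup_add sum.distrib)
qed

lemma expo_sum_single [simp]: "expo_sum (Poly_Mapping.single a c) = c"
  by (simp add: expo_sum_def)

lemma expo_sum_zero [simp]: "expo_sum 0 = 0"
  by (simp add: expo_sum_def)

lemma expo_sum_uminus: "expo_sum (- f) = - expo_sum f"
  using expo_sum_add[of f "- f"] by simp

lemma expo_sum_diff: "expo_sum (f - g) = expo_sum f - expo_sum g"
  using expo_sum_add[of "f - g" g] by simp

lemma pairing_add: "pairing (l + l') h = pairing l h + pairing l' h"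
  by (simp add: pairing_def algebra_simps sum.distrib)

lemma pairing_uminus: "pairing (- l) h = - pairing l h"
  by (simp add: pairing_def sum_negf)

lemma pairing_coroot: "pairing l (coroot i) = fst l $ i"
  by (simp add: pairing_def coroot_def axis_def if_distrib[of "(*) _"] cong: if_cong)

lemma monomial_group_iff: "m \<in> monomial_group \<longleftrightarrow>
    (\<forall>i. fst (wt m) $ i = of_int (expo_sum (snd m $ i))) \<and>
    (\<forall>i l. of_int l \<noteq> i \<and> of_int l \<noteq> i + 2 \<longrightarrow> Poly_Mapping.lookup (snd m $ i) l = 0)"
  unfolding monomial_group_def weight_lattice_def pairing_coroot expo_sum_def expo_def
  by (auto simp del: of_int_sum)

lemma monomial_group_add:
  "m \<in> monomial_group \<Longrightarrow> m' \<in> monomial_group \<Longrightarrow> m + m' \<in> monomial_group"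
  by (simp add: monomial_group_iff expo_sum_add lookup_add)

lemma monomial_group_diff:
  "m \<in> monomial_group \<Longrightarrow> m' \<in> monomial_group \<Longrightarrow> m - m' \<in> monomial_group"
  by (simp add: monomial_group_iff expo_sum_diff lookup_minus)

lemma node_parity:
  fixes x i :: node
  assumes "x = i + 1 \<or> x = i + 3"
  shows "x - 1 = i \<or> x - 1 = i + 2" "x + 1 = i \<or> x + 1 = i + 2"
    "x = (i + 1) \<or> x = (i + 1) + 2" "x = (i - 1) \<or> x = (i - 1) + 2"
  using assms exhaust_4[of i] by (elim disjE; simp)+

lemma A_mon_in_monomial_group:
  assumes "of_int l = i + 1 \<or> of_int l = i + 3"
  shows "A_mon i l \<in> monomial_group"
proof -
  have wt: "wt (A_mon i l) = simple_root i"
    by (simp add: A_mon_def e_mon_def Y_mon_def)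
  have u: "snd (A_mon i l) $ j =
     (if j = i then Yv (l - 1) + Yv (l + 1)
      else if j = i + 1 \<or> j = i - 1 then - Yv l else 0)" for j
    using exhaust_4[of i] exhaust_4[of j]
    by (auto simp: A_mon_def e_mon_def Y_mon_def axis_def)
  have nb: "i = j + 1 \<or> i = j - 1 \<longleftrightarrow> j = i + 1 \<or> j = i - 1" for j
    by (metis add_diff_cancel diff_add_cancel)
  have "fst (simple_root i) $ j = of_int (expo_sum (snd (A_mon i l) $ j))" for j
    using nb[of j] by (simp add: simple_root_def cartan_matrix_def u expo_sum_add expo_sum_uminus)
  moreover have "Poly_Mapping.lookup (snd (A_mon i l) $ j) l' = 0"
    if j: "of_int l' \<noteq> j" "of_int l' \<noteq> j + 2" for j l'
  proof -
    have "l' \<noteq> l - 1 \<and> l' \<noteq> l + 1" if "j = i"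
      using node_parity[OF assms] j that by auto
    moreover have "l' \<noteq> l" if "j = i + 1 \<or> j = i - 1"
      using node_parity[OF assms] j that by blast
    ultimately show ?thesis
      by (simp add: u lookup_add lookup_single when_def)
  qed
  ultimately show ?thesis by (simp add: monomial_group_iff wt)
qed

lemma null_root_coroot: "fst null_root $ j = 0"
proof -
  have "fst null_root $ j = (\<Sum>i\<in>UNIV. of_int (cartan_matrix j i))"
    unfolding null_root_def simple_root_def fst_sum sum_component by simp
  also have "\<dots> = of_int (cartan_matrix j 1 + cartan_matrix j 2 + cartan_matrix j 3 + cartan_matrix j 4)"
    unfolding sum_4 by (simp only: of_int_add)
  also have "\<dots> = 0"
    using exhaust_4[of j] unfolding cartan_matrix_def by (elim disjE) simp_all
  finally show ?thesis .
qed

lemma axis_nth': "axis i x $ j = (if j = i then x else 0)"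
  by (simp add: axis_def)

lemma M_shift_wt: "fst (wt (M_shift s)) $ j = (if j = 1 then 2 else if j = 0 then - 2 else 0)"
proof -
  have "fst (wt (M_shift s)) $ j = 2 * (axis 1 1 $ j - axis 0 1 $ j)"
    by (simp only: M_shift_def e_mon_def Y_mon_def wscale_def null_root_coroot varpi1_def
        fundamental_weight_def fst_add fst_diff fst_conv vector_smult_component
        vector_add_component vector_minus_component mult_zero_right add_0_right diff_zero zero_index fst_zero)
  also have "\<dots> = (if j = 1 then 2 else if j = 0 then - 2 else 0)"
    by (cases "j = 1"; cases "j = 0") (simp_all add: axis_nth')
  finally show ?thesis .
qed

lemma M_shift_part: "snd (M_shift s) $ j = (if j = 1 then Yv 1 + Yv (- 1 - 4 * int s)
     else if j = 0 then - Yv 2 - Yv (- 4 * int s) else 0)"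
proof -
  have "snd (M_shift s) $ j = axis 1 (Yv 1) $ j + axis 1 (Yv (- 1 - 4 * int s)) $ j
      - axis 0 (Yv 2) $ j - axis 0 (Yv (- 4 * int s)) $ j"
    by (simp only: M_shift_def e_mon_def Y_mon_def snd_add snd_diff snd_conv
        vector_add_component vector_minus_component add_0_left zero_index)
  thus ?thesis
    by (cases "j = 1"; cases "j = 0") (simp_all add: axis_nth' del: mult_minus_left)
qed

lemma of_int_4:
  "of_int (- 1 - 4 * int s) = (3 :: 4)" "of_int (- 4 * int s) = (0 :: 4)"
proof -
  have 4: "(4 :: 4) = 0" "- 1 = (3 :: 4)" by simp_all
  have "of_int (- 1 - 4 * int s) = - 1 - (4 :: 4) * of_nat s"
    by (simp only: of_int_diff of_int_mult of_int_minus of_int_1 of_int_numeral of_int_of_nat_eq)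
  thus "of_int (- 1 - 4 * int s) = (3 :: 4)"
    by (simp only: 4 mult_zero_left diff_zero)
  have "of_int (- 4 * int s) = - (4 :: 4) * of_nat s"
    by (simp only: of_int_mult of_int_minus of_int_numeral of_int_of_nat_eq)
  thus "of_int (- 4 * int s) = (0 :: 4)"
    by (simp only: 4 mult_zero_left minus_zero)
qed

lemma M_shift_in_monomial_group: "M_shift s \<in> monomial_group"
proof -
  have "Poly_Mapping.lookup (snd (M_shift s) $ j) l = 0"
    if l: "of_int l \<noteq> j" "of_int l \<noteq> j + 2" for j l
  proof -
    consider "j = 1" | "j = 0" | "j \<noteq> 1" "j \<noteq> 0" by blast
    thus ?thesis
    proof cases
      case 1
      have "l \<noteq> 1" using l(1) 1 by auto
      moreover have "l \<noteq> - 1 - 4 * int s"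
      proof
        assume "l = - 1 - 4 * int s"
        hence "of_int l = (3 :: 4)" by (simp only: of_int_4)
        thus False using l(2) unfolding 1 by simp
      qed
      ultimately show ?thesis
        unfolding M_shift_part 1 by (simp add: lookup_add lookup_single when_def)
    next
      case 2
      have "l \<noteq> 2" using l(2) 2 by auto
      moreover have "l \<noteq> - 4 * int s" 
      proof
        assume "l = - 4 * int s"
        hence "of_int l = (0 :: 4)" by (simp only: of_int_4)
        thus False using l(1) unfolding 2 by simp
      qed
      ultimately show ?thesis
        unfolding M_shift_part 2 by (simp add: lookup_minus lookup_single when_def)
    next
      case 3
      thus ?thesis by (simp add: M_shift_part)
    qed
  qed
  moreover have "fst (wt (M_shift s)) $ j = of_int (expo_sum (snd (M_shift s) $ j))" for j
  proof -
    consider "j = 1" | "j = 0" | "j \<noteq> 1" "j \<noteq> 0" by blast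
    thus ?thesis
      by cases (simp_all add: M_shift_wt M_shift_part expo_sum_add expo_sum_diff expo_sum_uminus)
  qed
  ultimately show ?thesis
    unfolding monomial_group_iff by blast
qed

lemma monomial_group_pos:
  assumes "m \<in> monomial_group" "expo m i l \<noteq> 0"
  shows "of_int l = i \<or> of_int l = i + 2"
  using assms by (auto simp: monomial_group_def)

lemma int_Greatest_mem:
  fixes P :: "int \<Rightarrow> bool"
  assumes "P a" "\<And>x. P x \<Longrightarrow> x \<le> b"
  shows "P (Greatest P)" "\<And>x. P x \<Longrightarrow> x \<le> Greatest P"
proof -
  define S where "S = {x. P x \<and> a \<le> x}"
  have "S \<subseteq> {a..b}" using assms(2) by (auto simp: S_def)
  hence fin: "finite S" using finite_subset by blast
  have "a \<in> S" using assms(1) by (simp add: S_def)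
  hence M: "P (Max S)" using Max_in[OF fin] by (auto simp: S_def)
  have "x \<le> Max S" if "P x" for x
  proof (cases "a \<le> x")
    case True
    thus ?thesis using Max_ge[OF fin, of x] that by (simp add: S_def)
  next
    case False
    thus ?thesis using Max_ge[OF fin \<open>a \<in> S\<close>] by simp
  qed
  with M have "Greatest P = Max S" by (intro Greatest_equality) auto
  thus "P (Greatest P)" "\<And>x. P x \<Longrightarrow> x \<le> Greatest P"
    using M \<open>\<And>x. P x \<Longrightarrow> x \<le> Max S\<close> by auto
qed

lemma int_Least_mem:
  fixes P :: "int \<Rightarrow> bool"
  assumes "P a" "\<And>x. P x \<Longrightarrow> b \<le> x"
  shows "P (Least P)" "\<And>x. P x \<Longrightarrow> Least P \<le> x"
proof -
  define S where "S = {x. P x \<and> x \<le> a}"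
  have "S \<subseteq> {b..a}" using assms(2) by (auto simp: S_def)
  hence fin: "finite S" using finite_subset by blast
  have "a \<in> S" using assms(1) by (simp add: S_def)
  hence M: "P (Min S)" using Min_in[OF fin] by (auto simp: S_def)
  have "Min S \<le> x" if "P x" for x
  proof (cases "x \<le> a")
    case True
    thus ?thesis using Min_le[OF fin, of x] that by (simp add: S_def)
  next
    case False
    thus ?thesis using Min_le[OF fin \<open>a \<in> S\<close>] by simp
  qed
  with M have "Least P = Min S" by (intro Least_equality) auto
  thus "P (Least P)" "\<And>x. P x \<Longrightarrow> Least P \<le> x"
    using M \<open>\<And>x. P x \<Longrightarrow> Min S \<le> x\<close> by auto
qed

lemma finite_range_restrict: "finite K \<Longrightarrow> finite (range (\<lambda>L. f (K \<inter> A L)))"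
  by (rule finite_subset[of _ "f ` Pow K"]) auto

lemma p_pos_support:
  assumes "eps_max i m \<noteq> 0"
  shows "expo m i (p_pos i m) \<noteq> 0"
proof -
  let ?K = "Poly_Mapping.keys (snd m $ i)"
  have fin: "finite (range (\<lambda>L. eps_from i L m))"
    unfolding eps_from_def by (rule finite_range_restrict) simp
  have "eps_max i m \<in> range (\<lambda>L. eps_from i L m)"
    unfolding eps_max_def using fin by (intro Max_in) auto
  then obtain L0 where L0: "eps_from i L0 m = eps_max i m" by auto
  have bound: "L \<le> Max (insert 0 ?K)" if "eps_from i L m = eps_max i m" for L
  proof (rule ccontr)
    assume contra: "\<not> L \<le> Max (insert 0 ?K)"
    hence "x < L" if "x \<in> ?K" for x
    proof -
      have "x \<le> Max (insert 0 ?K)" using that by (intro Max_ge) simp_all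
      thus ?thesis using contra by linarith
    qed
    hence "?K \<inter> {L..} = {}" by force
    thus False using that assms by (simp add: eps_from_def)
  qed
  have p: "eps_from i (p_pos i m) m = eps_max i m"
    and p_max: "\<And>L. eps_from i L m = eps_max i m \<Longrightarrow> L \<le> p_pos i m"
    unfolding p_pos_def
    using int_Greatest_mem[of "\<lambda>L. eps_from i L m = eps_max i m", OF L0 bound] by auto
  show ?thesis
  proof
    assume "expo m i (p_pos i m) = 0"
    hence "?K \<inter> {p_pos i m..} = ?K \<inter> {p_pos i m + 1..}"
      by (auto simp: expo_def in_keys_iff order_le_less)
    hence "eps_from i (p_pos i m + 1) m = eps_max i m"
      using p by (simp add: eps_from_def)
    from p_max[OF this] show False by simp
  qed
qed

lemma q_pos_support:
  assumes "phi_max i m \<noteq> 0"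
  shows "expo m i (q_pos i m) \<noteq> 0"
proof -
  let ?K = "Poly_Mapping.keys (snd m $ i)"
  have fin: "finite (range (\<lambda>L. phi_upto i L m))"
    unfolding phi_upto_def by (rule finite_range_restrict) simp
  have "phi_max i m \<in> range (\<lambda>L. phi_upto i L m)"
    unfolding phi_max_def using fin by (intro Max_in) auto
  then obtain L0 where L0: "phi_upto i L0 m = phi_max i m" by auto
  have bound: "Min (insert 0 ?K) \<le> L" if "phi_upto i L m = phi_max i m" for L
  proof (rule ccontr)
    assume contra: "\<not> Min (insert 0 ?K) \<le> L"
    hence "L < x" if "x \<in> ?K" for x
    proof -
      have "Min (insert 0 ?K) \<le> x" using that by (intro Min_le) simp_all
      thus ?thesis using contra by linarith
    qed
    hence "?K \<inter> {..L} = {}" by force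
    thus False using that assms by (simp add: phi_upto_def)
  qed
  have q: "phi_upto i (q_pos i m) m = phi_max i m"
    and q_min: "\<And>L. phi_upto i L m = phi_max i m \<Longrightarrow> q_pos i m \<le> L"
    unfolding q_pos_def
    using int_Least_mem[of "\<lambda>L. phi_upto i L m = phi_max i m", OF L0 bound] by auto
  show ?thesis
  proof
    assume 0: "expo m i (q_pos i m) = 0"
    have "?K \<inter> {..q_pos i m} = ?K \<inter> {..q_pos i m - 1}"
    proof (intro set_eqI iffI)
      fix x assume x: "x \<in> ?K \<inter> {..q_pos i m}"
      hence "x \<noteq> q_pos i m" using 0 by (auto simp: expo_def in_keys_iff)
      thus "x \<in> ?K \<inter> {..q_pos i m - 1}" using x by auto
    qed auto
    hence "phi_upto i (q_pos i m - 1) m = phi_max i m"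
      using q by (simp add: phi_upto_def)
    from q_min[OF this] show False by simp
  qed
qed

lemma crystal_E_subset_monomial_group: "crystal_E \<subseteq> monomial_group"
proof -
  have "m \<in> monomial_group" if "m \<in> subcrystal (M_shift s)" for m s
    using that
  proof induction
    case base
    show ?case by (rule M_shift_in_monomial_group)
  next
    case (e_step m i m')
    hence nz: "eps_max i m \<noteq> 0" and m': "m' = m + A_mon i (p_pos i m - 1)"
      by (auto simp: e_crystal_def split: if_splits)
    have "of_int (p_pos i m) = i \<or> of_int (p_pos i m) = i + 2"
      using monomial_group_pos[OF e_step.IH p_pos_support[OF nz]] .
    hence "of_int (p_pos i m - 1) = i + 1 \<or> of_int (p_pos i m - 1) = i + 3"
      using exhaust_4[of i] by auto
    thus ?case unfolding m'
      by (intro monomial_group_add e_step.IH A_mon_in_monomial_group)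
  next
    case (f_step m i m')
    hence nz: "phi_max i m \<noteq> 0" and m': "m' = m - A_mon i (q_pos i m + 1)"
      by (auto simp: f_crystal_def split: if_splits)
    have "of_int (q_pos i m) = i \<or> of_int (q_pos i m) = i + 2"
      using monomial_group_pos[OF f_step.IH q_pos_support[OF nz]] .
    hence "of_int (q_pos i m + 1) = i + 1 \<or> of_int (q_pos i m + 1) = i + 3"
      using exhaust_4[of i] by auto
    thus ?case unfolding m'
      by (intro monomial_group_diff f_step.IH A_mon_in_monomial_group)
  qed
  thus ?thesis by (auto simp: crystal_E_def)
qed

subsection \<open>The action of the Drinfeld generators\<close>

lemma x_rule_unique:
  assumes "x_rule t i r m s v" "x_rule t i r m s v'"
  shows "v = v'"
proof -
  define pos where "pos X = {x. Poly_Mapping.lookup X x = 1}" for X :: "int \<Rightarrow>\<^sub>0 int"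
  define neg where "neg X = {x. Poly_Mapping.lookup X x = -1}" for X :: "int \<Rightarrow>\<^sub>0 int"
  have one: "pos (Yv a) = {a}" "neg (Yv a) = {}" "pos (- Yv a) = {}" "neg (- Yv a) = {a}" for a
    by (auto simp: pos_def neg_def lookup_single when_def)
  have two: "pos (Yv a + Yv b) = {a, b}" "neg (Yv a + Yv b) = {}"
    "pos (- Yv a + Yv b) = {b}" "neg (- Yv a + Yv b) = {a}"
    "pos (Yv a - Yv b) = {a}" "neg (Yv a - Yv b) = {b}"
    "pos (- Yv a - Yv b) = {}" "neg (- Yv a - Yv b) = {a, b}" if "a \<noteq> b" for a b
    using that by (auto simp: pos_def neg_def lookup_add lookup_minus lookup_single when_def)
  show ?thesis
    using assms(1)
  proof cases
    case (case2 a)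
    hence "pos (Xi_part i m) = {a}" "neg (Xi_part i m) = {}" by (simp_all add: one)
    with assms(2) show ?thesis unfolding case2(1,2)
      by cases (auto simp: one two doubleton_eq_iff)
  next
    case (case3 a)
    hence "pos (Xi_part i m) = {}" "neg (Xi_part i m) = {a + 2}" by (simp_all add: one)
    with assms(2) show ?thesis unfolding case3(1,2)
      by cases (auto simp: one two doubleton_eq_iff)
  next
    case (case4_top b a)
    hence "pos (Xi_part i m) = {a, b}" "neg (Xi_part i m) = {}" by (simp_all add: two)
    with assms(2) \<open>b = a - 2\<close> show ?thesis unfolding case4_top(1,2)
      by cases (auto simp: one two doubleton_eq_iff)
  next
    case (case4_mid_up b a)
    hence "pos (Xi_part i m) = {b}" "neg (Xi_part i m) = {a + 2}" by (simp_all add: two)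
    with assms(2) \<open>b = a - 2\<close> show ?thesis unfolding case4_mid_up(1,2)
      by cases (auto simp: one two doubleton_eq_iff)
  next
    case (case4_mid_down b a)
    hence "pos (Xi_part i m) = {b}" "neg (Xi_part i m) = {a + 2}" by (simp_all add: two)
    with assms(2) \<open>b = a - 2\<close> show ?thesis unfolding case4_mid_down(1,2)
      by cases (auto simp: one two doubleton_eq_iff)
  next
    case (case4_bot b a)
    hence "pos (Xi_part i m) = {}" "neg (Xi_part i m) = {a + 2, b + 2}" by (simp_all add: two)
    with assms(2) \<open>b = a - 2\<close> show ?thesis unfolding case4_bot(1,2)
      by cases (auto simp: one two doubleton_eq_iff)
  next
    case (case5_top s a b)
    hence "pos (Xi_part i m) = {a, b}" "neg (Xi_part i m) = {}" by (simp_all add: two)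
    with assms(2) case5_top(3,4) show ?thesis unfolding case5_top(1,2)
      by cases (auto simp: one two doubleton_eq_iff)
  next
    case (case5_left_up s a b)
    hence "pos (Xi_part i m) = {b}" "neg (Xi_part i m) = {a + 2}" by (simp_all add: two)
    with assms(2) case5_left_up(3,4) show ?thesis unfolding case5_left_up(1,2)
      by cases (auto simp: one two doubleton_eq_iff)
  next
    case (case5_left_down s a b)
    hence "pos (Xi_part i m) = {b}" "neg (Xi_part i m) = {a + 2}" by (simp_all add: two)
    with assms(2) case5_left_down(3,4) show ?thesis unfolding case5_left_down(1,2)
      by cases (auto simp: one two doubleton_eq_iff)
  next
    case (case5_right_up s a b)
    hence "pos (Xi_part i m) = {a}" "neg (Xi_part i m) = {b + 2}" by (simp_all add: two)
    with assms(2) case5_right_up(3,4) show ?thesis unfolding case5_right_up(1,2)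
      by cases (auto simp: one two doubleton_eq_iff)
  next
    case (case5_right_down s a b)
    hence "pos (Xi_part i m) = {a}" "neg (Xi_part i m) = {b + 2}" by (simp_all add: two)
    with assms(2) case5_right_down(3,4) show ?thesis unfolding case5_right_down(1,2)
      by cases (auto simp: one two doubleton_eq_iff)
  next
    case (case5_bot s a b)
    hence "pos (Xi_part i m) = {}" "neg (Xi_part i m) = {a + 2, b + 2}" by (simp_all add: two)
    with assms(2) case5_bot(3,4) show ?thesis unfolding case5_bot(1,2)
      by cases (auto simp: one two doubleton_eq_iff)
  qed
qed

lemma x_action_eq: "x_rule t i r m s v \<Longrightarrow> x_action t s i r m = v"
  unfolding x_action_def by (metis (mono_tags, lifting) theI x_rule_unique)

subsection \<open>The action of the free algebra\<close>

lemma lookup_vscale [simp]: "Poly_Mapping.lookup (vscale c f) x = c * Poly_Mapping.lookup f x"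
  by (simp add: vscale_def Poly_Mapping.map.rep_eq when_def)

lemma vscale_simps:
  "vscale c (f + g) = vscale c f + vscale c g" "vscale (c + d) f = vscale c f + vscale d f"
  "vscale c (vscale d f) = vscale (c * d) f" "vscale 1 f = f" "vscale 0 f = 0" "vscale c 0 = 0"
  by (rule poly_mapping_eqI; simp add: lookup_add algebra_simps)+

lemma vscale_sum: "vscale c (\<Sum>x\<in>S. f x) = (\<Sum>x\<in>S. vscale c (f x))"
  by (induction S rule: infinite_finite_induct) (simp_all add: vscale_simps)

lemma sum_vscale: "(\<Sum>x\<in>S. vscale (c x) f) = vscale (\<Sum>x\<in>S. c x) f"
  by (induction S rule: infinite_finite_induct) (simp_all add: vscale_simps)

lemma vector_space_vscale: "vector_space vscale"
  by unfold_locales (simp_all add: vscale_simps)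

lemma gen_action_superset:
  assumes "finite S" "Poly_Mapping.keys v \<subseteq> S"
  shows "gen_action t g v = (\<Sum>m\<in>S. vscale (Poly_Mapping.lookup v m) (gen_on_basis t g m))"
  unfolding gen_action_def using assms
  by (intro sum.mono_neutral_left) (auto simp: in_keys_iff vscale_simps)

lemma gen_action_add: "gen_action t g (v + w) = gen_action t g v + gen_action t g w"
proof -
  let ?S = "Poly_Mapping.keys v \<union> Poly_Mapping.keys w"
  have "Poly_Mapping.keys (v + w) \<subseteq> ?S" by (rule keys_add)
  thus ?thesis
    by (simp add: gen_action_superset[of ?S] lookup_add vscale_simps sum.distrib)
qed

lemma gen_action_scale: "gen_action t g (vscale c v) = vscale c (gen_action t g v)"
proof -
  have "Poly_Mapping.keys (vscale c v) \<subseteq> Poly_Mapping.keys v" by (auto simp: in_keys_iff)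
  thus ?thesis
    by (simp add: gen_action_superset[of "Poly_Mapping.keys v"] vscale_sum vscale_simps)
qed

lemma gen_action_basis [simp]: "gen_action t g (basis_vec m) = gen_on_basis t g m"
  by (simp add: gen_action_def basis_vec_def vscale_simps)

lemma foldr_gen_action_add:
  "foldr (gen_action t) gs (v + w) = foldr (gen_action t) gs v + foldr (gen_action t) gs w"
  by (induction gs) (simp_all add: gen_action_add)

lemma foldr_gen_action_scale:
  "foldr (gen_action t) gs (vscale c v) = vscale c (foldr (gen_action t) gs v)"
  by (induction gs) (simp_all add: gen_action_scale)

lemma VM_act_superset:
  assumes "finite S" "Poly_Mapping.keys a \<subseteq> S"
  shows "VM_act t a v =
    (\<Sum>w\<in>S. vscale (Poly_Mapping.lookup a w) (foldr (gen_action t) (letters w) v))"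
  unfolding VM_act_def using assms
  by (intro sum.mono_neutral_left) (auto simp: in_keys_iff vscale_simps)

lemma VM_act_add_left: "VM_act t (a + b) v = VM_act t a v + VM_act t b v"
proof -
  let ?S = "Poly_Mapping.keys a \<union> Poly_Mapping.keys b"
  have "Poly_Mapping.keys (a + b) \<subseteq> ?S" by (rule keys_add)
  thus ?thesis
    by (simp add: VM_act_superset[of ?S] lookup_add vscale_simps sum.distrib)
qed

lemma VM_act_zero [simp]: "VM_act t 0 v = 0"
  by (simp add: VM_act_def)

lemma VM_act_sum_left: "VM_act t (\<Sum>x\<in>S. f x) v = (\<Sum>x\<in>S. VM_act t (f x) v)"
  by (induction S rule: infinite_finite_induct) (simp_all add: VM_act_add_left)

lemma VM_act_add: "VM_act t a (v + w) = VM_act t a v + VM_act t a w"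
  by (simp add: VM_act_def foldr_gen_action_add vscale_simps sum.distrib)

lemma VM_act_scale: "VM_act t a (vscale c v) = vscale c (VM_act t a v)"
  by (simp add: VM_act_def foldr_gen_action_scale vscale_simps vscale_sum mult.commute)

lemma VM_act_single:
  "VM_act t (Poly_Mapping.single w c) v = vscale c (foldr (gen_action t) (letters w) v)"
  by (simp add: VM_act_def vscale_simps)

lemma VM_act_cst [simp]: "VM_act t (cst c) v = vscale c v"
  by (simp add: cst_def VM_act_single zero_word_def)

lemma VM_act_one [simp]: "VM_act t 1 v = v"
  using VM_act_cst[of t 1 v] by (simp add: cst_def vscale_simps)

lemma VM_act_gen [simp]: "VM_act t (gen_elt g) v = gen_action t g v"
  by (simp add: gen_elt_def VM_act_single vscale_simps)

lemma poly_mapping_sum_single: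
  "f = (\<Sum>x\<in>Poly_Mapping.keys f. Poly_Mapping.single x (Poly_Mapping.lookup f x))"
  by (rule poly_mapping_eqI)
     (simp add: lookup_sum lookup_single when_def sum.delta in_keys_iff)

lemma VM_act_sum: "VM_act t a (\<Sum>x\<in>S. f x) = (\<Sum>x\<in>S. VM_act t a (f x))"
  using VM_act_scale[of t a 0 0]
  by (induction S rule: infinite_finite_induct) (simp_all add: VM_act_add vscale_simps)

lemma VM_act_mult: "VM_act t (a * b) v = VM_act t a (VM_act t b v)"
proof -
  have 1: "VM_act t (Poly_Mapping.single w c * Poly_Mapping.single w' c') v
      = VM_act t (Poly_Mapping.single w c) (VM_act t (Poly_Mapping.single w' c') v)" for w c w' c'
    by (simp add: mult_single VM_act_single plus_word_def foldr_gen_action_scale vscale_simps)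
  have "VM_act t (a * b) v = VM_act t
      ((\<Sum>w\<in>Poly_Mapping.keys a. Poly_Mapping.single w (Poly_Mapping.lookup a w))
       * (\<Sum>w\<in>Poly_Mapping.keys b. Poly_Mapping.single w (Poly_Mapping.lookup b w))) v"
    by (simp flip: poly_mapping_sum_single)
  also have "\<dots> = VM_act t
      (\<Sum>w\<in>Poly_Mapping.keys a. Poly_Mapping.single w (Poly_Mapping.lookup a w))
      (VM_act t (\<Sum>w\<in>Poly_Mapping.keys b. Poly_Mapping.single w (Poly_Mapping.lookup b w)) v)"
    by (simp add: sum_product VM_act_sum_left VM_act_sum 1) (rule sum.swap)
  finally show ?thesis
    by (simp flip: poly_mapping_sum_single)
qed

subsection \<open>The series attached to a monomial\<close>

lemma fps_exp_compose_unique: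
  fixes F a :: "complex fps"
  assumes "fps_nth a 0 = 0" "fps_nth F 0 = c" "fps_deriv F = F * fps_deriv a"
  shows "F = fps_const c * (fps_exp 1 oo a)"
proof -
  define E where "E b = fps_exp (1::complex) oo b" for b
  have dE: "fps_deriv (E b) = E b * fps_deriv b" if "fps_nth b 0 = 0" for b
    using that by (simp add: E_def fps_compose_deriv)
  have E0: "fps_nth (E b) 0 = 1" for b
    by (simp add: E_def fps_compose_nth)
  have const: "G = fps_const (fps_nth G 0)" if "fps_deriv G = 0" for G :: "complex fps"
    using that by (metis fps_deriv_eq_0_iff)
  have m: "fps_nth (- a) 0 = 0" using assms by simp
  have "fps_deriv (F * E (- a)) = 0"
    by (simp add: dE[OF m] assms(3) algebra_simps)
  hence 1: "F * E (- a) = fps_const c"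
    using const[of "F * E (- a)"] by (simp add: assms(2) E0)
  have "fps_deriv (E a * E (- a)) = 0"
    by (simp add: dE[OF m] dE[OF assms(1)] algebra_simps)
  hence 2: "E a * E (- a) = 1"
    using const[of "E a * E (- a)"] by (simp add: E0)
  have "F = F * (E a * E (- a))" by (simp add: 2)
  also have "\<dots> = fps_const c * E a" using 1 by (simp add: ac_simps)
  finally show ?thesis by (simp add: E_def)
qed

lemma qpow_add: "qpow t (x + y) = qpow t x * qpow t y"
  by (simp add: qpow_def of_rat_add distrib_left exp_add)

lemma qpow_0 [simp]: "qpow t 0 = 1"
  by (simp add: qpow_def)

lemma qpow_nonzero [simp]: "qpow t x \<noteq> 0"
  by (simp add: qpow_def)

lemma qpow_minus: "qpow t (- x) = inverse (qpow t x)"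
  by (simp add: qpow_def of_rat_minus exp_minus)

lemma qpow_power: "qpow t x ^ n = qpow t (of_nat n * x)"
  by (induction n) (simp_all add: qpow_add algebra_simps)

lemma qpow_diff_nonzero:
  assumes "\<And>n::nat. n > 0 \<Longrightarrow> exp t ^ n \<noteq> 1"
  shows "qpow t 1 - qpow t (- 1) \<noteq> 0"
proof
  assume "qpow t 1 - qpow t (- 1) = 0"
  hence "exp t = inverse (exp t)" by (simp add: qpow_def of_rat_minus exp_minus)
  hence "exp t ^ 2 = 1" by (metis exp_not_eq_zero power2_eq_square right_inverse)
  thus False using assms[of 2] by simp
qed


definition log_deriv :: "complex fps \<Rightarrow> complex fps \<Rightarrow> bool" where
  "log_deriv F g \<longleftrightarrow> fps_deriv F = F * g"

lemma log_deriv_const: "log_deriv (fps_const c) 0"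
  by (simp add: log_deriv_def)

lemma log_deriv_mult: "log_deriv F g \<Longrightarrow> log_deriv G h \<Longrightarrow> log_deriv (F * G) (g + h)"
  by (simp add: log_deriv_def algebra_simps)

lemma log_deriv_inverse:
  assumes "log_deriv F g" "fps_nth F 0 \<noteq> 0"
  shows "log_deriv (inverse F) (- g)"
proof -
  have "fps_deriv (inverse F) = - (inverse F * F) * g * inverse F"
    using assms by (simp add: log_deriv_def fps_inverse_deriv power2_eq_square algebra_simps)
  thus ?thesis
    using assms(2) by (simp add: log_deriv_def inverse_mult_eq_1)
qed

lemma log_deriv_power: "log_deriv F g \<Longrightarrow> log_deriv (F ^ n) (of_nat n * g)"
proof (induction n)
  case 0
  thus ?case by (simp add: log_deriv_def)
next
  case (Suc n)
  thus ?case using log_deriv_mult[of F g "F ^ n" "of_nat n * g"] by (simp add: algebra_simps)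
qed

lemma log_deriv_prod:
  "(\<And>x. x \<in> S \<Longrightarrow> log_deriv (F x) (g x)) \<Longrightarrow> log_deriv (\<Prod>x\<in>S. F x) (\<Sum>x\<in>S. g x)"
proof (induction S rule: infinite_finite_induct)
  case (insert x S)
  thus ?case by (simp add: log_deriv_mult)
qed (simp_all add: log_deriv_def)

lemma log_deriv_linear:
  "log_deriv (1 - fps_const c * fps_X) (- Abs_fps (\<lambda>n. c ^ Suc n))"
proof -
  have "(1 - fps_const c * fps_X) * Abs_fps (\<lambda>n. c ^ Suc n) = fps_const c"
  proof (rule fps_ext)
    fix n
    show "fps_nth ((1 - fps_const c * fps_X) * Abs_fps (\<lambda>n. c ^ Suc n)) n = fps_nth (fps_const c) n"
      by (cases n) (simp_all add: left_diff_distrib mult.assoc)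
  qed
  thus ?thesis by (simp add: log_deriv_def)
qed

lemma ell_factor_log_deriv:
  "log_deriv (ell_factor t l s)
     (Abs_fps (\<lambda>n. qpow t (of_int (sg s * (int n + 1) * (l + 1))))
      - Abs_fps (\<lambda>n. qpow t (of_int (sg s * (int n + 1) * (l - 1)))))"
  "fps_nth (ell_factor t l s) 0 = qpow t (of_int (sg s))"
proof -
  have frac: "log_deriv (fps_const c * (1 - fps_const a * fps_X) * inverse (1 - fps_const b * fps_X))
      (Abs_fps (\<lambda>n. b ^ Suc n) - Abs_fps (\<lambda>n. a ^ Suc n))" for a b c
    using log_deriv_mult[OF log_deriv_mult[OF log_deriv_const[of c] log_deriv_linear[of a]]
        log_deriv_inverse[OF log_deriv_linear[of b]]] by simp
  have lin: "fps_X - fps_const a = fps_const (- a) * (1 - fps_const (inverse a) * fps_X)"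
    if "a \<noteq> 0" for a :: complex
  proof -
    have "fps_const (- a) * (1 - fps_const (inverse a) * fps_X)
        = fps_const (- a) - fps_const (- a * inverse a) * fps_X"
      by (simp only: right_diff_distrib mult_1_right mult.assoc[symmetric] fps_const_mult)
    also have "\<dots> = fps_X - fps_const a"
      using that by (simp flip: fps_const_neg)
    finally show ?thesis ..
  qed
  have pw: "qpow t x ^ Suc n = qpow t (of_int (int n + 1) * x)" for x n
    by (subst qpow_power) (simp add: add.commute)
  have pw': "inverse (qpow t x) ^ Suc n = qpow t (- (of_int (int n + 1) * x))" for x n
    by (subst power_inverse, subst qpow_power) (simp add: add.commute flip: qpow_minus)
  show "log_deriv (ell_factor t l s)
     (Abs_fps (\<lambda>n. qpow t (of_int (sg s * (int n + 1) * (l + 1))))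
      - Abs_fps (\<lambda>n. qpow t (of_int (sg s * (int n + 1) * (l - 1)))))"
  proof (cases s)
    case Pls
    show ?thesis
      using frac[of "qpow t 1" "qpow t (of_int (l - 1))" "qpow t (of_int (l + 1))"]
      unfolding pw Pls by (simp del: of_int_add of_int_diff flip: of_int_mult)
  next
    case Mns
    let ?a = "qpow t (of_int (l - 1))" and ?b = "qpow t (of_int (l + 1))"
    have "ell_factor t l Mns = fps_const (qpow t 1 * (- ?a) * inverse (- ?b))
        * (1 - fps_const (inverse ?a) * fps_X) * inverse (1 - fps_const (inverse ?b) * fps_X)"
      by (simp only: ell_factor.simps lin[OF qpow_nonzero] fps_inverse_mult fps_const_inverse
            fps_const_mult[symmetric] mult_ac)
    moreover have "qpow t (of_int (sg s * (int n + 1) * k)) = inverse (qpow t (of_int k)) ^ Suc n"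
      for n k unfolding pw' Mns by (simp add: algebra_simps)
    ultimately show ?thesis
      using frac[of "qpow t 1 * (- ?a) * inverse (- ?b)" "inverse ?a" "inverse ?b"]
      by (simp only: Mns)
  qed
  show "fps_nth (ell_factor t l s) 0 = qpow t (of_int (sg s))"
  proof (cases s)
    case Mns
    have "qpow t 1 * qpow t (of_int (l - 1)) * qpow t (of_int (- (l + 1))) = qpow t (- 1)"
      by (simp flip: qpow_add)
    hence "qpow t 1 * qpow t (of_int (l - 1)) * inverse (qpow t (of_int (l + 1))) = qpow t (- 1)"
      by (simp add: qpow_minus[symmetric])
    thus ?thesis
      by (simp add: Mns fps_inverse_def del: of_int_add of_int_diff)
  qed simp
qed

lemma sum_expo_pairing:
  assumes "m \<in> monomial_group"
  shows "of_int (\<Sum>l\<in>Poly_Mapping.keys (snd m $ i). expo m i l) = pairing (wt m) (coroot i)"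
  using assms by (simp add: monomial_group_def)

definition h_series :: "complex \<Rightarrow> monom \<Rightarrow> sign \<Rightarrow> node \<Rightarrow> complex fps" where
  "h_series t m s i = Abs_fps (\<lambda>n. if n = 0 then 0 else
     of_int (sg s) * (qpow t 1 - qpow t (- 1)) * h_scalar t i (sg s * int n) m)"

lemma qpow_prod: "(\<Prod>x\<in>S. qpow t (f x)) = qpow t (\<Sum>x\<in>S. f x)"
  by (induction S rule: infinite_finite_induct) (simp_all add: qpow_add)

lemma h_series_deriv:
  assumes "qpow t 1 - qpow t (- 1) \<noteq> 0"
  shows "fps_deriv (h_series t m s i) = (\<Sum>l\<in>Poly_Mapping.keys (snd m $ i).
     of_int (expo m i l) * (Abs_fps (\<lambda>n. qpow t (of_int (sg s * (int n + 1) * (l + 1))))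
      - Abs_fps (\<lambda>n. qpow t (of_int (sg s * (int n + 1) * (l - 1))))))"
proof (rule fps_ext)
  fix n
  let ?N = "sg s * (int n + 1)"
  have N: "?N \<noteq> 0" "of_int (sg s) * of_int (sg s) = (1::complex)" by (cases s; simp)+
  have q: "(qpow t 1 - qpow t (- 1)) * qint t ?N = qpow t (of_int ?N) - qpow t (- of_int ?N)"
    using assms by (simp add: qint_def)
  have n: "of_nat (Suc n) * of_int (sg s) / of_int ?N = (1::complex)"
  proof -
    have "of_nat (Suc n) * of_int (sg s) = (of_int ?N :: complex)" by simp
    moreover have "of_int ?N \<noteq> (0::complex)" using N(1) by (subst of_int_eq_0_iff)
    ultimately show ?thesis by (metis divide_self)
  qed
  have "fps_nth (fps_deriv (h_series t m s i)) n
      = of_nat (Suc n) * (of_int (sg s) * (qpow t 1 - qpow t (- 1)) * h_scalar t i ?N m)"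
    by (simp add: h_series_def ac_simps)
  also have "\<dots> = (of_nat (Suc n) * of_int (sg s) / of_int ?N)
      * ((qpow t 1 - qpow t (- 1)) * qint t ?N)
      * (\<Sum>l\<in>Poly_Mapping.keys (snd m $ i). of_int (expo m i l) * qpow t (of_int (?N * l)))"
    unfolding h_scalar_def by (simp only: times_divide_eq_left times_divide_eq_right mult_ac)
  also have "\<dots> = (\<Sum>l\<in>Poly_Mapping.keys (snd m $ i). of_int (expo m i l) *
      ((qpow t (of_int ?N) - qpow t (- of_int ?N)) * qpow t (of_int (?N * l))))"
    unfolding n q by (simp add: sum_distrib_left mult_ac)
  also have "\<dots> = (\<Sum>l\<in>Poly_Mapping.keys (snd m $ i). of_int (expo m i l) *
      (qpow t (of_int (?N * (l + 1))) - qpow t (of_int (?N * (l - 1)))))"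
  proof (intro sum.cong refl arg_cong2[where f = "(*)"])
    fix l
    have "(of_int (?N * (l + 1)) :: rat) = of_int ?N + of_int (?N * l)"
      "(of_int (?N * (l - 1)) :: rat) = - of_int ?N + of_int (?N * l)"
      by (simp_all add: algebra_simps)
    thus "(qpow t (of_int ?N) - qpow t (- of_int ?N)) * qpow t (of_int (?N * l)) =
      qpow t (of_int (?N * (l + 1))) - qpow t (of_int (?N * (l - 1)))"
      by (simp only: qpow_add left_diff_distrib)
  qed
  finally show "fps_nth (fps_deriv (h_series t m s i)) n = fps_nth (\<Sum>l\<in>Poly_Mapping.keys (snd m $ i).
     of_int (expo m i l) * (Abs_fps (\<lambda>n. qpow t (of_int (sg s * (int n + 1) * (l + 1))))
      - Abs_fps (\<lambda>n. qpow t (of_int (sg s * (int n + 1) * (l - 1)))))) n"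
    by (simp add: fps_sum_nth fps_of_int[symmetric])
qed

lemma phi_scalar_eq_ell_series:
  assumes nz: "qpow t 1 - qpow t (- 1) \<noteq> 0" and m: "m \<in> monomial_group"
  shows "fps_const (qpow t (of_int (sg s) * pairing (wt m) (coroot i)))
     * (fps_exp 1 oo h_series t m s i) = ell_series t m s i"
proof -
  let ?K = "Poly_Mapping.keys (snd m $ i)"
  let ?g = "\<lambda>l. Abs_fps (\<lambda>n. qpow t (of_int (sg s * (int n + 1) * (l + 1))))
      - Abs_fps (\<lambda>n. qpow t (of_int (sg s * (int n + 1) * (l - 1))))"
  let ?F = "\<lambda>l. if expo m i l \<ge> 0 then ell_factor t l s ^ nat (expo m i l)
        else inverse (ell_factor t l s) ^ nat (- expo m i l)"
  have "log_deriv (?F l) (of_int (expo m i l) * ?g l)" for l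
  proof (cases "expo m i l \<ge> 0")
    case True
    thus ?thesis
      using log_deriv_power[OF ell_factor_log_deriv(1)[of t l s], of "nat (expo m i l)"] by simp
  next
    case False
    thus ?thesis
      using log_deriv_power[OF log_deriv_inverse[OF ell_factor_log_deriv(1)[of t l s]],
          of "nat (- expo m i l)"]
      by (simp add: ell_factor_log_deriv(2) algebra_simps)
  qed
  hence "log_deriv (ell_series t m s i) (fps_deriv (h_series t m s i))"
    unfolding ell_series_def h_series_deriv[OF nz] by (intro log_deriv_prod) auto
  moreover have "fps_nth (ell_series t m s i) 0
      = qpow t (of_int (sg s) * pairing (wt m) (coroot i))"
  proof -
    have nth_0_prod: "fps_nth (\<Prod>x\<in>S. F x) 0 = (\<Prod>x\<in>S. fps_nth (F x) 0)"
      for S :: "int set" and F :: "int \<Rightarrow> complex fps"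
      by (induction S rule: infinite_finite_induct) simp_all
    have "fps_nth (?F l) 0 = qpow t (of_int (sg s * expo m i l))" for l
    proof (cases "expo m i l \<ge> 0")
      case True
      thus ?thesis
        by (simp add: fps_power_zeroth ell_factor_log_deriv(2) qpow_power mult.commute)
    next
      case False
      thus ?thesis
        by (simp add: fps_power_zeroth ell_factor_log_deriv(2) qpow_power mult.commute
            flip: qpow_minus)
    qed
    hence "fps_nth (ell_series t m s i) 0 = (\<Prod>l\<in>?K. qpow t (of_int (sg s * expo m i l)))"
      unfolding ell_series_def nth_0_prod by simp
    also have "\<dots> = qpow t (of_int (sg s) * pairing (wt m) (coroot i))"
      by (simp add: qpow_prod sum_distrib_left flip: sum_expo_pairing[OF m])
    finally show ?thesis .
  qed
  ultimately show ?thesis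
    by (intro fps_exp_compose_unique[symmetric]) (simp_all add: log_deriv_def h_series_def)
qed


lemma VM_act_series_exp:
  assumes "\<And>n. VM_act t (fps_nth f n) (basis_vec m) = vscale (fps_nth g n) (basis_vec m)"
  shows "VM_act t (fps_nth (series_exp f) n) (basis_vec m)
    = vscale (fps_nth (fps_exp 1 oo g) n) (basis_vec m)"
proof -
  have pow: "VM_act t (fps_nth (f ^ j) n) (basis_vec m) = vscale (fps_nth (g ^ j) n) (basis_vec m)"
    for j n
  proof (induction j arbitrary: n)
    case 0
    show ?case by (simp add: vscale_simps)
  next
    case (Suc j)
    thus ?case
      by (simp add: fps_mult_nth VM_act_sum_left VM_act_mult VM_act_scale assms vscale_simps
          sum_vscale mult.commute)
  qed
  show ?thesis
    by (simp add: series_exp_def fps_compose_nth VM_act_sum_left VM_act_mult pow vscale_simps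
        sum_vscale atLeast0AtMost)
qed

lemma VM_act_phi:
  assumes "qpow t 1 - qpow t (- 1) \<noteq> 0" "m \<in> monomial_group"
  shows "VM_act t (phi_el t s i (sg s * int n)) (basis_vec m)
    = vscale (fps_nth (ell_series t m s i) n) (basis_vec m)"
proof -
  let ?f = "Abs_fps (\<lambda>n. if n = 0 then 0 else
    cst (of_int (sg s) * (qpow t 1 - qpow t (- 1))) * h_el i (sg s * int n))"
  have f: "VM_act t (fps_nth ?f n) (basis_vec m) = vscale (fps_nth (h_series t m s i) n) (basis_vec m)"
    for n by (simp add: h_series_def VM_act_mult vscale_simps)
  have sgn: "sg s * (sg s * int n) = int n" by (cases s) simp_all
  have k: "VM_act t (case s of Pls \<Rightarrow> k_el (coroot i) | Mns \<Rightarrow> k_el (- coroot i)) (basis_vec m)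
      = vscale (qpow t (of_int (sg s) * pairing (wt m) (coroot i))) (basis_vec m)"
    by (cases s) (simp_all add: pairing_def sum_negf)
  have "VM_act t (phi_el t s i (sg s * int n)) (basis_vec m)
    = vscale (qpow t (of_int (sg s) * pairing (wt m) (coroot i))
        * fps_nth (fps_exp 1 oo h_series t m s i) n) (basis_vec m)"
    by (simp add: phi_el_def sgn VM_act_mult VM_act_series_exp[OF f] VM_act_scale k vscale_simps
        mult.commute)
  also have "\<dots> = vscale (fps_nth (ell_series t m s i) n) (basis_vec m)"
    by (simp flip: phi_scalar_eq_ell_series[OF assms])
  finally show ?thesis .
qed

end

theory Submission
  imports Defs
begin

text \<open>
  A box with spectral shift \<open>c\<close> is a monomial $Y_{j,j+c}\,Y_{j-1,j+1+c}^{-1}$ with a suitable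
  weight, for an integer \<open>j\<close> whose residue modulo 4 is a node. Lowering at the node of \<open>j\<close> turns box
  \<open>j\<close> into box \<open>j + 1\<close>, so the boxes form the crystal of a vector representation. The monomial \<open>M\<close>
  is the product of two boxes numbered 1, with shifts 0 and -2. The set \<open>crystal_E\<close> consists of the
  products of a box \<open>j\<close> with shift 0 and a box \<open>k\<close> with shift -2 for which \<open>k \<le> j\<close> (\<open>crystal_E_eq\<close>):
  the component number \<open>s\<close> is the strip of the pairs with \<open>4 s \<le> j - k \<le> 4 s + 3\<close>.

  Put \<open>d = j - k\<close>. Once the basis vectors with \<open>d = 0\<close> are multiplied by $[2]_q$, all the cases that
  define the action become instances of one rule: a Drinfeld generator moves one of the two boxes by
  one step, with a coefficient that depends on \<open>d\<close> only and is 1 unless \<open>d\<close> is divisible by 4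
  (\<open>lower_wvec\<close>, \<open>raise_wvec\<close>). The coefficient of a move that decreases \<open>d\<close> vanishes for \<open>d = 0\<close>,
  which is why the half plane \<open>k \<le> j\<close> is stable. Reversing the two indices exchanges raising with
  lowering and $q$ with $q^{-1}$, so that both signs are treated at once (\<open>gen_action_uvec\<close>).

  Each defining relation is checked on one basis vector by comparing the coefficients of the
  possible end points. For the quadratic and the Serre relations this leaves identities between
  $q$-integers (\<open>quadratic_coefficient\<close>, \<open>serre_coefficients\<close>). In the commutator of a raising and a
  lowering generator the paths that do not return to their starting point cancel; those that return
  contribute the residues of the rational function whose two expansions give the eigenvalues of
  $\phi_i^{\pm}(z)$ (\<open>opposite_on_wvec\<close>, \<open>expansion_jump_residue_sum\<close>).

  The remaining properties are visible on pairs of boxes. After box \<open>j\<close> was moved by a generator,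
  the next move of this box in the same direction belongs to another node; so the cube of each
  $x_{i,0}^{\pm}$ vanishes. The two moves at one node take place at different spectral parameters,
  so the modes 0 and 1 of a generator separate them, and since their coefficients are non-zero every
  pair is reached from every other (\<open>isolate_move\<close>, \<open>VM_cyclic\<close>). The extremal vectors attached to
  the Weyl group are the pairs with \<open>j = k\<close>: that group permutes the weights of the boxes, and the
  divided square of a generator moves both boxes by one step (\<open>VM_extremal\<close>). Finally, without the
  generators of one node no box can pass that node, so both indices stay in a finite interval
  (\<open>vertical_finite\<close>).
\<close>

section \<open>Nodes modulo four\<close>

text \<open>
  Conditions on nodes become divisibility conditions on integers, which arithmetic decides.
\<close>

lemma of_int_node_eq_iff: "of_int j = (of_int k :: node) \<longleftrightarrow> 4 dvd (j - k)"
proof -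
  have four: "of_int 4 = (0 :: node)" by simp
  \<comment> \<open>Reduction modulo 4, since \<open>4 = 0\<close> in the type of nodes.\<close>
  have red: "of_int x = (of_int (x mod 4) :: node)" for x :: int
  proof -
    have "of_int x = (of_int (4 * (x div 4) + x mod 4) :: node)" by simp
    also have "\<dots> = of_int 4 * of_int (x div 4) + of_int (x mod 4)"
      by (simp only: of_int_add of_int_mult)
    finally show ?thesis by (simp only: four mult_zero_left add_0_left)
  qed
  have "of_int x = (0 :: node) \<longleftrightarrow> x mod 4 = 0" for x :: int
  proof -
    have "x mod 4 = 0 \<or> x mod 4 = 1 \<or> x mod 4 = 2 \<or> x mod 4 = 3" by presburger
    thus ?thesis by (subst red) (elim disjE; simp)
  qed
  from this[of "j - k"] show ?thesis by (simp add: dvd_eq_mod_eq_0)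
qed

lemma node_of_int_exists: "\<exists>j. i = (of_int j :: node)"
proof -
  have "i = of_int 1 \<or> i = of_int 2 \<or> i = of_int 3 \<or> i = of_int 4"
    using exhaust_4[of i] by simp
  thus ?thesis by blast
qed

section \<open>Boxes and pairs of boxes\<close>

text \<open>
  The first component records the pairings with the coroots. Passing the node 0 subtracts
  $\alpha_0$, the only simple root that does not vanish on $d$; hence the floor quotient.
\<close>

definition box_weight :: "int \<Rightarrow> weight" where
  "box_weight j = (axis (of_int j) 1 - axis (of_int j - 1) 1, - of_int ((j - 1) div 4))"

definition box_mon :: "int \<Rightarrow> int \<Rightarrow> monom" where
  "box_mon c j = e_mon (box_weight j) + Y_mon (of_int j) (j + c) - Y_mon (of_int j - 1) (j + c + 1)"

lemma simple_root_axis: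
  "simple_root i = (2 *s axis i 1 - axis (i + 1) 1 - axis (i - 1) 1, if i = 0 then 1 else 0)"
proof -
  have "fst (simple_root i) $ j = (2 *s axis i 1 - axis (i + 1) 1 - axis (i - 1) 1) $ j" for j
    using exhaust_4[of i] exhaust_4[of j]
    by (auto simp: simple_root_def cartan_matrix_def axis_nth')
  thus ?thesis by (simp add: prod_eq_iff vec_eq_iff simple_root_def)
qed

lemma box_weight_step: "box_weight (j + 1) = box_weight j - simple_root (of_int j)"
proof -
  have d: "of_int j = (0 :: node) \<longleftrightarrow> 4 dvd j" using of_int_node_eq_iff[of j 0] by simp
  have "j div 4 = (j - 1) div 4 + (if 4 dvd j then 1 else 0)" by presburger
  hence "(of_int (j div 4) :: rat) = of_int ((j - 1) div 4 + (if 4 dvd j then 1 else 0))"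
    by (rule arg_cong)
  hence "(of_int (j div 4) :: rat) = of_int ((j - 1) div 4) + (if 4 dvd j then 1 else 0)"
    by simp
  thus ?thesis
    by (simp add: box_weight_def simple_root_axis prod_eq_iff vec_eq_iff d add.commute)
qed

text \<open>
  Box \<open>j\<close> can be lowered exactly once at the node of \<open>j\<close>. This fixes the spectral index of every
  $A_{i,l}$ that occurs below.
\<close>

lemma box_step: "box_mon c (j + 1) = box_mon c j - A_mon (of_int j) (j + c + 1)"
proof -
  have "e_mon (box_weight (j + 1)) = e_mon (box_weight j) - e_mon (simple_root (of_int j))"
    by (simp add: e_mon_def box_weight_step)
  thus ?thesis by (simp add: box_mon_def A_mon_def add_ac)
qed

text \<open>
  The shift -2 of the second box makes $Y_{1,1} Y_{1,-1} Y_{0,2}^{-1} Y_{0,0}^{-1}$ the pair of two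
  boxes numbered 1.
\<close>

definition box_pair :: "int \<Rightarrow> int \<Rightarrow> monom" where
  "box_pair j k = box_mon 0 j + box_mon (- 2) k"

lemma wt_box_pair: "wt (box_pair j k) = box_weight j + box_weight k"
  by (simp add: box_pair_def box_mon_def e_mon_def Y_mon_def)

lemma box_pair_step_fst: "box_pair (j + 1) k = box_pair j k - A_mon (of_int j) (j + 1)"
  by (simp add: box_pair_def box_step)

lemma box_pair_step_snd: "box_pair j (k + 1) = box_pair j k - A_mon (of_int k) (k - 1)"
  by (simp add: box_pair_def box_step)

lemma box_pair_back_fst: "box_pair (j - 1) k = box_pair j k + A_mon (of_int (j - 1)) j"
  using box_pair_step_fst[of "j - 1" k] by simp

lemma box_pair_back_snd: "box_pair j (k - 1) = box_pair j k + A_mon (of_int (k - 1)) (k - 2)"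
  using box_pair_step_snd[of j "k - 1"] by simp

text \<open>
  At most two variables of a given node occur. Two of them meet at one node only if \<open>j - k\<close> is
  congruent to 0, 1 or -1 modulo 4; this is the source of all case distinctions.
\<close>

lemma snd_box_pair: "snd (box_pair j k) $ i =
   ((if i = of_int j then Yv j else 0) - (if i = of_int (j - 1) then Yv (j + 1) else 0))
 + ((if i = of_int k then Yv (k - 2) else 0) - (if i = of_int (k - 1) then Yv (k - 1) else 0))"
  by (simp add: box_pair_def box_mon_def e_mon_def Y_mon_def axis_nth')

text \<open>
  Decreasing the number of a box by 4 shifts its spectral indices by -4 and adds $\delta$ to its
  weight, which accounts for the weight $2\varpi_1 + s\delta$ of the generators.
\<close>

lemma M_shift_eq_box_pair: "M_shift s = box_pair 1 (1 - 4 * int s)"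
proof -
  have o: "of_int (1 - 4 * int s) = (1 :: node)"
    using of_int_node_eq_iff[of "1 - 4 * int s" 1] by simp
  have n: "snd null_root = 1"
    by (simp add: null_root_def sum_4 simple_root_def)
  have n': "fst null_root = 0"
    by (simp add: vec_eq_iff null_root_coroot)
  have "(1 - 4 * int s - 1) div 4 = - int s" by simp
  hence b: "box_weight (1 - 4 * int s) = (axis 1 1 - axis 0 1, of_nat s)"
    unfolding box_weight_def o by simp
  have w: "wscale 2 varpi1 + wscale (of_nat s) null_root = box_weight 1 + box_weight (1 - 4 * int s)"
    unfolding b by (simp add: prod_eq_iff wscale_def varpi1_def fundamental_weight_def
        box_weight_def n n' vec_eq_iff)
  have "box_pair 1 (1 - 4 * int s) = e_mon (box_weight 1 + box_weight (1 - 4 * int s))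
     + Y_mon 1 1 + Y_mon 1 (- 1 - 4 * int s) - Y_mon 0 2 - Y_mon 0 (- 4 * int s)"
    unfolding box_pair_def box_mon_def o by (simp add: e_mon_def)
  thus ?thesis unfolding M_shift_def w by simp
qed

section \<open>The crystal on pairs of boxes\<close>

text \<open>
  Both statistics of the crystal, $\varphi_{i,L}$ and $\varepsilon_{i,L}$, are expressed by this
  additive function of the exponents.
\<close>

definition partial_sum :: "(int \<Rightarrow>\<^sub>0 int) \<Rightarrow> int \<Rightarrow> int" where
  "partial_sum X L = (\<Sum>l\<in>Poly_Mapping.keys X \<inter> {..L}. Poly_Mapping.lookup X l)"

lemma partial_sum_superset:
  assumes "finite S" "Poly_Mapping.keys X \<subseteq> S"
  shows "partial_sum X L = (\<Sum>l\<in>S \<inter> {..L}. Poly_Mapping.lookup X l)"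
  unfolding partial_sum_def using assms
  by (intro sum.mono_neutral_left) (auto simp: in_keys_iff)

lemma partial_sum_simps [simp]:
  "partial_sum (X + Z) L = partial_sum X L + partial_sum Z L"
  "partial_sum (- X) L = - partial_sum X L"
  "partial_sum (X - Z) L = partial_sum X L - partial_sum Z L"
  "partial_sum 0 L = 0"
  "partial_sum (Poly_Mapping.single a c) L = (if a \<le> L then c else 0)"
proof -
  show add: "partial_sum (X + Z) L = partial_sum X L + partial_sum Z L" for X Z
    using keys_add[of X Z] partial_sum_superset[of "Poly_Mapping.keys X \<union> Poly_Mapping.keys Z"]
    by (simp add: lookup_add sum.distrib)
  show z: "partial_sum 0 L = 0" by (simp add: partial_sum_def)
  show neg: "partial_sum (- X) L = - partial_sum X L"  for X using add[of X "- X"] z by simp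
  show "partial_sum (X - Z) L = partial_sum X L - partial_sum Z L"
    using add[of X "- Z"] neg[of Z] by simp
  show "partial_sum (Poly_Mapping.single a c) L = (if a \<le> L then c else 0)"
    by (simp add: partial_sum_def)
qed

lemma phi_upto_partial_sum: "phi_upto i L m = partial_sum (snd m $ i) L"
  by (simp add: phi_upto_def partial_sum_def expo_def)

lemma eps_from_partial_sum:
  "eps_from i L m = partial_sum (snd m $ i) (L - 1) - expo_sum (snd m $ i)"
proof -
  let ?X = "snd m $ i"
  have "expo_sum ?X = (\<Sum>l\<in>(Poly_Mapping.keys ?X \<inter> {..L - 1}) \<union> (Poly_Mapping.keys ?X \<inter> {L..}).
      Poly_Mapping.lookup ?X l)"
    unfolding expo_sum_def by (rule arg_cong2[where f = sum]) auto
  also have "\<dots> = partial_sum ?X (L - 1) - eps_from i L m"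
    unfolding partial_sum_def eps_from_def expo_def by (subst sum.union_disjoint) auto
  finally show ?thesis by simp
qed

lemma finite_range_phi: "finite (range (\<lambda>L. phi_upto i L m))"
  unfolding phi_upto_def by (rule finite_range_restrict) simp

lemma finite_range_eps: "finite (range (\<lambda>L. eps_from i L m))"
  unfolding eps_from_def by (rule finite_range_restrict) simp

lemma f_crystal_None:
  assumes "\<And>L. partial_sum (snd m $ i) L \<le> 0" "partial_sum (snd m $ i) L0 = 0"
  shows "f_crystal i m = None"
proof -
  have "phi_max i m = 0" unfolding phi_max_def
    by (rule Max_eqI[OF finite_range_phi]) (use assms in \<open>auto
        simp: phi_upto_partial_sum image_iff intro: exI[of _ L0]\<close>)
  thus ?thesis by (simp add: f_crystal_def)
qed

lemma f_crystal_Some: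
  assumes "\<And>L. partial_sum (snd m $ i) L \<le> partial_sum (snd m $ i) a"
    "\<And>L. L < a \<Longrightarrow> partial_sum (snd m $ i) L < partial_sum (snd m $ i) a"
    "partial_sum (snd m $ i) a > 0"
  shows "f_crystal i m = Some (m - A_mon i (a + 1))"
proof -
  have p: "phi_max i m = partial_sum (snd m $ i) a" unfolding phi_max_def
    by (rule Max_eqI[OF finite_range_phi]) (use assms(1) in \<open>auto simp: phi_upto_partial_sum\<close>)
  have "q_pos i m = a" unfolding q_pos_def
    by (rule Least_equality) (use assms(2) in \<open>force simp: p phi_upto_partial_sum not_less[symmetric]\<close>)+
  thus ?thesis using assms(3) by (simp add: f_crystal_def p)
qed

lemma e_crystal_None:
  assumes "\<And>L. partial_sum (snd m $ i) L \<le> expo_sum (snd m $ i)"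
    "partial_sum (snd m $ i) L0 = expo_sum (snd m $ i)"
  shows "e_crystal i m = None"
proof -
  have "eps_max i m = 0" unfolding eps_max_def
    by (rule Max_eqI[OF finite_range_eps])
       (use assms in \<open>auto simp: eps_from_partial_sum image_iff intro: exI[of _ "L0 + 1"]\<close>)
  thus ?thesis by (simp add: e_crystal_def)
qed

lemma e_crystal_Some:
  assumes "\<And>L. partial_sum (snd m $ i) L \<le> partial_sum (snd m $ i) (a - 1)"
    "\<And>L. L \<ge> a \<Longrightarrow> partial_sum (snd m $ i) L < partial_sum (snd m $ i) (a - 1)"
    "partial_sum (snd m $ i) (a - 1) > expo_sum (snd m $ i)"
  shows "e_crystal i m = Some (m + A_mon i (a - 1))"
proof -
  let ?X = "snd m $ i"
  have p: "eps_max i m = partial_sum ?X (a - 1) - expo_sum ?X" unfolding eps_max_def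
    by (rule Max_eqI[OF finite_range_eps]) (use assms(1) in \<open>auto simp: eps_from_partial_sum\<close>)
  have "p_pos i m = a" unfolding p_pos_def
  proof (rule Greatest_equality)
    fix L assume "eps_from i L m = eps_max i m"
    thus "L \<le> a" using assms(2)[of "L - 1"] by (force simp: p eps_from_partial_sum)
  qed (simp add: p eps_from_partial_sum)
  thus ?thesis using assms(3) by (simp add: e_crystal_def p)
qed

text \<open>
  If both boxes can be lowered at the node \<open>i\<close>, the first one moves, because its variable has the
  larger spectral index and the partial sums still grow there. If \<open>j - k + 1\<close> is divisible by 4, the
  variable of the first box is preceded by an inverse variable of the second one, so the partial
  sums never become positive.
\<close>

lemma f_crystal_box_pair:
  assumes "k \<le> j"
  shows "f_crystal i (box_pair j k) =
    (if i = of_int j \<and> \<not> 4 dvd (j - k + 1) then Some (box_pair (j + 1) k)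
     else if i = of_int k \<and> \<not> 4 dvd (j - k) then Some (box_pair j (k + 1)) else None)"
proof -
  have imp: "4 dvd (j - k + 1) \<Longrightarrow> \<not> 4 dvd (j - k)" by presburger
  consider (P) "i = of_int j" "\<not> 4 dvd (j - k + 1)"
    | (Q) "i = of_int k" "i \<noteq> of_int j" | (N) "i \<noteq> of_int j" "i \<noteq> of_int k"
    | (C) "i = of_int j" "4 dvd (j - k + 1)" "\<not> 4 dvd (j - k)"
    using imp by blast
  thus ?thesis
  proof cases
    case P
    have "f_crystal i (box_pair j k) = Some (box_pair j k - A_mon i (j + 1))"
      by (rule f_crystal_Some) (use P assms in \<open>auto
          simp: snd_box_pair of_int_node_eq_iff algebra_simps simp del: of_int_diff\<close>)
    thus ?thesis using P by (simp add: box_pair_step_fst)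
  next
    case Q
    have "f_crystal i (box_pair j k) = Some (box_pair j k - A_mon i (k - 2 + 1))"
      by (rule f_crystal_Some) (use Q assms in \<open>auto
          simp: snd_box_pair of_int_node_eq_iff algebra_simps simp del: of_int_diff\<close>)
    moreover have "\<not> 4 dvd (j - k)" using Q by (metis of_int_node_eq_iff)
    ultimately show ?thesis using Q by (simp add: box_pair_step_snd)
  next
    case N
    have "f_crystal i (box_pair j k) = None"
      by (rule f_crystal_None[of _ _ "k - 3"]) (use N assms in \<open>auto
          simp: snd_box_pair of_int_node_eq_iff algebra_simps simp del: of_int_diff\<close>)
    thus ?thesis using N by simp
  next
    case C
    have "f_crystal i (box_pair j k) = None"
      by (rule f_crystal_None[of _ _ "k - 3"]) (use C assms in \<open>auto
          simp: snd_box_pair of_int_node_eq_iff algebra_simps simp del: of_int_diff\<close>)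
    moreover have "of_int j \<noteq> (of_int k :: node)" using C by (metis of_int_node_eq_iff)
    ultimately show ?thesis using C by simp
  qed
qed

text \<open>
  The mirror image of the previous rule: the second box has priority, and the same congruence blocks
  it.
\<close>

lemma e_crystal_box_pair:
  assumes "k \<le> j"
  shows "e_crystal i (box_pair j k) =
    (if i = of_int (k - 1) \<and> \<not> 4 dvd (j - k + 1) then Some (box_pair j (k - 1))
     else if i = of_int (j - 1) \<and> \<not> 4 dvd (j - k) then Some (box_pair (j - 1) k) else None)"
proof -
  have imp: "4 dvd (j - k + 1) \<Longrightarrow> \<not> 4 dvd (j - k)" by presburger
  note si = of_int_node_eq_iff algebra_simps expo_sum_add expo_sum_diff expo_sum_uminus
  consider (P) "i = of_int (k - 1)" "\<not> 4 dvd (j - k + 1)"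
    | (Q) "i = of_int (j - 1)" "i \<noteq> of_int (k - 1)" | (N) "i \<noteq> of_int (j - 1)" "i \<noteq> of_int (k - 1)"
    | (C) "i = of_int (k - 1)" "4 dvd (j - k + 1)" "\<not> 4 dvd (j - k)"
    using imp by blast
  thus ?thesis
  proof cases
    case P
    have "e_crystal i (box_pair j k) = Some (box_pair j k + A_mon i (k - 1 - 1))"
      by (rule e_crystal_Some) (use P assms in \<open>auto simp: snd_box_pair si simp del: of_int_diff\<close>)
    thus ?thesis using P by (simp add: box_pair_back_snd)
  next
    case Q
    have "e_crystal i (box_pair j k) = Some (box_pair j k + A_mon i (j + 1 - 1))"
      by (rule e_crystal_Some) (use Q assms in \<open>auto simp: snd_box_pair si simp del: of_int_diff\<close>)
    moreover have "\<not> 4 dvd (j - k)" using Q by (metis of_int_node_eq_iff diff_diff_eq2 diff_add_cancel)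
    ultimately show ?thesis using Q by (simp add: box_pair_back_fst)
  next
    case N
    have "e_crystal i (box_pair j k) = None"
      by (rule e_crystal_None[of _ _ "j + 1"]) (use N assms in \<open>auto simp: snd_box_pair si
          simp del: of_int_diff\<close>)
    thus ?thesis using N by simp
  next
    case C
    have "e_crystal i (box_pair j k) = None"
      by (rule e_crystal_None[of _ _ "j + 1"]) (use C assms in \<open>auto simp: snd_box_pair si
          simp del: of_int_diff\<close>)
    moreover have "of_int (j - 1) \<noteq> (of_int (k - 1) :: node)" using C
        by (simp only: of_int_node_eq_iff) simp
    ultimately show ?thesis using C by simp
  qed
qed

text \<open>
  Alternating a step that widens the pair with a step that narrows it translates both boxes, so one
  reaches all pairs with difference \<open>4 s\<close>; up to three further lowerings of the first box reach the
  rest of the strip.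
\<close>

lemma box_pair_in_subcrystal:
  assumes "4 * int s \<le> j - k" "j - k \<le> 4 * int s + 3"
  shows "box_pair j k \<in> subcrystal (M_shift s)"
proof -
  let ?S = "subcrystal (M_shift s)"
  have up: "box_pair (j + 1) k \<in> ?S" if "box_pair j k \<in> ?S" "k \<le> j" "\<not> 4 dvd (j - k + 1)" for j k
    using subcrystal.f_step[OF that(1), of "of_int j"] that by (simp add: f_crystal_box_pair)
  have up': "box_pair j (k - 1) \<in> ?S" if "box_pair j k \<in> ?S" "k \<le> j" "\<not> 4 dvd (j - k + 1)" for j k
    using subcrystal.e_step[OF that(1), of "of_int (k - 1)"] that by (simp add: e_crystal_box_pair)
  have down: "box_pair j (k + 1) \<in> ?S" if "box_pair j k \<in> ?S" "k \<le> j" "4 dvd (j - k - 1)" for j k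
  proof -
    have "\<not> 4 dvd (j - k)" using that by presburger
    moreover from this have "of_int k \<noteq> (of_int j :: node)"
      by (simp add: of_int_node_eq_iff dvd_diff_commute)
    ultimately show ?thesis
      using subcrystal.f_step[OF that(1), of "of_int k"] that by (simp add: f_crystal_box_pair)
  qed
  have down': "box_pair (j - 1) k \<in> ?S" if "box_pair j k \<in> ?S" "k \<le> j" "4 dvd (j - k - 1)" for j k
  proof -
    have "\<not> 4 dvd (j - k)" using that by presburger
    moreover from this have "of_int (j - 1) \<noteq> (of_int (k - 1) :: node)"
      by (simp only: of_int_node_eq_iff) simp
    ultimately show ?thesis
      using subcrystal.e_step[OF that(1), of "of_int (j - 1)"] that
      by (simp add: e_crystal_box_pair del: of_int_diff)
  qed
  \<comment> \<open>Translations along the line of difference \<open>4 s\<close>, in both directions.\<close>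
  have diag: "box_pair j (j - 4 * int s) \<in> ?S" for j
  proof (induction j rule: int_induct[where k = 1])
    case base
    show ?case using subcrystal.base[of "M_shift s"] by (simp add: M_shift_eq_box_pair)
  next
    case (step1 i)
    have "box_pair (i + 1) (i - 4 * int s) \<in> ?S" by (rule up[OF step1(2)]) presburger+
    from down[OF this] show ?case by (simp add: algebra_simps)
  next
    case (step2 i)
    have "box_pair i (i - 4 * int s - 1) \<in> ?S" by (rule up'[OF step2(2)]) presburger+
    from down'[OF this] show ?case by (simp add: algebra_simps)
  qed
  have "box_pair (k + 4 * int s + int n) k \<in> ?S" if "n \<le> 3" for n
    using that
  proof (induction n)
    case 0
    show ?case using diag[of "k + 4 * int s"] by simp
  next
    case (Suc n)
    have "\<not> 4 dvd (k + 4 * int s + int n - k + 1)" using Suc.prems by presburger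
    from up[OF _ _ this] Suc show ?case by (simp add: add_ac)
  qed
  from this[of "nat (j - k - 4 * int s)"] assms show ?thesis by simp
qed

lemma subcrystal_box_pair:
  assumes "m \<in> subcrystal (M_shift s)"
  shows "\<exists>j k. k \<le> j \<and> m = box_pair j k"
  using assms
proof induction
  case base
  show ?case by (intro exI[of _ 1] exI[of _ "1 - 4 * int s"]) (simp add: M_shift_eq_box_pair)
next
  case (e_step m i m')
  then obtain j k where jk: "k \<le> j" "m = box_pair j k" by blast
  have "m' = box_pair j (k - 1) \<or> (m' = box_pair (j - 1) k \<and> j \<noteq> k)"
    using e_step(2) jk by (auto simp: e_crystal_box_pair split: if_splits)
  thus ?case
  proof
    assume "m' = box_pair j (k - 1)"
    with jk(1) show ?thesis by (intro exI[of _ j] exI[of _ "k - 1"]) simp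
  next
    assume "m' = box_pair (j - 1) k \<and> j \<noteq> k"
    with jk(1) show ?thesis by (intro exI[of _ "j - 1"] exI[of _ k]) simp
  qed
next
  case (f_step m i m')
  then obtain j k where jk: "k \<le> j" "m = box_pair j k" by blast
  have "m' = box_pair (j + 1) k \<or> (m' = box_pair j (k + 1) \<and> j \<noteq> k)"
    using f_step(2) jk by (auto simp: f_crystal_box_pair split: if_splits)
  thus ?case
  proof
    assume "m' = box_pair (j + 1) k"
    with jk(1) show ?thesis by (intro exI[of _ "j + 1"] exI[of _ k]) simp
  next
    assume "m' = box_pair j (k + 1) \<and> j \<noteq> k"
    with jk(1) show ?thesis by (intro exI[of _ j] exI[of _ "k + 1"]) simp
  qed
qed

text \<open>
  A crystal operator narrows a pair only if the difference is not divisible by 4, so the condition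
  \<open>k \<le> j\<close> is preserved; conversely every such difference lies in one of the strips.
\<close>

lemma crystal_E_eq: "crystal_E = {box_pair j k | j k. k \<le> j}"
proof -
  have "box_pair j k \<in> crystal_E" if "k \<le> j" for j k
  proof -
    have "box_pair j k \<in> subcrystal (M_shift (nat ((j - k) div 4)))"
      by (rule box_pair_in_subcrystal) (use that in \<open>simp_all, presburger+\<close>)
    thus ?thesis by (auto simp: crystal_E_def)
  qed
  thus ?thesis using subcrystal_box_pair by (fastforce simp: crystal_E_def)
qed

section \<open>Generic parameters and $q$-integers\<close>

text \<open>
  An integer power of $q$ is 1 only for the exponent 0. In contrast to the usual formulation this is
  visibly symmetric under $q \mapsto q^{-1}$.
\<close>

definition generic :: "complex \<Rightarrow> bool" where
  "generic t \<longleftrightarrow> (\<forall>n::int. n \<noteq> 0 \<longrightarrow> qpow t (of_int n) \<noteq> 1)"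

lemma genericI:
  assumes "\<And>n::nat. n > 0 \<Longrightarrow> exp t ^ n \<noteq> 1"
  shows "generic t"
  unfolding generic_def
proof (intro allI impI)
  fix n :: int
  assume n: "n \<noteq> 0"
  have p: "qpow t (of_int (int k)) = exp t ^ k" for k
    using qpow_power[of t 1 k] by (simp add: qpow_def)
  show "qpow t (of_int n) \<noteq> 1"
  proof (cases n)
    case (nonneg k)
    thus ?thesis using n p[of k] assms[of k] by simp
  next
    case (neg k)
    have "qpow t (of_int n) = inverse (qpow t (of_int (int (Suc k))))"
      unfolding neg of_int_minus by (rule qpow_minus)
    also have "qpow t (of_int (int (Suc k))) = exp t ^ Suc k" by (rule p)
    finally show ?thesis using assms[of "Suc k"] by (metis inverse_1 inverse_inverse_eq zero_less_Suc)
  qed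
qed

lemma qpow_uminus_param: "qpow (- t) x = qpow t (- x)"
  by (simp add: qpow_def of_rat_minus)

lemma generic_uminus: "generic t \<Longrightarrow> generic (- t)"
  unfolding generic_def qpow_uminus_param by (metis neg_equal_0_iff_equal of_int_minus)

lemma qpow_int_add: "qpow t (of_int (m + n)) = qpow t (of_int m) * qpow t (of_int n)"
  by (simp add: qpow_add)

lemma qpow_int_inj: "generic t \<Longrightarrow> qpow t (of_int m) = qpow t (of_int n) \<longleftrightarrow> m = n"
proof -
  assume g: "generic t"
  have "qpow t (of_int m) = qpow t (of_int n) * qpow t (of_int (m - n))"
    using qpow_int_add[of t n "m - n"] by simp
  moreover have "qpow t (of_int (m - n)) = 1 \<longleftrightarrow> m = n"
    using g unfolding generic_def by (metis eq_iff_diff_eq_0 of_int_0 qpow_0)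
  ultimately show ?thesis by simp
qed

lemma qpow_1_diff_nonzero: "generic t \<Longrightarrow> qpow t 1 - qpow t (- 1) \<noteq> 0"
  using qpow_int_inj[of t 1 "- 1"] by simp

lemma qint_eq: "generic t \<Longrightarrow> qpow t (of_int n) - qpow t (- of_int n)
    = (qpow t 1 - qpow t (- 1)) * qint t n"
  using qpow_1_diff_nonzero[of t] by (simp add: qint_def)

lemma qint_nonzero: "generic t \<Longrightarrow> n \<noteq> 0 \<Longrightarrow> qint t n \<noteq> 0"
  using qpow_1_diff_nonzero[of t] qpow_int_inj[of t n "- n"] by (simp add: qint_def)

lemma qint_0 [simp]: "qint t 0 = 0"
  by (simp add: qint_def)

lemma qint_1: "generic t \<Longrightarrow> qint t 1 = 1"
  using qpow_1_diff_nonzero[of t] by (simp add: qint_def)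

lemma qint_uminus: "qint t (- n) = - qint t n"
  by (simp add: qint_def minus_divide_left)

lemma qint_uminus_param: "qint (- t) n = qint t n"
  unfolding qint_def qpow_uminus_param
  by (simp, metis minus_diff_eq minus_divide_divide)

lemma qint_2: "generic t \<Longrightarrow> qint t 2 = qpow t 1 + qpow t (- 1)"
proof -
  assume g: "generic t"
  have "qpow t 2 = qpow t 1 * qpow t 1" "qpow t (- 2) = qpow t (- 1) * qpow t (- 1)"
    by (simp_all flip: qpow_add)
  thus ?thesis using qpow_1_diff_nonzero[OF g]
    by (simp add: qint_def nonzero_divide_eq_eq algebra_simps)
qed

lemma qint_two_mult: "generic t \<Longrightarrow> qint t 2 * qint t n = qint t (n + 1) + qint t (n - 1)"
proof -
  assume g: "generic t"
  have "qpow t (of_int (n + 1)) = qpow t (of_int n) * qpow t 1"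
    "qpow t (- of_int (n + 1)) = qpow t (- of_int n) * qpow t (- 1)"
    "qpow t (of_int (n - 1)) = qpow t (of_int n) * qpow t (- 1)"
    "qpow t (- of_int (n - 1)) = qpow t (- of_int n) * qpow t 1"
    by (simp_all flip: qpow_add)
  thus ?thesis unfolding qint_2[OF g]
    by (simp only: qint_def times_divide_eq_right add_divide_distrib[symmetric])
        (simp add: algebra_simps)
qed

text \<open>
  The two coefficients in the action on $Y_{i,a} Y_{i,b}$ depend on \<open>a - b\<close> only, and are quotients
  of consecutive $q$-integers.
\<close>

lemma coeff_quotients:
  assumes "generic t" "a - b = 2 * h" "h \<noteq> 0"
  shows "coeff1 t a b = qint t (h + 1) / qint t h" "coeff2 t a b = qint t (h - 1) / qint t h"
proof -
  have ab: "of_int a = (of_int (b + 2 * h) :: rat)" using assms(2) by simp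
  define x y z where "x = qpow t (of_int b)" and "y = qpow t (of_int h)" and "z = qpow t 1"
  have nz: "x \<noteq> 0" "y \<noteq> 0" "z \<noteq> 0" by (simp_all add: x_def y_def z_def)
  have "qpow t (of_int (2 * h)) \<noteq> 1" using qpow_int_inj[OF assms(1), of "2 * h" 0] assms(3) by simp
  hence "y * y \<noteq> 1" by (simp add: y_def flip: qpow_add)
  moreover have "z * z \<noteq> 1"
    using qpow_int_inj[OF assms(1), of 2 0] by (simp add: z_def flip: qpow_add)
  moreover have "qpow t (of_int (h + 1)) = y * z" "qpow t (- of_int (h + 1)) = inverse (y * z)"
      "qpow t (of_int (h - 1)) = y / z" "qpow t (- of_int (h - 1)) = z / y"
      "qpow t (- of_int h) = inverse y" "qpow t (- 1) = inverse z"
      "qpow t (of_int a) = x * (y * y)" "qpow t (of_int (a + 1)) = x * (y * y) * z"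
      "qpow t (of_int (a - 1)) = x * (y * y) / z"
      "qpow t (of_int (b + 1)) = x * z" "qpow t (of_int (b - 1)) = x / z"
    unfolding x_def y_def z_def divide_inverse qpow_minus[symmetric] qpow_add[symmetric] ab
    by (simp_all add: ab algebra_simps)
  ultimately have D: "z - inverse z \<noteq> 0" "y - inverse y \<noteq> 0" "x - x * (y * y) \<noteq> 0"
    and Q: "coeff1 t a b = (x / z - x * (y * y) * z) / (x - x * (y * y))"
      "coeff2 t a b = (x * z - x * (y * y) / z) / (x - x * (y * y))"
      "qint t (h + 1) = (y * z - inverse (y * z)) / (z - inverse z)"
      "qint t (h - 1) = (y / z - z / y) / (z - inverse z)"
      "qint t h = (y - inverse y) / (z - inverse z)"
    using nz by (simp_all only: coeff1_def coeff2_def qint_def flip: x_def y_def z_def)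
      (simp_all add: field_simps)
  show "coeff1 t a b = qint t (h + 1) / qint t h" "coeff2 t a b = qint t (h - 1) / qint t h"
    using D nz unfolding Q divide_divide_eq_right times_divide_eq_left
        nonzero_mult_div_cancel_right[OF D(1)]
    by (simp_all only: frac_eq_eq[OF D(3,2)])
        (simp_all add: divide_inverse, (simp_all add: field_simps)?)
qed

text \<open>
  The coefficient of a move that increases the difference \<open>d\<close> of a pair. It is 0 for negative \<open>d\<close>,
  where the vectors are 0 as well, so that the rules for the action need no side condition.
\<close>

definition widen_coeff :: "complex \<Rightarrow> int \<Rightarrow> complex" where
  "widen_coeff t d = (if d < 0 then 0 else if 4 dvd d then qint t (d div 2 + 2) / qint t (d div 2
      + 1) else 1)"

text \<open>
  The coefficient of a move that decreases the difference \<open>d\<close>. For \<open>d = 0\<close> the formula for multiples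
  of 4 would also give 0.
\<close>

definition narrow_coeff :: "complex \<Rightarrow> int \<Rightarrow> complex" where
  "narrow_coeff t d = (if d \<le> 0 then 0 else if 4 dvd d then qint t (d div 2) / qint t (d div 2
      + 1) else 1)"

section \<open>The action of the Drinfeld generators\<close>

text \<open>
  A lowering rule needs a variable with positive exponent and a raising rule one with negative
  exponent. This decides the cases in which no rule applies.
\<close>

lemma x_rule_sign:
  assumes "x_rule t i r m s v"
  shows "\<exists>a. sg s * Poly_Mapping.lookup (Xi_part i m) a < 0"
  using assms
proof cases
  case (case4_mid_up b a)
  thus ?thesis by (intro exI[of _ "a + 2"]) (simp add: lookup_add lookup_minus lookup_single when_def)
next
  case (case4_mid_down b a)
  thus ?thesis by (intro exI[of _ b]) (simp add: lookup_add lookup_minus lookup_single when_def)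
next
  case (case5_left_up s a b)
  thus ?thesis by (intro exI[of _ "a + 2"]) (simp add: lookup_add lookup_minus lookup_single when_def)
next
  case (case5_left_down s a b)
  thus ?thesis by (intro exI[of _ b]) (simp add: lookup_add lookup_minus lookup_single when_def)
next
  case (case5_right_up s a b)
  thus ?thesis by (intro exI[of _ "b + 2"]) (simp add: lookup_minus lookup_single when_def)
next
  case (case5_right_down s a b)
  thus ?thesis by (intro exI[of _ a]) (simp add: lookup_minus lookup_single when_def)
qed (auto simp: lookup_add lookup_minus lookup_single when_def)

lemma x_action_zero:
  assumes "\<And>a. sg s * Poly_Mapping.lookup (Xi_part i m) a \<ge> 0"
  shows "x_action t s i r m = 0"
  using x_rule_sign[of t i r m s] assms unfolding x_action_def by (meson not_less)

lemma Xi_box_pair: "Xi_part i (box_pair j k) =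
   ((if i = of_int j then Yv j else 0) - (if i = of_int (j - 1) then Yv (j + 1) else 0))
 + ((if i = of_int k then Yv (k - 2) else 0) - (if i = of_int (k - 1) then Yv (k - 1) else 0))"
  unfolding Xi_part_def by (rule snd_box_pair)

lemma lower_box_pair:
  "lower t (of_int j) r (box_pair j k) j c = vscale (c
      * qpow t (of_int (r * (j + 1)))) (basis_vec (box_pair (j + 1) k))"
  "lower t (of_int k) r (box_pair j k) (k - 2) c
      = vscale (c * qpow t (of_int (r * (k - 1)))) (basis_vec (box_pair j (k + 1)))"
  by (simp_all add: lower_def box_pair_step_fst box_pair_step_snd)

lemma raise_box_pair:
  "raise t (of_int (j - 1)) r (box_pair j k) (j - 1) c
      = vscale (c * qpow t (of_int (r * j))) (basis_vec (box_pair (j - 1) k))"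
  "raise t (of_int (k - 1)) r (box_pair j k) (k - 3) c
      = vscale (c * qpow t (of_int (r * (k - 2)))) (basis_vec (box_pair j (k - 1)))"
  by (simp_all add: raise_def box_pair_back_fst box_pair_back_snd del: of_int_diff)

lemma Xi_box_pair_cases:
  "4 dvd (j - k) \<Longrightarrow> Xi_part (of_int j) (box_pair j k) = Yv j + Yv (k - 2)"
  "4 dvd (j - k + 1) \<Longrightarrow> Xi_part (of_int j) (box_pair j k) = Yv j - Yv (k - 1)"
  "\<not> 4 dvd (j - k) \<Longrightarrow> \<not> 4 dvd (j - k + 1) \<Longrightarrow> Xi_part (of_int j) (box_pair j k) = Yv j"
  "4 dvd (j - k - 1) \<Longrightarrow> Xi_part (of_int k) (box_pair j k) = - Yv (j + 1) + Yv (k - 2)"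
  "\<not> 4 dvd (j - k) \<Longrightarrow> \<not> 4 dvd (j - k - 1) \<Longrightarrow> Xi_part (of_int k) (box_pair j k) = Yv (k - 2)"
  "4 dvd (j - k) \<Longrightarrow> Xi_part (of_int (k - 1)) (box_pair j k) = - Yv (j + 1) - Yv (k - 1)"
  "4 dvd (j - k + 1) \<Longrightarrow> Xi_part (of_int (k - 1)) (box_pair j k) = Yv j - Yv (k - 1)"
  "\<not> 4 dvd (j - k) \<Longrightarrow> \<not> 4 dvd (j - k + 1) \<Longrightarrow> Xi_part (of_int (k - 1)) (box_pair j k) = - Yv (k - 1)"
  "4 dvd (j - k - 1) \<Longrightarrow> Xi_part (of_int (j - 1)) (box_pair j k) = - Yv (j + 1) + Yv (k - 2)"
  "\<not> 4 dvd (j - k) \<Longrightarrow> \<not> 4 dvd (j - k - 1) \<Longrightarrow> Xi_part (of_int (j - 1)) (box_pair j k) = - Yv (j + 1)"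
  unfolding Xi_box_pair of_int_node_eq_iff
  by (auto, presburger+)

text \<open>
  The factor $[2]_q$ on the diagonal reconciles the normalisation chosen for $Y_{i,a} Y_{i,a-2}$
  with the one chosen for $Y_{i,a} Y_{i,b}$ when \<open>a - b\<close> is larger; the value 0 for \<open>j < k\<close> makes
  formulas for neighbours of a pair meaningful at the boundary.
\<close>

definition wvec :: "complex \<Rightarrow> int \<Rightarrow> int \<Rightarrow> combination" where
  "wvec t j k = (if j < k then 0 else if j = k then vscale (qint t 2) (basis_vec (box_pair j k))
     else basis_vec (box_pair j k))"

definition vwhen :: "bool \<Rightarrow> complex \<Rightarrow> combination \<Rightarrow> combination" where
  "vwhen P c v = (if P then vscale c v else 0)"

lemma lower_wvec_fst:
  assumes g: "generic t" and "k \<le> j"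
  shows "gen_action t (Gen_x Mns (of_int j) r) (wvec t j k) =
     vscale (widen_coeff t (j - k) * qpow t (of_int (r * (j + 1)))) (wvec t (j + 1) k)
   + vwhen (4 dvd (j - k)) (narrow_coeff t (j - k) * qpow t (of_int (r * (k - 1)))) (wvec t j (k + 1))"
proof -
  consider (eq) "j = k" | (c0) s where "s \<ge> 1" "j - k = 4 * s" | (c3) s where "s \<ge> 1" "j - k = 4 * s - 1"
    | (N) "\<not> 4 dvd (j - k)" "\<not> 4 dvd (j - k + 1)"
  proof -
    have "j \<noteq> k \<Longrightarrow> 4 dvd (j - k) \<Longrightarrow> \<exists>s\<ge>1. j - k = 4 * s" using assms(2) by presburger
    moreover have "4 dvd (j - k + 1) \<Longrightarrow> \<exists>s\<ge>1. j - k = 4 * s - 1" using assms(2) by presburger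
    ultimately show ?thesis using that by blast
  qed
  thus ?thesis
  proof cases
    case eq
    have "x_rule t (of_int j) r (box_pair j k) Mns (lower t (of_int j) r (box_pair j k) j 1)"
      by (rule x_rule.case4_top[of "k - 2"]) (use eq in \<open>simp_all add: Xi_box_pair_cases(1)\<close>)
    from x_action_eq[OF this] show ?thesis using eq qint_1[OF g]
      by (simp add: wvec_def widen_coeff_def narrow_coeff_def vwhen_def gen_action_scale
          lower_box_pair vscale_simps)
  next
    case (c0 s)
    have "x_rule t (of_int j) r (box_pair j k) Mns
        (lower t (of_int j) r (box_pair j k) j (coeff1 t j (k - 2))
         + lower t (of_int j) r (box_pair j k) (k - 2) (coeff2 t j (k - 2)))"
      by (rule x_rule.case5_top[of s]) (use c0 in \<open>simp_all add: Xi_box_pair_cases(1)\<close>)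
    moreover have "of_int j = (of_int k :: node)" using c0 by (simp only: of_int_node_eq_iff) simp
    moreover have "coeff1 t j (k - 2) = widen_coeff t (j - k)"
        "coeff2 t j (k - 2) = narrow_coeff t (j - k)"
      using coeff_quotients[OF g, of j "k - 2" "2 * s + 1"] c0
          by (simp_all add: widen_coeff_def narrow_coeff_def add.commute)
    ultimately show ?thesis using c0 lower_box_pair(1)[of t j r k]
      by (simp add: wvec_def vwhen_def lower_box_pair(2) x_action_eq)
  next
    case (c3 s)
    have "x_rule t (of_int j) r (box_pair j k) Mns (lower t (of_int j) r (box_pair j k) j 1)"
      by (rule x_rule.case5_right_down[of s _ "k - 3"]) (use c3 in \<open>simp_all add: Xi_box_pair_cases(2)\<close>)
    moreover have "\<not> 4 dvd (j - k)" using c3 by presburger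
    ultimately show ?thesis using c3
      by (simp add: wvec_def vwhen_def lower_box_pair x_action_eq widen_coeff_def)
  next
    case N
    have "x_rule t (of_int j) r (box_pair j k) Mns (lower t (of_int j) r (box_pair j k) j 1)"
      by (rule x_rule.case2) (use N in \<open>simp_all add: Xi_box_pair_cases(3)\<close>)
    moreover have "j \<noteq> k" using N by auto
    ultimately show ?thesis using N assms(2)
      by (simp add: wvec_def vwhen_def lower_box_pair x_action_eq widen_coeff_def)
  qed
qed

lemma lower_wvec_snd:
  assumes g: "generic t" and "k \<le> j" "\<not> 4 dvd (j - k)"
  shows "gen_action t (Gen_x Mns (of_int k) r) (wvec t j k) =
     vscale (narrow_coeff t (j - k) * qpow t (of_int (r * (k - 1)))) (wvec t j (k + 1))"
proof -
  consider (one) "j = k + 1" | (c1) s where "s \<ge> 1" "j - k = 4 * s + 1" | (N) "\<not> 4 dvd (j - k - 1)"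
      "j \<noteq> k + 1"
  proof -
    have "j \<noteq> k + 1 \<Longrightarrow> 4 dvd (j - k - 1) \<Longrightarrow> \<exists>s\<ge>1. j - k = 4 * s + 1" using assms(2,3) by presburger
    thus ?thesis using that by blast
  qed
  thus ?thesis
  proof cases
    case one
    have "x_rule t (of_int k) r (box_pair j k) Mns (lower t (of_int k) r (box_pair j k) (k
        - 2) (qint t 2))"
      by (rule x_rule.case4_mid_down[of _ k])
          (use one Xi_box_pair_cases(4)[of j k] in \<open>simp_all add: add.commute\<close>)
    from x_action_eq[OF this] show ?thesis using one
      by (simp add: wvec_def narrow_coeff_def gen_action_scale lower_box_pair vscale_simps mult.commute)
  next
    case (c1 s)
    have "x_rule t (of_int k) r (box_pair j k) Mns (lower t (of_int k) r (box_pair j k) (k - 2) 1)"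
      by (rule x_rule.case5_left_down[of s "j
          - 1"]) (use c1 Xi_box_pair_cases(4)[of j k] in \<open>simp_all add: add.commute\<close>)
    from x_action_eq[OF this] show ?thesis using c1 assms(3)
      by (simp add: wvec_def narrow_coeff_def lower_box_pair)
  next
    case N
    have "x_rule t (of_int k) r (box_pair j k) Mns (lower t (of_int k) r (box_pair j k) (k - 2) 1)"
      by (rule x_rule.case2) (use N assms(3) in \<open>simp_all add: Xi_box_pair_cases(5)\<close>)
    moreover have "k + 1 < j" using N assms(2,3) by (cases "j = k") auto
    ultimately show ?thesis using assms(3)
      by (simp add: wvec_def narrow_coeff_def lower_box_pair x_action_eq)
  qed
qed

lemma wvec_neg: "j < k \<Longrightarrow> wvec t j k = 0"
  by (simp add: wvec_def)

lemma gen_action_zero [simp]: "gen_action t g 0 = 0"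
  by (simp add: gen_action_def)

lemma gen_action_wvec_zero: "x_action t s i r (box_pair j k) = 0
    \<Longrightarrow> gen_action t (Gen_x s i r) (wvec t j k) = 0"
  by (auto simp: wvec_def gen_action_scale vscale_simps)

text \<open>
  All cases of the action in one formula: lowering at the node \<open>i\<close> moves each box whose number has
  residue \<open>i\<close>, and the mode \<open>r\<close> only contributes a power of the spectral parameter of the move.
\<close>

lemma lower_wvec:
  assumes g: "generic t"
  shows "gen_action t (Gen_x Mns i r) (wvec t j k) =
     vwhen (i = of_int j) (widen_coeff t (j - k) * qpow t (of_int (r * (j + 1)))) (wvec t (j + 1) k)
   + vwhen (i = of_int k) (narrow_coeff t (j - k) * qpow t (of_int (r * (k - 1)))) (wvec t j (k + 1))"
proof (cases "j < k")
  case True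
  thus ?thesis by (simp add: wvec_neg widen_coeff_def narrow_coeff_def vwhen_def vscale_simps)
next
  case False
  consider "i = of_int j" | "i = of_int k" "i \<noteq> of_int j" | "i \<noteq> of_int j" "i \<noteq> of_int k" by blast
  thus ?thesis
  proof cases
    case 1
    thus ?thesis using lower_wvec_fst[OF g, of k j r] False by (simp add: of_int_node_eq_iff vwhen_def)
  next
    case 2
    moreover have "\<not> 4 dvd (j - k)" using 2 by (metis of_int_node_eq_iff)
    ultimately show ?thesis using lower_wvec_snd[OF g, of k j r] False by (simp add: vwhen_def)
  next
    case 3
    have "x_action t Mns i r (box_pair j k) = 0"
      by (rule x_action_zero) (use 3 in \<open>simp add: Xi_box_pair lookup_add lookup_minus lookup_single
          when_def\<close>)
    thus ?thesis using 3 by (simp add: gen_action_wvec_zero vwhen_def)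
  qed
qed

lemma raise_wvec_snd:
  assumes g: "generic t" and "k \<le> j"
  shows "gen_action t (Gen_x Pls (of_int (k - 1)) r) (wvec t j k) =
     vscale (widen_coeff t (j - k) * qpow t (of_int (r * (k - 2)))) (wvec t j (k - 1))
   + vwhen (4 dvd (j - k)) (narrow_coeff t (j - k) * qpow t (of_int (r * j))) (wvec t (j - 1) k)"
proof -
  let ?i = "of_int (k - 1) :: node"
  consider (eq) "j = k" | (c0) s where "s \<ge> 1" "j - k = 4 * s" | (c3) s where "s \<ge> 1" "j - k = 4 * s - 1"
    | (N) "\<not> 4 dvd (j - k)" "\<not> 4 dvd (j - k + 1)"
  proof -
    have "j \<noteq> k \<Longrightarrow> 4 dvd (j - k) \<Longrightarrow> \<exists>s\<ge>1. j - k = 4 * s" using assms(2) by presburger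
    moreover have "4 dvd (j - k + 1) \<Longrightarrow> \<exists>s\<ge>1. j - k = 4 * s - 1" using assms(2) by presburger
    ultimately show ?thesis using that by blast
  qed
  thus ?thesis
  proof cases
    case eq
    have "x_rule t ?i r (box_pair j k) Pls (raise t ?i r (box_pair j k) (k - 3) 1)"
      by (rule x_rule.case4_bot[of _ "j - 1"])
          (use eq Xi_box_pair_cases(6)[of j k] in \<open>simp_all add: add.commute\<close>)
    from x_action_eq[OF this] show ?thesis using eq qint_1[OF g]
      by (simp add: wvec_def widen_coeff_def narrow_coeff_def vwhen_def gen_action_scale
          raise_box_pair vscale_simps
          del: of_int_diff)
  next
    case (c0 s)
    have "x_rule t ?i r (box_pair j k) Pls (raise t ?i r (box_pair j k) (k
        - 3) (coeff1 t (j - 1) (k - 3))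
         + raise t ?i r (box_pair j k) (j - 1) (coeff2 t (j - 1) (k - 3)))"
      by (rule x_rule.case5_bot[of s]) (use c0 Xi_box_pair_cases(6)[of j k] in \<open>simp_all add:
          add.commute\<close>)
    moreover have "of_int (j - 1) = (of_int (k - 1) :: node)"
      using c0 by (simp only: of_int_node_eq_iff) simp
    moreover have "coeff1 t (j - 1) (k - 3) = widen_coeff t (j - k)"
        "coeff2 t (j - 1) (k - 3) = narrow_coeff t (j - k)"
      using coeff_quotients[OF g, of "j - 1" "k - 3" "2 * s + 1"] c0
          by (simp_all add: widen_coeff_def narrow_coeff_def add.commute)
    ultimately show ?thesis using c0 raise_box_pair(1)[of t j r k]
      by (simp add: wvec_def vwhen_def raise_box_pair(2) x_action_eq del: of_int_diff)
  next
    case (c3 s)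
    have "x_rule t ?i r (box_pair j k) Pls (raise t ?i r (box_pair j k) (k - 3) 1)"
      by (rule x_rule.case5_right_up[of s j]) (use c3 Xi_box_pair_cases(7)[of j k] in simp_all)
    moreover have "\<not> 4 dvd (j - k)" using c3 by presburger
    ultimately show ?thesis using c3
      by (simp add: wvec_def vwhen_def raise_box_pair x_action_eq widen_coeff_def del: of_int_diff)
  next
    case N
    have "x_rule t ?i r (box_pair j k) Pls (raise t ?i r (box_pair j k) (k - 3) 1)"
      by (rule x_rule.case3) (use N Xi_box_pair_cases(8)[of j k] in simp_all)
    moreover have "j \<noteq> k" using N by auto
    ultimately show ?thesis using N assms(2)
      by (simp add: wvec_def vwhen_def raise_box_pair x_action_eq widen_coeff_def del: of_int_diff)
  qed
qed

lemma raise_wvec_fst: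
  assumes g: "generic t" and "k \<le> j" "\<not> 4 dvd (j - k)"
  shows "gen_action t (Gen_x Pls (of_int (j - 1)) r) (wvec t j k) =
     vscale (narrow_coeff t (j - k) * qpow t (of_int (r * j))) (wvec t (j - 1) k)"
proof -
  let ?i = "of_int (j - 1) :: node"
  consider (one) "j = k + 1" | (c1) s where "s \<ge> 1" "j - k = 4 * s + 1" | (N) "\<not> 4 dvd (j - k - 1)"
      "j \<noteq> k + 1"
  proof -
    have "j \<noteq> k + 1 \<Longrightarrow> 4 dvd (j - k - 1) \<Longrightarrow> \<exists>s\<ge>1. j - k = 4 * s + 1" using assms(2,3) by presburger
    thus ?thesis using that by blast
  qed
  thus ?thesis
  proof cases
    case one
    have "x_rule t ?i r (box_pair j k) Pls (raise t ?i r (box_pair j k) (j - 1) (qint t 2))"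
      by (rule x_rule.case4_mid_up[of "k - 2"])
          (use one Xi_box_pair_cases(9)[of j k] in \<open>simp_all add: add.commute\<close>)
    from x_action_eq[OF this] show ?thesis using one raise_box_pair(1)[of t j r k]
      by (simp add: wvec_def narrow_coeff_def gen_action_scale vscale_simps mult.commute)
  next
    case (c1 s)
    have "x_rule t ?i r (box_pair j k) Pls (raise t ?i r (box_pair j k) (j - 1) 1)"
      by (rule x_rule.case5_left_up[of s _ "k
          - 2"]) (use c1 Xi_box_pair_cases(9)[of j k] in \<open>simp_all add: add.commute\<close>)
    from x_action_eq[OF this] show ?thesis using c1 assms(3)
      by (simp add: wvec_def narrow_coeff_def raise_box_pair del: of_int_diff)
  next
    case N
    have "x_rule t ?i r (box_pair j k) Pls (raise t ?i r (box_pair j k) (j - 1) 1)"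
      by (rule x_rule.case3) (use N assms(3) Xi_box_pair_cases(10)[of j k] in \<open>simp_all add:
          add.commute\<close>)
    moreover have "k + 1 < j" using N assms(2,3) by (cases "j = k") auto
    ultimately show ?thesis using assms(3)
      by (simp add: wvec_def narrow_coeff_def raise_box_pair x_action_eq del: of_int_diff)
  qed
qed

text \<open>
  The same with the roles of the boxes exchanged: now the second box widens the pair.
\<close>

lemma raise_wvec:
  assumes g: "generic t"
  shows "gen_action t (Gen_x Pls i r) (wvec t j k) =
     vwhen (i = of_int (k - 1)) (widen_coeff t (j - k)
         * qpow t (of_int (r * (k - 2)))) (wvec t j (k - 1))
   + vwhen (i = of_int (j - 1)) (narrow_coeff t (j - k) * qpow t (of_int (r * j))) (wvec t (j - 1) k)"
proof (cases "j < k")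
  case True
  thus ?thesis by (simp add: wvec_neg widen_coeff_def narrow_coeff_def vwhen_def vscale_simps)
next
  case False
  have kj: "of_int (k - 1) = (of_int (j - 1) :: node) \<longleftrightarrow> 4 dvd (j - k)"
    by (simp only: of_int_node_eq_iff) presburger
  consider "i = of_int (k - 1)" | "i = of_int (j - 1)" "i \<noteq> of_int (k - 1)"
    | "i \<noteq> of_int (j - 1)" "i \<noteq> of_int (k - 1)" by blast
  thus ?thesis
  proof cases
    case 1
    thus ?thesis using raise_wvec_snd[OF g, of k j r] False by (simp add: kj vwhen_def del: of_int_diff)
  next
    case 2
    moreover have "\<not> 4 dvd (j - k)" using 2 kj by metis
    ultimately show ?thesis using raise_wvec_fst[OF g, of k j r] False
        by (simp add: vwhen_def del: of_int_diff)
  next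
    case 3
    have "x_action t Pls i r (box_pair j k) = 0"
      by (rule x_action_zero) (use 3 in \<open>simp add: Xi_box_pair lookup_add lookup_minus lookup_single
          when_def\<close>)
    thus ?thesis using 3 by (simp add: gen_action_wvec_zero vwhen_def)
  qed
qed

section \<open>A uniform description of raising and lowering\<close>

text \<open>
  Replacing \<open>t\<close> by its negative inverts $q$.
\<close>

definition twist :: "sign \<Rightarrow> complex \<Rightarrow> complex" where
  "twist s t = (case s of Pls \<Rightarrow> - t | Mns \<Rightarrow> t)"

text \<open>
  In the reversed indices \<open>a = 1 - k\<close> and \<open>b = 1 - j\<close> a raising generator increases one of \<open>a\<close> and
  \<open>b\<close>, exactly as a lowering generator increases \<open>j\<close> or \<open>k\<close>; the difference is the same.
\<close>

definition uvec :: "complex \<Rightarrow> sign \<Rightarrow> int \<Rightarrow> int \<Rightarrow> combination" where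
  "uvec t s a b = (case s of Pls \<Rightarrow> wvec t (1 - b) (1 - a) | Mns \<Rightarrow> wvec t a b)"

text \<open>
  The node at which a generator of the sign \<open>s\<close> increases the index \<open>a\<close> of a vector \<open>uvec t s a b\<close>.
\<close>

definition move_node :: "sign \<Rightarrow> int \<Rightarrow> node" where
  "move_node s a = of_int (- sg s * a)"

lemma move_node_eq_iff: "move_node s a = move_node s b \<longleftrightarrow> 4 dvd (a - b)"
  unfolding move_node_def of_int_node_eq_iff by (cases s) (simp_all add: dvd_diff_commute)

lemma generic_twist: "generic t \<Longrightarrow> generic (twist s t)"
  by (cases s) (simp_all add: twist_def generic_uminus)

lemma move_coeff_uminus: "widen_coeff (- t) d = widen_coeff t d"
    "narrow_coeff (- t) d = narrow_coeff t d"
  by (simp_all add: widen_coeff_def narrow_coeff_def qint_uminus_param)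

text \<open>
  The part of a matrix coefficient that depends on the node and the mode. For a sequence of moves
  these parts are independent of the order in which the two boxes move, unlike the coefficients in
  \<open>d\<close>.
\<close>

definition widen_move :: "complex \<Rightarrow> sign \<Rightarrow> node \<Rightarrow> int \<Rightarrow> int \<Rightarrow> complex" where
  "widen_move t s i r a = (if i = move_node s a then qpow (twist s t) (of_int (r * (a + 1))) else 0)"

definition narrow_move :: "complex \<Rightarrow> sign \<Rightarrow> node \<Rightarrow> int \<Rightarrow> int \<Rightarrow> complex" where
  "narrow_move t s i r b = (if i = move_node s b then qpow (twist s t) (of_int (r * (b - 1))) else 0)"

text \<open>
  From here on both signs are treated together, with $q$ replaced by $q^{-1}$ for the raising
  generators.
\<close>

lemma gen_action_uvec:
  assumes "generic t"
  shows "gen_action t (Gen_x s i r) (uvec t s a b) =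
     vscale (widen_coeff t (a - b) * widen_move t s i r a) (uvec t s (a + 1) b)
   + vscale (narrow_coeff t (a - b) * narrow_move t s i r b) (uvec t s a (b + 1))"
proof (cases s)
  case Mns
  thus ?thesis by (simp add: uvec_def lower_wvec[OF assms] vwhen_def widen_move_def narrow_move_def
      move_node_def
        twist_def vscale_simps)
next
  case Pls
  have e: "1 - b - (1 - a) = a - b" "1 - a - 1 = - a" "1 - b - 1 = - b" "1 - (1 + a) = - a"
    "1 - (1 + b) = - b" "1 - a - 2 = - (a + 1)" "1 - b = - (b - 1)" by simp_all
  have f: "uvec t Pls (a + 1) b = wvec t (1 - b) (1 - a - 1)"
    "uvec t Pls a (b + 1) = wvec t (1 - b - 1) (1 - a)" by (simp_all add: uvec_def)
  have g: "qpow t (of_int (r * (- x))) = qpow (- t) (of_int (r * x))" for x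
    by (simp add: qpow_uminus_param)
  have n: "move_node Pls a = of_int (1 - a - 1)" "move_node Pls b = of_int (1 - b - 1)"
      by (simp_all add: move_node_def)
  have p: "r * (1 - a - 2) = r * (- (a + 1))" "r * (1 - b) = r * (- (b - 1))" by simp_all
  have "gen_action t (Gen_x Pls i r) (uvec t Pls a b)
    = vwhen (i = move_node Pls a) (widen_coeff t (a - b)
        * qpow (- t) (of_int (r * (a + 1)))) (uvec t Pls (a + 1) b)
    + vwhen (i = move_node Pls b) (narrow_coeff t (a - b)
        * qpow (- t) (of_int (r * (b - 1)))) (uvec t Pls a (b + 1))"
    unfolding f n using raise_wvec[OF assms, of i r "1 - b" "1 - a"]
    unfolding e(1) p g by (simp only: uvec_def sign.case)
  thus ?thesis unfolding Pls
    by (simp add: vwhen_def widen_move_def narrow_move_def twist_def vscale_simps)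
qed

section \<open>Quadratic and Serre relations\<close>

text \<open>
  Both summands equal $\pm q^n (q - q^{-1}) [m]_q [n]_q$.
\<close>

lemma qint_exchange:
  assumes "generic t"
  shows "qint t m * (1 - qpow t (of_int (2 * n))) + qint t n
      * (qpow t (of_int (m + n)) - qpow t (of_int (n - m))) = 0"
proof -
  define y z where "y = qpow t (of_int m)" and "z = qpow t (of_int n)"
  have nz: "y \<noteq> 0" "z \<noteq> 0" by (simp_all add: y_def z_def)
  have "qpow t (of_int (2 * n)) = z * z" "qpow t (of_int (m + n)) = y * z"
      "qpow t (of_int (n - m)) = z / y"
    "qpow t (- of_int m) = inverse y" "qpow t (- of_int n) = inverse z"
    unfolding y_def z_def divide_inverse qpow_minus[symmetric] qpow_add[symmetric]
    by simp_all
  thus ?thesis using nz unfolding qint_def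
    by (simp flip: y_def z_def add: add_divide_distrib[symmetric]) (simp add: field_simps)
qed

text \<open>
  The entry of the Cartan matrix at two nodes whose representatives differ by \<open>d\<close>.
\<close>

definition cartan_diff :: "int \<Rightarrow> int" where
  "cartan_diff d = (if 4 dvd d then 2 else if 4 dvd (d - 1) \<or> 4 dvd (d + 1) then -1 else 0)"

lemma cartan_move_node: "cartan_matrix (move_node s a) (move_node s b) = cartan_diff (a - b)"
proof -
  have "move_node s a + 1 = of_int (- sg s * a + 1)" "move_node s a - 1 = of_int (- sg s * a - 1)"
    by (simp_all add: move_node_def)
  hence 1: "move_node s b = move_node s a + 1 \<longleftrightarrow> 4 dvd (- sg s * b - (- sg s * a + 1))"
    "move_node s b = move_node s a - 1 \<longleftrightarrow> 4 dvd (- sg s * b - (- sg s * a - 1))"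
    by (simp_all only: move_node_def of_int_node_eq_iff)
  show ?thesis
    unfolding cartan_matrix_def cartan_diff_def move_node_eq_iff 1 by (cases s; simp; presburger)
qed

text \<open>
  The identity that makes the two orders of moving both boxes compatible with the quadratic
  relation. In each residue class of \<open>d\<close> modulo 4 it is trivial or an instance of \<open>qint_exchange\<close>.
\<close>

lemma quadratic_coefficient:
  assumes g: "generic t" and d: "d = a - b"
  shows "widen_coeff t d * narrow_coeff t (d + 1)
      * (qpow t (of_int (b - 1)) - qpow t (of_int (- cartan_diff d)) * qpow t (of_int (a + 1)))
    + narrow_coeff t d * widen_coeff t (d - 1)
        * (qpow t (of_int (a + 1)) - qpow t (of_int (- cartan_diff d)) * qpow t (of_int (b - 1))) = 0"
    (is "?L = 0")
proof (cases "d < 0")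
  case True
  thus ?thesis by (simp add: widen_coeff_def narrow_coeff_def)
next
  case False
  let ?G = "qpow t (of_int (- cartan_diff d))" and ?Q = "qpow t (of_int (b - 1))"
  have 1: "qpow t (of_int (a + 1)) = ?Q * qpow t (of_int (d + 2))" and
    2: "?G * qpow t (of_int (d + 2)) = qpow t (of_int (d + 2 - cartan_diff d))"
    unfolding qpow_add[symmetric] of_int_add[symmetric] by (simp_all add: d algebra_simps)
  have L: "?L = ?Q * (widen_coeff t d * narrow_coeff t (d + 1)
      * (1 - qpow t (of_int (d + 2 - cartan_diff d)))
      + narrow_coeff t d * widen_coeff t (d - 1) * (qpow t (of_int (d + 2)) - ?G))"
    unfolding 1 2[symmetric] by (simp only: algebra_simps mult_1_left)
  have "d mod 4 = 0 \<or> d mod 4 = 1 \<or> d mod 4 = 2 \<or> d mod 4 = 3" by presburger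
  then consider (zero) s where "d = 4 * s" "s \<ge> 0" | (one) s where "d = 4 * s + 1" "s \<ge> 0"
    | (two) s where "d = 4 * s + 2" "s \<ge> 0" | (three) s where "d = 4 * s + 3" "s \<ge> 0"
    using False by (elim disjE) (metis (no_types) mult_div_mod_eq add_0_right not_less
        pos_imp_zdiv_nonneg_iff zero_less_numeral)+
  thus ?thesis
  proof cases
    case (zero s)
    have AB: "cartan_diff d = 2" "widen_coeff t d = qint t (2 * s + 2) / qint t (2 * s + 1)"
      "narrow_coeff t (d + 1) = 1"
      using zero by (simp_all add: cartan_diff_def widen_coeff_def narrow_coeff_def, presburger+)
    show ?thesis
    proof (cases "s = 0")
      case True
      thus ?thesis unfolding L unfolding AB using zero by (simp add: narrow_coeff_def)
    next
      case False
      have BA: "narrow_coeff t d = qint t (2 * s) / qint t (2 * s + 1)" "widen_coeff t (d - 1) = 1"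
        using zero False by (simp_all add: widen_coeff_def narrow_coeff_def, presburger+)
      have "qint t (2 * s + 2) * (1 - qpow t (of_int (d + 2 - 2)))
          + qint t (2 * s) * (qpow t (of_int (d + 2)) - qpow t (of_int (- 2))) = 0"
        using qint_exchange[OF g, of "2 * s + 2" "2 * s"] zero by simp
      thus ?thesis unfolding L unfolding AB BA
        by (simp only: mult_1_right times_divide_eq_left add_divide_distrib[symmetric] div_0
            mult_zero_right)
    qed
  next
    case (one s)
    have AB: "cartan_diff d = - 1" "widen_coeff t d = 1" "narrow_coeff t (d + 1) = 1"
        "narrow_coeff t d = 1"
      "widen_coeff t (d - 1) = qint t (2 * s + 2) / qint t (2 * s + 1)"
      using one by (simp_all add: cartan_diff_def widen_coeff_def narrow_coeff_def, presburger+)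
    have clear: "x + y / z * w = 0" if "z * x + y * w = 0" "z \<noteq> 0" for x y z w :: complex
      using that by (simp add: field_simps)
    have "1 - qpow t (of_int (d + 2 - - 1)) + qint t (2 * s + 2) / qint t (2 * s + 1)
        * (qpow t (of_int (d + 2)) - qpow t (of_int (- (- 1)))) = 0"
      by (rule clear) (use one qint_exchange[OF g, of "2 * s + 1" "2 * s + 2"] in
          \<open>simp_all add: qint_nonzero[OF g] algebra_simps\<close>)
    thus ?thesis unfolding L unfolding AB by (simp only: mult_1_right mult_1_left mult_zero_right)
  next
    case (two s)
    have "cartan_diff d = 0" "widen_coeff t d = 1" "narrow_coeff t (d + 1) = 1"
        "narrow_coeff t d = 1" "widen_coeff t (d - 1) = 1"
      using two by (simp_all add: cartan_diff_def widen_coeff_def narrow_coeff_def, presburger+)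
    thus ?thesis unfolding L by simp
  next
    case (three s)
    have AB: "cartan_diff d = - 1" "widen_coeff t d = 1"
        "narrow_coeff t (d + 1) = qint t (2 * s + 2) / qint t (2 * s + 3)"
       "narrow_coeff t d = 1" "widen_coeff t (d - 1) = 1"
      using three by (simp_all add: cartan_diff_def widen_coeff_def narrow_coeff_def add.commute,
          presburger+)
    have clear: "y / z * w + x = 0" if "y * w + z * x = 0" "z \<noteq> 0" for x y z w :: complex
      using that by (simp add: field_simps)
    have "qint t (2 * s + 2) / qint t (2 * s + 3) * (1 - qpow t (of_int (d + 2 - - 1)))
        + (qpow t (of_int (d + 2)) - qpow t (of_int (- (- 1)))) = 0"
      by (rule clear) (use three qint_exchange[OF g, of "2 * s + 2" "2 * s + 3"] in
          \<open>simp_all add: qint_nonzero[OF g] algebra_simps\<close>)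
    thus ?thesis unfolding L unfolding AB by (simp only: mult_1_right mult_1_left mult_zero_right)
  qed
qed

text \<open>
  An instance of $[2]_q [n]_q = [n+1]_q + [n-1]_q$; the only arithmetic behind the Serre relations.
\<close>

lemma widen_narrow_sum:
  assumes g: "generic t" and "4 dvd d" "d \<ge> 0"
  shows "widen_coeff t d + narrow_coeff t d = qint t 2"
proof -
  have "qint t (d div 2 + 1) \<noteq> 0" using assms by (intro qint_nonzero[OF g]) auto
  moreover have "narrow_coeff t d = qint t (d div 2) / qint t (d div 2 + 1)"
    using assms by (cases "d = 0") (simp_all add: narrow_coeff_def)
  ultimately show ?thesis
    using qint_two_mult[OF g, of "d div 2 + 1"] assms by (simp add: widen_coeff_def field_simps)
qed

text \<open>
  The four ways in which two moves at one node and one move at a neighbouring node can end: two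
  moves of the widening box, the first or the second of them at the repeated node, and the same for
  the narrowing box.
\<close>

lemma serre_coefficients:
  assumes g: "generic t"
  shows "4 dvd (d + 1) \<Longrightarrow> widen_coeff t d * widen_coeff t (d + 1) * narrow_coeff t (d + 2)
      + widen_coeff t d * narrow_coeff t (d + 1) * widen_coeff t d
      = qint t 2 * (narrow_coeff t d * widen_coeff t (d - 1) * widen_coeff t d)"
    and "4 dvd d \<Longrightarrow> widen_coeff t d * narrow_coeff t (d + 1) * widen_coeff t d + narrow_coeff t d
        * widen_coeff t (d - 1) * widen_coeff t d
      = qint t 2 * (widen_coeff t d * widen_coeff t (d + 1) * narrow_coeff t (d + 2))"
    and "4 dvd (d - 1) \<Longrightarrow> narrow_coeff t d * narrow_coeff t (d - 1) * widen_coeff t (d - 2)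
        + narrow_coeff t d * widen_coeff t (d - 1) * narrow_coeff t d
      = qint t 2 * (widen_coeff t d * narrow_coeff t (d + 1) * narrow_coeff t d)"
    and "4 dvd d \<Longrightarrow> narrow_coeff t d * widen_coeff t (d - 1) * narrow_coeff t d + widen_coeff t d
        * narrow_coeff t (d + 1) * narrow_coeff t d
      = qint t 2 * (narrow_coeff t d * narrow_coeff t (d - 1) * widen_coeff t (d - 2))"
proof -
  have one: "widen_coeff t x = 1" if "x \<ge> 0" "\<not> 4 dvd x" for x using that by (simp add: widen_coeff_def)
  have one': "narrow_coeff t x = 1" if "x \<ge> 0" "\<not> 4 dvd x" for x using that
      by (auto simp: narrow_coeff_def)
  have neg: "widen_coeff t x = 0" if "x < 0" for x using that by (simp add: widen_coeff_def)
  have neg': "narrow_coeff t x = 0" if "x \<le> 0" for x using that by (simp add: narrow_coeff_def)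
  show "widen_coeff t d * widen_coeff t (d + 1) * narrow_coeff t (d + 2) + widen_coeff t d
      * narrow_coeff t (d + 1) * widen_coeff t d
      = qint t 2 * (narrow_coeff t d * widen_coeff t (d - 1) * widen_coeff t d)" if D: "4 dvd (d + 1)"
  proof (cases "d < 0")
    case False
    with D have "d \<ge> 1" by presburger
    moreover have "\<not> 4 dvd d" "\<not> 4 dvd (d + 2)" "\<not> 4 dvd (d - 1)" using D by presburger+
    ultimately show ?thesis using widen_narrow_sum[OF g D] by (simp add: one one')
  qed (simp add: neg)
  show "widen_coeff t d * narrow_coeff t (d + 1) * widen_coeff t d + narrow_coeff t d
      * widen_coeff t (d - 1) * widen_coeff t d
      = qint t 2 * (widen_coeff t d * widen_coeff t (d + 1) * narrow_coeff t (d + 2))" if D: "4 dvd d"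
  proof (cases "d < 0")
    case False
    have "\<not> 4 dvd (d + 1)" "\<not> 4 dvd (d + 2)" "\<not> 4 dvd (d - 1)" using D by presburger+
    thus ?thesis using False widen_narrow_sum[OF g D]
      by (cases "d = 0") (simp_all add: one one' neg' flip: distrib_right)
  qed (simp add: neg)
  show "narrow_coeff t d * narrow_coeff t (d - 1) * widen_coeff t (d - 2) + narrow_coeff t d
      * widen_coeff t (d - 1) * narrow_coeff t d
      = qint t 2 * (widen_coeff t d * narrow_coeff t (d + 1) * narrow_coeff t d)" if D: "4 dvd (d - 1)"
  proof (cases "d \<le> 0")
    case False
    have "\<not> 4 dvd d" "\<not> 4 dvd (d + 1)" "\<not> 4 dvd (d - 2)" using D by presburger+
    thus ?thesis using False widen_narrow_sum[OF g D]
      by (cases "d = 1") (simp_all add: one one' neg' add.commute)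
  qed (simp add: neg')
  show "narrow_coeff t d * widen_coeff t (d - 1) * narrow_coeff t d + widen_coeff t d
      * narrow_coeff t (d + 1) * narrow_coeff t d
      = qint t 2 * (narrow_coeff t d * narrow_coeff t (d - 1) * widen_coeff t (d - 2))" if D: "4 dvd d"
  proof (cases "d \<le> 0")
    case False
    with D have "d \<ge> 4" by presburger
    moreover have "\<not> 4 dvd (d - 1)" "\<not> 4 dvd (d + 1)" "\<not> 4 dvd (d - 2)" using D by presburger+
    ultimately show ?thesis using False widen_narrow_sum[OF g D]
      by (simp add: one one' flip: distrib_right) (simp add: add.commute)
  qed (simp add: neg')
qed

lemma VM_act_diff_left: "VM_act t (a - b) v = VM_act t a v - VM_act t b v"
  using VM_act_add_left[of t "a - b" b v] by (simp add: algebra_simps)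

abbreviation drinfeld :: "complex \<Rightarrow> sign \<Rightarrow> node \<Rightarrow> int \<Rightarrow> combination \<Rightarrow> combination" where
  "drinfeld t s i r \<equiv> gen_action t (Gen_x s i r)"

text \<open>
  Two moves end at three possible pairs, and only the middle one is reached in two ways.
\<close>

lemma two_moves:
  assumes "generic t"
  shows "drinfeld t s i r (drinfeld t s j r' (uvec t s a b)) =
     vscale (widen_coeff t (a - b) * widen_coeff t (a - b + 1)
         * (widen_move t s j r' a * widen_move t s i r (a + 1))) (uvec t s (a + 2) b)
   + vscale (widen_coeff t (a - b) * narrow_coeff t (a - b + 1)
       * (widen_move t s j r' a * narrow_move t s i r b)
       + narrow_coeff t (a - b) * widen_coeff t (a - b - 1)
           * (narrow_move t s j r' b * widen_move t s i r a)) (uvec t s (a + 1) (b + 1))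
   + vscale (narrow_coeff t (a - b) * narrow_coeff t (a - b - 1)
       * (narrow_move t s j r' b * narrow_move t s i r (b + 1))) (uvec t s a (b + 2))"
proof -
  have e: "a + 1 - b = a - b + 1" "a - (b + 1) = a - b - 1" "a + 1 + 1 = a + 2" "b + 1 + 1 = b + 2"
    by simp_all
  show ?thesis
    unfolding gen_action_uvec[OF assms] gen_action_add gen_action_scale e
    by (simp add: vscale_simps mult_ac add_ac)
qed

text \<open>
  Each of the two middle end points is reached in three ways, according to the position of the odd
  move.
\<close>

lemma three_moves:
  assumes "generic t"
  shows "drinfeld t s i r (drinfeld t s j r' (drinfeld t s l r'' (uvec t s a b))) =
     vscale (widen_coeff t (a - b) * widen_coeff t (a - b + 1) * widen_coeff t (a - b + 2)
       * (widen_move t s l r'' a * widen_move t s j r' (a + 1)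
           * widen_move t s i r (a + 2))) (uvec t s (a + 3) b)
   + vscale (widen_coeff t (a - b) * widen_coeff t (a - b + 1) * narrow_coeff t (a - b + 2)
         * (widen_move t s l r'' a * widen_move t s j r' (a + 1) * narrow_move t s i r b)
       + widen_coeff t (a - b) * narrow_coeff t (a - b + 1) * widen_coeff t (a - b)
         * (widen_move t s l r'' a * narrow_move t s j r' b * widen_move t s i r (a + 1))
       + narrow_coeff t (a - b) * widen_coeff t (a - b - 1) * widen_coeff t (a - b)
         * (narrow_move t s l r'' b * widen_move t s j r' a
             * widen_move t s i r (a + 1))) (uvec t s (a + 2) (b + 1))
   + vscale (narrow_coeff t (a - b) * narrow_coeff t (a - b - 1) * widen_coeff t (a - b - 2)
         * (narrow_move t s l r'' b * narrow_move t s j r' (b + 1) * widen_move t s i r a)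
       + narrow_coeff t (a - b) * widen_coeff t (a - b - 1) * narrow_coeff t (a - b)
         * (narrow_move t s l r'' b * widen_move t s j r' a * narrow_move t s i r (b + 1))
       + widen_coeff t (a - b) * narrow_coeff t (a - b + 1) * narrow_coeff t (a - b)
         * (widen_move t s l r'' a * narrow_move t s j r' b
             * narrow_move t s i r (b + 1))) (uvec t s (a + 1) (b + 2))
   + vscale (narrow_coeff t (a - b) * narrow_coeff t (a - b - 1) * narrow_coeff t (a - b - 2)
       * (narrow_move t s l r'' b * narrow_move t s j r' (b + 1)
           * narrow_move t s i r (b + 2))) (uvec t s a (b + 3))"
proof -
  have e: "a + 1 - b = a - b + 1" "a - (b + 1) = a - b - 1" "a + 1 + 1 = a + 2" "b + 1 + 1 = b + 2"
    "a + 1 - (b + 1) = a - b" "a + 2 - b = a - b + 2" "a - (b + 2) = a - b - 2"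
    "a + 2 + 1 = a + 3" "b + 2 + 1 = b + 3"
    by simp_all
  show ?thesis
    unfolding two_moves[OF assms] gen_action_uvec[OF assms] gen_action_add gen_action_scale e
    by (rule poly_mapping_eqI)
       (simp only: lookup_add lookup_vscale distrib_left distrib_right mult_ac add_ac)
qed

lemma widen_move_next_mode: "widen_move t s i (r + 1) a
    = qpow (twist s t) (of_int (a + 1)) * widen_move t s i r a"
  and narrow_move_next_mode: "narrow_move t s i (r + 1) b
      = qpow (twist s t) (of_int (b - 1)) * narrow_move t s i r b"
  by (simp_all add: widen_move_def narrow_move_def algebra_simps flip: qpow_add)

lemma move_coeff_twist: "widen_coeff (twist s t) d = widen_coeff t d"
    "narrow_coeff (twist s t) d = narrow_coeff t d"
  by (cases s; simp add: twist_def move_coeff_uminus)+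

lemma qpow_twist: "qpow t (of_int (sg s * n)) = qpow (twist s t) (of_int (- n))"
  by (cases s) (simp_all add: twist_def qpow_uminus_param)

text \<open>
  The sum of the four terms of the quadratic relation, sorted by the end point. The letters stand
  for the node-dependent parts of the moves and for powers of $q$; kept abstract, they let ring
  normalisation finish quickly.
\<close>

lemma quadratic_scalar:
  fixes G :: complex
  defines "K \<equiv> \<lambda>cAB cBA x1 y0. cAB * (y0 - G * x1) + cBA * (x1 - G * y0)"
  shows "cAA * (aj * (x2 * ai')) * U + (cAB * (aj * (y0 * bi)) + cBA * (bj * (x1 * ai))) * V + cBB
      * (bj * (y1 * bi')) * W
   - G * (cAA * ((x1 * ai) * aj') * U + (cAB * ((x1 * ai) * bj) + cBA * ((y0 * bi) * aj)) * V + cBB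
       * ((y0 * bi) * bj') * W)
   - G * (cAA * ((x1 * aj) * ai') * U + (cAB * ((x1 * aj) * bi) + cBA * ((y0 * bj) * ai)) * V + cBB
       * ((y0 * bj) * bi') * W)
   + (cAA * (ai * (x2 * aj')) * U + (cAB * (ai * (y0 * bj)) + cBA * (bi * (x1 * aj))) * V + cBB
       * (bi * (y1 * bj')) * W)
   = cAA * U * (aj * ai' * (x2 - G * x1) + ai * aj' * (x2 - G * x1))
   + cBB * W * (bj * bi' * (y1 - G * y0) + bi * bj' * (y1 - G * y0))
   + V * (aj * bi * K cAB cBA x1 y0 + ai * bj * K cAB cBA x1 y0)"
  unfolding K_def by (simp only: algebra_simps)

text \<open>
  If one box makes both moves, they belong to neighbouring nodes and their spectral parameters
  differ by the factor $q$, so the relation holds term by term. If each box makes one move,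
  \<open>quadratic_coefficient\<close> applies.
\<close>

lemma quadratic_on_uvec:
  assumes g: "generic t"
  assumes G_def: "G = qpow t (of_int (sg s * cartan_matrix i j))"
  shows "drinfeld t s i (r + 1) (drinfeld t s j r' (uvec t s a b))
      - vscale G (drinfeld t s j r' (drinfeld t s i (r + 1) (uvec t s a b)))
    = vscale G (drinfeld t s i r (drinfeld t s j (r' + 1) (uvec t s a b)))
      - drinfeld t s j (r' + 1) (drinfeld t s i r (uvec t s a b))"
proof (rule poly_mapping_eqI)
  fix x
  define q where "q n = qpow (twist s t) (of_int n)" for n
  have G: "G = q (- cartan_matrix i j)"
    unfolding G_def q_def by (rule qpow_twist)
  have sym: "cartan_matrix i j = cartan_matrix j i"
    unfolding cartan_matrix_def using exhaust_4[of i] exhaust_4[of j] by (elim disjE) simp_all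
  have q1: "q (m + 1) = q m * q 1" for m
    unfolding q_def by (simp add: qpow_add)
  have qa: "q (a + 2) = q 1 * q (a + 1)" and qb: "q b = q 1 * q (b - 1)"
    using q1[of "a + 1"] q1[of "b - 1"] by (simp_all add: add.assoc)
  have step: "cartan_diff (- 1) = - 1" "cartan_diff 1 = - 1" by (simp_all add: cartan_diff_def)
  have C1: "move_node s' k = i \<and> move_node s' (k + 1) = j \<or> move_node s' k
      = j \<and> move_node s' (k + 1) = i \<Longrightarrow> cartan_matrix i j = - 1" for s' k
    using cartan_move_node[of s' k "k + 1"] sym step by auto
  have A: "widen_move t s j r' a * widen_move t s i r (a + 1) * (q (a + 2) - G * q (a + 1)) = 0"
    "widen_move t s i r a * widen_move t s j r' (a + 1) * (q (a + 2) - G * q (a + 1)) = 0"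
    using C1[of s a] by (auto simp: widen_move_def G qa)
  have B: "narrow_move t s j r' b * narrow_move t s i r (b + 1) * (q b - G * q (b - 1)) = 0"
    "narrow_move t s i r b * narrow_move t s j r' (b + 1) * (q b - G * q (b - 1)) = 0"
    using C1[of s b] by (auto simp: narrow_move_def G qb)
  let ?K = "widen_coeff t (a - b) * narrow_coeff t (a - b + 1) * (q (b - 1) - G * q (a + 1))
    + narrow_coeff t (a - b) * widen_coeff t (a - b - 1) * (q (a + 1) - G * q (b - 1))"
  \<comment> \<open>Only pairs of nodes that both boxes can serve matter; there the Cartan entry is a function of
      \<open>a - b\<close>.\<close>
  have K: "?K = 0" if "move_node s a = j \<and> move_node s b = i \<or> move_node s a = i \<and> move_node s b = j"
  proof -
    have "cartan_matrix i j = cartan_diff (a - b)" using that sym cartan_move_node[of s a b] by auto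
    thus ?thesis
      using quadratic_coefficient[OF generic_twist[OF g, of s], of "a - b" a b]
      by (simp add: move_coeff_twist G q_def)
  qed
  have AB: "widen_move t s j r' a * narrow_move t s i r b * ?K = 0"
      "widen_move t s i r a * narrow_move t s j r' b * ?K = 0"
    using K by (auto simp: widen_move_def narrow_move_def)
  let ?U = "\<lambda>a b. Poly_Mapping.lookup (uvec t s a b) x"
  have e: "a + 1 + 1 = a + 2" "b + 1 - 1 = b" by simp_all
  have "Poly_Mapping.lookup (drinfeld t s i (r + 1) (drinfeld t s j r' (uvec t s a b))) x
      - G * Poly_Mapping.lookup (drinfeld t s j r' (drinfeld t s i (r + 1) (uvec t s a b))) x
      - G * Poly_Mapping.lookup (drinfeld t s i r (drinfeld t s j (r' + 1) (uvec t s a b))) x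
      + Poly_Mapping.lookup (drinfeld t s j (r' + 1) (drinfeld t s i r (uvec t s a b))) x
    = widen_coeff t (a - b) * widen_coeff t (a - b + 1) * ?U (a + 2) b *
        (widen_move t s j r' a * widen_move t s i r (a + 1) * (q (a + 2) - G * q (a + 1))
        + widen_move t s i r a * widen_move t s j r' (a + 1) * (q (a + 2) - G * q (a + 1)))
    + narrow_coeff t (a - b) * narrow_coeff t (a - b - 1) * ?U a (b + 2) *
        (narrow_move t s j r' b * narrow_move t s i r (b + 1) * (q b - G * q (b - 1))
        + narrow_move t s i r b * narrow_move t s j r' (b + 1) * (q b - G * q (b - 1)))
    + ?U (a + 1) (b + 1) * (widen_move t s j r' a * narrow_move t s i r b * ?K
        + widen_move t s i r a * narrow_move t s j r' b * ?K)"
    unfolding two_moves[OF g] widen_move_next_mode narrow_move_next_mode lookup_add lookup_vscale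
        q_def[symmetric] e
    by (rule quadratic_scalar)
  also have "\<dots> = 0" unfolding A B AB by simp
  finally show "Poly_Mapping.lookup (drinfeld t s i (r + 1) (drinfeld t s j r' (uvec t s a b))
      - vscale G (drinfeld t s j r' (drinfeld t s i (r + 1) (uvec t s a b)))) x
    = Poly_Mapping.lookup (vscale G (drinfeld t s i r (drinfeld t s j (r' + 1) (uvec t s a b)))
      - drinfeld t s j (r' + 1) (drinfeld t s i r (uvec t s a b))) x"
    by (simp add: lookup_minus algebra_simps)
qed

text \<open>
  Consecutive moves of one box belong to neighbouring nodes. So each generator moves a different
  box, and the difference of the pair is 2 modulo 4, where all coefficients along both orders are 1
  unless the vector itself is 0.
\<close>

lemma commute_on_uvec:
  assumes g: "generic t" and ij: "i \<noteq> j" "i \<noteq> j + 1" "i \<noteq> j - 1"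
  shows "drinfeld t s i r (drinfeld t s j r' (uvec t s a b))
      = drinfeld t s j r' (drinfeld t s i r (uvec t s a b))"
proof -
  have C: "cartan_matrix i j = 0" "cartan_matrix j i = 0"
  proof -
    have "j \<noteq> i + 1" "j \<noteq> i - 1" using ij(2,3) by auto
    thus "cartan_matrix i j = 0" "cartan_matrix j i = 0"
      using ij by (simp_all add: cartan_matrix_def)
  qed
  have "cartan_diff (- 1) = - 1" "cartan_diff 1 = - 1" by (simp_all add: cartan_diff_def)
  hence N: "\<not> (move_node s k = i \<and> move_node s (k + 1) = j)"
      "\<not> (move_node s k = j \<and> move_node s (k + 1) = i)" for k
    using cartan_move_node[of s k "k + 1"] C by auto
  have z: "widen_move t s j r' a * widen_move t s i r (a + 1) = 0"
      "widen_move t s i r a * widen_move t s j r' (a + 1) = 0"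
    "narrow_move t s j r' b * narrow_move t s i r (b + 1) = 0"
        "narrow_move t s i r b * narrow_move t s j r' (b + 1) = 0"
    using N by (auto simp: widen_move_def narrow_move_def)
  have c: "widen_coeff t (a - b) * narrow_coeff t (a - b + 1)
      = narrow_coeff t (a - b) * widen_coeff t (a - b - 1)"
    if "move_node s a = j \<and> move_node s b = i \<or> move_node s a = i \<and> move_node s b = j"
  proof -
    have "cartan_diff (a - b) = 0" using that C cartan_move_node[of s a b] by auto
    hence n: "\<not> 4 dvd (a - b)" "\<not> 4 dvd (a - b - 1)" "\<not> 4 dvd (a - b + 1)"
      by (auto simp: cartan_diff_def split: if_splits)
    show ?thesis
    proof (cases "a - b \<le> 0")
      case True
      hence "a - b < 0" using n(1) by (cases "a = b") auto
      thus ?thesis by (simp add: widen_coeff_def narrow_coeff_def)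
    next
      case False
      thus ?thesis using n by (simp add: widen_coeff_def narrow_coeff_def)
    qed
  qed
  have ab: "widen_coeff t (a - b) * narrow_coeff t (a - b + 1)
      * (widen_move t s j r' a * narrow_move t s i r b)
      = narrow_coeff t (a - b) * widen_coeff t (a - b - 1)
          * (narrow_move t s i r b * widen_move t s j r' a)"
    "widen_coeff t (a - b) * narrow_coeff t (a - b + 1) * (widen_move t s i r a * narrow_move t s j r' b)
      = narrow_coeff t (a - b) * widen_coeff t (a - b - 1)
          * (narrow_move t s j r' b * widen_move t s i r a)"
    using c by (auto simp: widen_move_def narrow_move_def)
  show ?thesis unfolding two_moves[OF g] z ab by (simp add: add.commute)
qed

text \<open>
  The six words of the Serre relation for an end point that is reached in three ways with the
  coefficients \<open>x\<close>, \<open>y\<close>, \<open>z\<close>. A box cannot make two consecutive moves at the same node, which is the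
  content of the first two hypotheses; then only two combinations of coefficients remain.
\<close>

lemma serre_scalar:
  fixes x y z c :: complex
  assumes "p1 * p2' = 0" "p2 * p1' = 0"
    and "P * (p1' * s2 + p2' * s1) * (x + y - c * z) = 0"
        "P' * (p1 * s2 + p2 * s1) * (y + z - c * x) = 0"
  shows "((x * (P * p2' * s1) + y * (P * s2 * p1') + z * (S * p2 * p1'))
      - c * (x * (p2 * P' * s1) + y * (p2 * S * p1') + z * (s2 * P * p1'))
      + (x * (p2 * p1' * S) + y * (p2 * s1 * P') + z * (s2 * p1 * P')))
    + ((x * (P * p1' * s2) + y * (P * s1 * p2') + z * (S * p1 * p2'))
      - c * (x * (p1 * P' * s2) + y * (p1 * S * p2') + z * (s1 * P * p2'))
      + (x * (p1 * p2' * S) + y * (p1 * s2 * P') + z * (s1 * p2 * P'))) = 0" (is "?L = 0")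
proof -
  have "?L = P * (p1' * s2 + p2' * s1) * (x + y - c * z) + P' * (p1 * s2 + p2 * s1) * (y + z - c * x)
     + (p2 * p1') * (S * z - c * S * y + S * x) + (p1 * p2') * (S * z - c * S * y + S * x)"
    by (simp only: algebra_simps)
  thus ?thesis unfolding assms by simp
qed

lemma move_node_step: "move_node s (a + 1) \<noteq> move_node s a" "move_node s (a + 2) \<noteq> move_node s a"
    "move_node s (a + 2) \<noteq> move_node s (a + 1)"
  by (simp_all add: move_node_eq_iff)

text \<open>
  In every contributing sequence one box makes two moves, one at each node, and the other box makes
  one move at the repeated node. Four end points remain possible, one for each identity of
  \<open>serre_coefficients\<close>.
\<close>

lemma serre_on_uvec:
  fixes s i j r' a b
  assumes g: "generic t"
  defines "W \<equiv> \<lambda>r1 r2. drinfeld t s i r1 (drinfeld t s i r2 (drinfeld t s j r' (uvec t s a b)))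
      - vscale (qint t 2) (drinfeld t s i r1 (drinfeld t s j r' (drinfeld t s i r2 (uvec t s a b))))
      + drinfeld t s j r' (drinfeld t s i r1 (drinfeld t s i r2 (uvec t s a b)))"
  shows "W r1 r2 + W r2 r1 = 0"
proof (rule poly_mapping_eqI)
  fix x
  have zero: "widen_move t s i q a * widen_move t s i q' (a + 1) = 0"
      "narrow_move t s i q b * narrow_move t s i q' (b + 1) = 0"
    "widen_move t s j q a * widen_move t s i q' (a + 1) * widen_move t s i q'' (a + 2) = 0"
    "widen_move t s i q a * widen_move t s j q' (a + 1) * widen_move t s i q'' (a + 2) = 0"
    "widen_move t s i q a * widen_move t s i q' (a + 1) * widen_move t s j q'' (a + 2) = 0"
    "narrow_move t s j q b * narrow_move t s i q' (b + 1) * narrow_move t s i q'' (b + 2) = 0"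
    "narrow_move t s i q b * narrow_move t s j q' (b + 1) * narrow_move t s i q'' (b + 2) = 0"
    "narrow_move t s i q b * narrow_move t s i q' (b + 1) * narrow_move t s j q'' (b + 2) = 0"
        for q q' q''
    using move_node_step[of s a] move_node_step[of s b] by (auto simp: widen_move_def narrow_move_def)
  define d where "d = a - b"
  note sc = serre_coefficients[OF g, of d]
  have 1: "widen_move t s j r' a * (widen_move t s i r1 (a + 1) * narrow_move t s i r2 b
      + widen_move t s i r2 (a + 1) * narrow_move t s i r1 b)
      * (widen_coeff t d * widen_coeff t (d + 1) * narrow_coeff t (d + 2) + widen_coeff t d
          * narrow_coeff t (d + 1) * widen_coeff t d
      - qint t 2 * (narrow_coeff t d * widen_coeff t (d - 1) * widen_coeff t d)) = 0"
  proof (cases "4 dvd (d + 1)")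
    case False
    hence "move_node s (a + 1) \<noteq> move_node s b" by (simp add: move_node_eq_iff d_def algebra_simps)
    thus ?thesis by (auto simp: widen_move_def narrow_move_def)
  qed (simp add: sc)
  have 2: "widen_move t s j r' (a + 1) * (widen_move t s i r1 a * narrow_move t s i r2 b
      + widen_move t s i r2 a * narrow_move t s i r1 b)
      * (widen_coeff t d * narrow_coeff t (d + 1) * widen_coeff t d + narrow_coeff t d
          * widen_coeff t (d - 1) * widen_coeff t d
      - qint t 2 * (widen_coeff t d * widen_coeff t (d + 1) * narrow_coeff t (d + 2))) = 0"
  proof (cases "4 dvd d")
    case False
    hence "move_node s a \<noteq> move_node s b" by (simp add: move_node_eq_iff d_def algebra_simps)
    thus ?thesis by (auto simp: widen_move_def narrow_move_def)
  qed (simp add: sc)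
  have 3: "narrow_move t s j r' b * (narrow_move t s i r1 (b + 1) * widen_move t s i r2 a
      + narrow_move t s i r2 (b + 1) * widen_move t s i r1 a)
      * (narrow_coeff t d * narrow_coeff t (d - 1) * widen_coeff t (d - 2) + narrow_coeff t d
          * widen_coeff t (d - 1) * narrow_coeff t d
      - qint t 2 * (widen_coeff t d * narrow_coeff t (d + 1) * narrow_coeff t d)) = 0"
  proof (cases "4 dvd (d - 1)")
    case False
    hence "move_node s a \<noteq> move_node s (b + 1)" by (simp add: move_node_eq_iff d_def algebra_simps)
    thus ?thesis by (auto simp: widen_move_def narrow_move_def)
  qed (simp add: sc)
  have 4: "narrow_move t s j r' (b + 1) * (narrow_move t s i r1 b * widen_move t s i r2 a
      + narrow_move t s i r2 b * widen_move t s i r1 a)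
      * (narrow_coeff t d * widen_coeff t (d - 1) * narrow_coeff t d + widen_coeff t d
          * narrow_coeff t (d + 1) * narrow_coeff t d
      - qint t 2 * (narrow_coeff t d * narrow_coeff t (d - 1) * widen_coeff t (d - 2))) = 0"
  proof (cases "4 dvd d")
    case False
    hence "move_node s a \<noteq> move_node s b" by (simp add: move_node_eq_iff d_def algebra_simps)
    thus ?thesis by (auto simp: widen_move_def narrow_move_def)
  qed (simp add: sc)
  note S = serre_scalar[OF zero(1)[of r1 r2] zero(1)[of r2 r1] 1 2, of "narrow_move t s j r' b"]
    serre_scalar[OF zero(2)[of r1 r2] zero(2)[of r2 r1] 3 4, of "widen_move t s j r' a"]
  have combine: "(((t1 * U + v1 * V) - c * (t2 * U + v2 * V) + (t3 * U + v3 * V))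
      + ((t4 * U + v4 * V) - c * (t5 * U + v5 * V) + (t6 * U + v6 * V)) :: complex)
    = ((t1 - c * t2 + t3) + (t4 - c * t5 + t6)) * U + ((v1 - c * v2 + v3) + (v4 - c * v5 + v6)) * V"
    for t1 t2 t3 t4 t5 t6 v1 v2 v3 v4 v5 v6 c U V :: complex
    by (simp only: algebra_simps)
  show "Poly_Mapping.lookup (W r1 r2 + W r2 r1) x = Poly_Mapping.lookup 0 x"
    unfolding W_def three_moves[OF g] lookup_add lookup_minus lookup_vscale zero(3-8) d_def[symmetric]
      mult_zero_right mult_zero_left add_0_left add_0_right combine S
    by simp
qed

text \<open>
  Of three moves at the same node, two consecutive moves of one box would be needed.
\<close>

lemma cube_on_uvec:
  assumes "generic t"
  shows "drinfeld t s i r (drinfeld t s i r' (drinfeld t s i r'' (uvec t s a b))) = 0"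
proof -
  have "widen_move t s i q a * widen_move t s i q' (a + 1) * c = 0"
      "narrow_move t s i q b * narrow_move t s i q' (b + 1) * c = 0"
    "widen_move t s i q a * c * widen_move t s i q' (a + 1) = 0"
        "narrow_move t s i q b * c * narrow_move t s i q' (b + 1) = 0"
    "c * widen_move t s i q a * widen_move t s i q' (a + 1) = 0"
        "c * narrow_move t s i q b * narrow_move t s i q' (b + 1) = 0"
    for q q' c
    using move_node_step[of s a] move_node_step[of s b] by (auto simp: widen_move_def narrow_move_def)
  thus ?thesis unfolding three_moves[OF assms]
    by (simp only: vscale_simps mult_zero_right add_0_left add_0_right)
qed

section \<open>Relation between raising and lowering generators\<close>

text \<open>
  The two expansions of the rational function \<open>1 / (1 - p z)\<close>: in powers of $z$ for the sign plus,
  and in powers of $z^{-1}$ for the sign minus.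
\<close>

definition pole :: "complex \<Rightarrow> sign \<Rightarrow> complex fps" where
  "pole p s = (case s of Pls \<Rightarrow> Abs_fps (\<lambda>n. p ^ n)
     | Mns \<Rightarrow> Abs_fps (\<lambda>n. if n = 0 then 0 else - (inverse p ^ n)))"

lemma pole_denominator:
  "(1 - fps_const p * fps_X) * pole p Pls = 1"
  "p \<noteq> 0 \<Longrightarrow> (fps_X - fps_const p) * pole p Mns = fps_X"
proof -
  show "(1 - fps_const p * fps_X) * pole p Pls = 1"
  proof (rule fps_ext)
    fix n show "fps_nth ((1 - fps_const p * fps_X) * pole p Pls) n = fps_nth 1 n"
      by (cases n) (simp_all add: pole_def left_diff_distrib mult.assoc)
  qed
  show "(fps_X - fps_const p) * pole p Mns = fps_X" if "p \<noteq> 0"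
  proof (rule fps_ext)
    fix n show "fps_nth ((fps_X - fps_const p) * pole p Mns) n = fps_nth fps_X n"
      using that by (cases n) (auto simp: pole_def left_diff_distrib)
  qed
qed

text \<open>
  Partial fractions. Each expansion is determined by clearing its denominator, so both obey the same
  formula.
\<close>

lemma pole_mult:
  assumes "p \<noteq> 0" "r \<noteq> 0" "p \<noteq> r"
  shows "pole p s * pole r s = fps_const (p / (p - r)) * pole p s - fps_const (r / (p - r)) * pole r s"
proof -
  have "fps_const (p - r) * (pole p s * pole r s) = fps_const p * pole p s - fps_const r * pole r s"
  proof (cases s)
    case Pls
    let ?D = "(1 - fps_const p * fps_X) * (1 - fps_const r * fps_X)"
    have "?D * (fps_const (p - r) * (pole p s * pole r s))
        = fps_const (p - r) * (((1 - fps_const p * fps_X) * pole p s)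
            * ((1 - fps_const r * fps_X) * pole r s))"
      by (simp only: mult_ac)
    also have "\<dots> = fps_const p * (1 - fps_const r * fps_X) * ((1 - fps_const p * fps_X) * pole p s)
        - fps_const r * (1 - fps_const p * fps_X) * ((1 - fps_const r * fps_X) * pole r s)"
      unfolding Pls pole_denominator by (simp add: algebra_simps flip: fps_const_sub)
    also have "\<dots> = ?D * (fps_const p * pole p s - fps_const r * pole r s)"
      by (simp only: algebra_simps mult_1_left)
    finally have "?D * (fps_const (p - r) * (pole p s * pole r s))
        = ?D * (fps_const p * pole p s - fps_const r * pole r s)" .
    moreover have "?D \<noteq> 0" using pole_denominator(1)[of p] pole_denominator(1)[of r]
      by (metis mult_zero_left no_zero_divisors zero_neq_one)
    ultimately show ?thesis by (simp only: mult_cancel_left) blast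
  next
    case Mns
    let ?D = "(fps_X - fps_const p) * (fps_X - fps_const r)"
    have "?D * (fps_const (p - r) * (pole p s * pole r s))
        = fps_const (p - r) * (((fps_X - fps_const p) * pole p s) * ((fps_X - fps_const r) * pole r s))"
      by (simp only: mult_ac)
    also have "\<dots> = fps_const p * (fps_X - fps_const r) * ((fps_X - fps_const p) * pole p s)
        - fps_const r * (fps_X - fps_const p) * ((fps_X - fps_const r) * pole r s)"
      unfolding Mns pole_denominator(2)[OF assms(1)] pole_denominator(2)[OF assms(2)]
      by (simp add: algebra_simps flip: fps_const_sub)
    also have "\<dots> = ?D * (fps_const p * pole p s - fps_const r * pole r s)"
      by (simp only: algebra_simps mult_1_left)
    finally have "?D * (fps_const (p - r) * (pole p s * pole r s))
        = ?D * (fps_const p * pole p s - fps_const r * pole r s)" .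
    moreover have "?D \<noteq> 0"
      using pole_denominator(2)[OF assms(1)] pole_denominator(2)[OF assms(2)]
      by (metis fps_X_neq_zero mult_eq_0_iff mult_zero_left)
    ultimately show ?thesis by (simp only: mult_cancel_left) blast
  qed
  moreover have "pole p s * pole r s = fps_const (inverse (p - r))
      * (fps_const (p - r) * (pole p s * pole r s))"
    using assms(3) by (simp add: mult.assoc[symmetric])
  ultimately have "pole p s * pole r s
      = fps_const (inverse (p - r)) * (fps_const p * pole p s - fps_const r * pole r s)"
    by (simp only:)
  thus ?thesis by (simp add: right_diff_distrib divide_inverse mult_ac flip: fps_const_mult)
qed

text \<open>
  The factor $q (1 - z q^{l-1}) / (1 - z q^{l+1})$ takes the value $q^{-1}$ at infinity and has a
  simple pole.
\<close>

lemma ell_factor_pole: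
  "ell_factor t l s = fps_const (qpow t (- 1))
     + fps_const (qpow t 1 - qpow t (- 1)) * pole (qpow t (of_int (l + 1))) s"
proof -
  let ?q = "qpow t 1" and ?p = "qpow t (of_int (l + 1))" and ?u = "qpow t (of_int (l - 1))"
  have u: "?u = qpow t (- 1) * qpow t (- 1) * ?p" by (simp flip: qpow_add)
  have q: "?q * qpow t (- 1) = 1" by (simp flip: qpow_add)
  have e: "?q * (qpow t (- 1) * qpow t (- 1)) = qpow t (- 1)"
    "?q * (1 - qpow t (- 1) * qpow t (- 1)) = ?q - qpow t (- 1)"
    using q by (simp_all add: right_diff_distrib mult.assoc[symmetric])
  show ?thesis
  proof (cases s)
    case Pls
    have i: "inverse (1 - fps_const ?p * fps_X) = pole ?p Pls"
      by (rule fps_inverse_unique) (rule pole_denominator)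
    have "1 - fps_const ?u * fps_X = fps_const (qpow t (- 1) * qpow t (- 1)) * (1 - fps_const ?p * fps_X)
        + fps_const (1 - qpow t (- 1) * qpow t (- 1))"
      unfolding u by (simp add: algebra_simps flip: fps_const_sub fps_const_mult)
    hence "ell_factor t l Pls = fps_const ?q * (fps_const (qpow t (- 1) * qpow t (- 1))
        * ((1 - fps_const ?p * fps_X) * pole ?p Pls)
        + fps_const (1 - qpow t (- 1) * qpow t (- 1)) * pole ?p Pls)"
      by (simp only: ell_factor.simps i) (simp only: algebra_simps)
    also have "\<dots> = fps_const (?q * (qpow t (- 1) * qpow t (- 1)))
        + fps_const (?q * (1 - qpow t (- 1) * qpow t (- 1))) * pole ?p Pls"
      unfolding pole_denominator by (simp add: distrib_left mult.assoc[symmetric])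
    finally show ?thesis unfolding Pls e .
  next
    case Mns
    have pu: "inverse (fps_X - fps_const ?p) * (fps_X - fps_const ?p) = 1"
      by (rule inverse_mult_eq_1) simp
    have "inverse (fps_X - fps_const ?p) * fps_X
        = inverse (fps_X - fps_const ?p) * ((fps_X - fps_const ?p) * pole ?p Mns)"
      by (simp add: pole_denominator)
    hence i: "inverse (fps_X - fps_const ?p) * fps_X = pole ?p Mns"
      by (simp only: mult.assoc[symmetric] pu mult_1_left)
    have "fps_X - fps_const ?u = fps_const (qpow t (- 1) * qpow t (- 1)) * (fps_X - fps_const ?p)
        + fps_const (1 - qpow t (- 1) * qpow t (- 1)) * fps_X"
      unfolding u by (simp add: algebra_simps flip: fps_const_sub fps_const_mult)
    hence "ell_factor t l Mns = fps_const ?q * (fps_const (qpow t (- 1) * qpow t (- 1))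
        * (inverse (fps_X - fps_const ?p) * (fps_X - fps_const ?p))
        + fps_const (1 - qpow t (- 1) * qpow t (- 1)) * (inverse (fps_X - fps_const ?p) * fps_X))"
      by (simp only: ell_factor.simps) (simp only: algebra_simps)
    also have "\<dots> = fps_const (?q * (qpow t (- 1) * qpow t (- 1)))
        + fps_const (?q * (1 - qpow t (- 1) * qpow t (- 1))) * pole ?p Mns"
      unfolding pu i by (simp add: distrib_left mult.assoc[symmetric])
    finally show ?thesis unfolding Mns e .
  qed
qed

text \<open>
  The factor attached to $Y_{i,l}^{e}$ for an exponent \<open>e\<close> equal to 1 or -1.
\<close>

definition signed_ell_factor :: "complex \<Rightarrow> int \<Rightarrow> int \<Rightarrow> sign \<Rightarrow> complex fps" where
  "signed_ell_factor t e l s = fps_const (qpow t (of_int (- e)))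
     + fps_const (of_int e * (qpow t 1 - qpow t (- 1))) * pole (qpow t (of_int (l + e))) s"

lemma inverse_ell_factor:
  assumes "generic t"
  shows "inverse (ell_factor t l s) = signed_ell_factor t (- 1) l s"
proof (rule fps_inverse_unique)
  let ?k = "qpow t 1 - qpow t (- 1)" and ?p = "qpow t (of_int (l + 1))" and ?r
      = "qpow t (of_int (l - 1))"
  \<comment> \<open>The poles of the two factors are distinct, so their product splits into partial fractions.\<close>
  have ne: "?p \<noteq> ?r" using qpow_int_inj[OF assms, of "l + 1" "l - 1"] by simp
  have pl: "?p = qpow t (of_int l) * qpow t 1" "?r = qpow t (of_int l) * qpow t (- 1)"
    by (simp_all flip: qpow_add)
  have dif: "?p - ?r = qpow t (of_int l) * ?k" unfolding pl by (simp only: right_diff_distrib)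
  have k: "?k * ?k * (?p / (?p - ?r)) = ?k * qpow t 1" "?k * ?k * (?r / (?p - ?r)) = ?k * qpow t (- 1)"
    unfolding dif unfolding pl using qpow_1_diff_nonzero[OF assms] by simp_all
  have one: "qpow t 1 * qpow t (- 1) = 1" by (simp flip: qpow_add)
  have "ell_factor t l s * signed_ell_factor t (- 1) l s
      = fps_const (qpow t 1 * qpow t (- 1)) + fps_const (?k * qpow t 1) * pole ?p s
        - fps_const (?k * qpow t (- 1)) * pole ?r s - fps_const (?k * ?k) * (pole ?p s * pole ?r s)"
    unfolding ell_factor_pole signed_ell_factor_def
    by (simp only: of_int_minus of_int_1 minus_minus mult_minus_left mult_1_left fps_const_neg[symmetric]
        diff_conv_add_uminus[symmetric] fps_const_mult[symmetric] add_uminus_conv_diff)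
            (simp only: algebra_simps)
  also have "\<dots> = fps_const (qpow t 1 * qpow t (- 1)) + fps_const (?k * qpow t 1) * pole ?p s
        - fps_const (?k * qpow t (- 1)) * pole ?r s
        - (fps_const (?k * ?k * (?p / (?p - ?r))) * pole ?p s
            - fps_const (?k * ?k * (?r / (?p - ?r))) * pole ?r s)"
    unfolding pole_mult[OF qpow_nonzero qpow_nonzero ne]
    by (simp only: right_diff_distrib mult.assoc[symmetric] fps_const_mult)
  also have "\<dots> = 1" unfolding k one by simp
  finally show "ell_factor t l s * signed_ell_factor t (- 1) l s = 1" .
qed

lemma ell_factor_signed: "ell_factor t l s = signed_ell_factor t 1 l s"
  by (simp add: signed_ell_factor_def ell_factor_pole)

text \<open>
  The coefficient at \<open>n\<close> of the difference of the two expansions. Constants cancel in it, and a pole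
  contributes a geometric progression.
\<close>

definition expansion_jump :: "(sign \<Rightarrow> complex fps) \<Rightarrow> int \<Rightarrow> complex" where
  "expansion_jump G n = (if n \<ge> 0 then fps_nth (G Pls) (nat n) else 0)
     - (if n \<le> 0 then fps_nth (G Mns) (nat (- n)) else 0)"

lemma expansion_jump_simps:
  "expansion_jump (\<lambda>s. fps_const c) n = 0"
  "expansion_jump (\<lambda>s. F s + G s) n = expansion_jump F n + expansion_jump G n"
  "expansion_jump (\<lambda>s. F s - G s) n = expansion_jump F n - expansion_jump G n"
  "expansion_jump (\<lambda>s. fps_const c * F s) n = c * expansion_jump F n"
  by (simp_all add: expansion_jump_def algebra_simps)

lemma expansion_jump_pole: "expansion_jump (\<lambda>s. pole (qpow t (of_int l)) s) n = qpow t (of_int (n * l))"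
proof -
  have "qpow t (of_int l) ^ k = qpow t (of_int (int k * l))" for k by (simp add: qpow_power)
  moreover have "inverse (qpow t (of_int l)) ^ k = qpow t (of_int (- int k * l))" for k
    by (simp add: qpow_power power_inverse flip: qpow_minus)
  ultimately show ?thesis by (auto simp: expansion_jump_def pole_def)
qed

lemma expansion_jump_factor: "expansion_jump (signed_ell_factor t e l) n
    = of_int e * (qpow t 1 - qpow t (- 1)) * qpow t (of_int (n * (l + e)))"
  unfolding signed_ell_factor_def expansion_jump_simps expansion_jump_pole by simp

lemma qint_shift:
  assumes "generic t"
  shows "qint t h * qpow t (- 1) + qpow t (of_int h) = qint t (h + 1)"
    "qint t h * qpow t 1 - qpow t (of_int h) = qint t (h - 1)"
    "qint t h * qpow t (- 1) - qpow t (- of_int h) = qint t (h - 1)"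
    "qint t h * qpow t 1 + qpow t (- of_int h) = qint t (h + 1)"
proof -
  have "qpow t (of_int (h + 1)) = qpow t (of_int h) * qpow t 1"
    "qpow t (- of_int (h + 1)) = qpow t (- of_int h) * qpow t (- 1)"
    "qpow t (of_int (h - 1)) = qpow t (of_int h) * qpow t (- 1)"
    "qpow t (- of_int (h - 1)) = qpow t (- of_int h) * qpow t 1"
    by (simp_all flip: qpow_add)
  thus "qint t h * qpow t (- 1) + qpow t (of_int h) = qint t (h + 1)"
    "qint t h * qpow t 1 - qpow t (of_int h) = qint t (h - 1)"
    "qint t h * qpow t (- 1) - qpow t (- of_int h) = qint t (h - 1)"
    "qint t h * qpow t 1 + qpow t (- of_int h) = qint t (h + 1)"
    using qpow_1_diff_nonzero[OF assms] by (simp_all add: qint_def divide_simps)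
        (simp_all add: algebra_simps)
qed

text \<open>
  The residue of a product at the pole of one factor is the residue of that factor times the value
  of the other one, and this value is a quotient of consecutive $q$-integers.
\<close>

lemma expansion_jump_two_factors:
  assumes g: "generic t" and ef: "e = 1 \<or> e = - 1" "f = 1 \<or> f = - 1"
    and h: "(l + e) - (l' + f) = 2 * h" "h \<noteq> 0"
  shows "expansion_jump (\<lambda>s. signed_ell_factor t e l s * signed_ell_factor t f l' s) n
      = (qpow t 1 - qpow t (- 1)) *
     (of_int e * (qint t (h + f) / qint t h) * qpow t (of_int (n * (l + e)))
     + of_int f * (qint t (h - e) / qint t h) * qpow t (of_int (n * (l' + f))))"
proof -
  let ?k = "qpow t 1 - qpow t (- 1)" and ?p = "qpow t (of_int (l + e))" and ?r
      = "qpow t (of_int (l' + f))"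
  have ne: "?p \<noteq> ?r" using qpow_int_inj[OF g, of "l + e" "l' + f"] h by simp
  have "l + e = (l' + f + h) + h" using h by simp
  hence p: "?p = qpow t (of_int (l' + f + h)) * qpow t (of_int h)" by (metis qpow_int_add)
  have "l' + f = (l' + f + h) + - h" by simp
  hence r: "?r = qpow t (of_int (l' + f + h)) * qpow t (- of_int h)" by (metis qpow_int_add of_int_minus)
  have dif: "?p - ?r = qpow t (of_int (l' + f + h)) * (?k * qint t h)"
    unfolding p r by (simp add: right_diff_distrib flip: qint_eq[OF g])
  have hn: "qint t h \<noteq> 0" using qint_nonzero[OF g h(2)] .
  have k: "?k * (?p / (?p - ?r)) = qpow t (of_int h) / qint t h"
     "?k * (?r / (?p - ?r)) = qpow t (- of_int h) / qint t h"
    unfolding dif unfolding p r using qpow_1_diff_nonzero[OF g] hn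
    by (simp_all del: of_int_add)
  have eq: "(\<lambda>s. signed_ell_factor t e l s * signed_ell_factor t f l' s)
      = (\<lambda>s. fps_const (qpow t (of_int (- e)) * qpow t (of_int (- f)))
        + fps_const (of_int e * ?k * qpow t (of_int (- f))) * pole ?p s
        + fps_const (of_int f * ?k * qpow t (of_int (- e))) * pole ?r s
        + fps_const (of_int e * of_int f * ?k * ?k) * (pole ?p s * pole ?r s))"
    unfolding signed_ell_factor_def by (rule ext)
        (simp only: fps_const_mult[symmetric] distrib_left distrib_right mult_ac add_ac)
  have E: "expansion_jump (\<lambda>s. signed_ell_factor t e l s * signed_ell_factor t f l' s) n
    = of_int e * ?k * (qpow t (of_int (- f)) + of_int f * (?k * (?p / (?p - ?r))))
        * qpow t (of_int (n * (l + e)))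
    + of_int f * ?k * (qpow t (of_int (- e)) - of_int e * (?k * (?r / (?p - ?r))))
        * qpow t (of_int (n * (l' + f)))"
    unfolding eq pole_mult[OF qpow_nonzero qpow_nonzero ne]
    by (simp only: expansion_jump_simps expansion_jump_pole)
        (simp only: algebra_simps mult_zero_left add_0_left)
  have m1: "qpow t (of_int (- f)) + of_int f * (?k * (?p / (?p - ?r))) = qint t (h + f) / qint t h"
    unfolding k using ef(2) hn qint_shift[OF g, of h] by (auto simp: field_simps)
  have m2: "qpow t (of_int (- e)) - of_int e * (?k * (?r / (?p - ?r))) = qint t (h - e) / qint t h"
    unfolding k using ef(1) hn qint_shift[OF g, of h] by (auto simp: field_simps)
  show ?thesis unfolding E m1 m2 by (simp only: algebra_simps)
qed

lemma ell_series_Xi: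
  assumes g: "generic t"
  shows "snd m $ i = 0 \<Longrightarrow> ell_series t m s i = 1"
    and "snd m $ i = Poly_Mapping.single l e \<Longrightarrow> e = 1 \<or> e = - 1 \<Longrightarrow> ell_series t m s i
        = signed_ell_factor t e l s"
    and "snd m $ i = Poly_Mapping.single l e + Poly_Mapping.single l' f \<Longrightarrow> l \<noteq> l' \<Longrightarrow> e = 1 \<or> e = - 1 \<Longrightarrow>
      f = 1 \<or> f = - 1 \<Longrightarrow> ell_series t m s i = signed_ell_factor t e l s * signed_ell_factor t f l' s"
proof -
  show "snd m $ i = 0 \<Longrightarrow> ell_series t m s i = 1"
    by (simp add: ell_series_def)
  show "snd m $ i = Poly_Mapping.single l e \<Longrightarrow> e = 1 \<or> e = - 1 \<Longrightarrow> ell_series t m s i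
      = signed_ell_factor t e l s"
    by (auto simp: ell_series_def expo_def ell_factor_signed[symmetric]
        inverse_ell_factor[OF g, symmetric])
  assume X: "snd m $ i = Poly_Mapping.single l e + Poly_Mapping.single l' f" "l \<noteq> l'" "e = 1 \<or> e = - 1"
      "f = 1 \<or> f = - 1"
  have "Poly_Mapping.keys (snd m $ i) = {l, l'}" "expo m i l = e" "expo m i l' = f"
    using X by (auto simp: in_keys_iff lookup_add lookup_single when_def expo_def split: if_splits)
  thus "ell_series t m s i = signed_ell_factor t e l s * signed_ell_factor t f l' s"
    using X(2-) by (auto simp: ell_series_def ell_factor_signed[symmetric]
        inverse_ell_factor[OF g, symmetric])
qed

text \<open>
  The diagonal matrix coefficient of the commutator of a raising and a lowering generator of the
  node \<open>i\<close>, with total mode \<open>n\<close>: lowering first and then raising counts positively, the other order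
  negatively.
\<close>

definition residue_sum :: "complex \<Rightarrow> int \<Rightarrow> int \<Rightarrow> node \<Rightarrow> int \<Rightarrow> complex" where
  "residue_sum t j k i n =
     (let A = widen_coeff t (j - k) * narrow_coeff t (j - k + 1); B
         = narrow_coeff t (j - k) * widen_coeff t (j - k - 1) in
       (if i = of_int j then A * qpow t (of_int (n * (j + 1))) else 0)
     + (if i = of_int k then B * qpow t (of_int (n * (k - 1))) else 0)
     - (if i = of_int (k - 1) then A * qpow t (of_int (n * (k - 2))) else 0)
     - (if i = of_int (j - 1) then B * qpow t (of_int (n * j)) else 0))"

lemma single_uminus: "Poly_Mapping.single a (- c) = - Poly_Mapping.single a (c :: int)"
  by (rule poly_mapping_eqI) (simp add: lookup_single when_def)

text \<open>
  The residues of the eigenvalue of $\phi_i^{\pm}(z)$ are the coefficients of the closed paths. This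
  is where the coefficients of the moves are tied to the \<open>\<ell>\<close>-weights.
\<close>

lemma expansion_jump_residue_sum:
  assumes g: "generic t" and kj: "k \<le> j"
  shows "expansion_jump (\<lambda>s. ell_series t (box_pair j k) s i) n
      = (qpow t 1 - qpow t (- 1)) * residue_sum t j k i n"
proof -
  let ?d = "j - k"
  have single: "expansion_jump (\<lambda>s. ell_series t (box_pair j k) s i) n
      = of_int e * (qpow t 1 - qpow t (- 1)) * qpow t (of_int (n * (l + e)))"
    if "snd (box_pair j k) $ i = Poly_Mapping.single l e" "e = 1 \<or> e = - 1" for l e
    using ell_series_Xi(2)[OF g that] by (simp add: expansion_jump_factor)
  have double: "expansion_jump (\<lambda>s. ell_series t (box_pair j k) s i) n = (qpow t 1 - qpow t (- 1)) *
     (of_int e * (qint t (h + f) / qint t h) * qpow t (of_int (n * (l + e)))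
     + of_int f * (qint t (h - e) / qint t h) * qpow t (of_int (n * (l' + f))))"
    if "snd (box_pair j k) $ i = Poly_Mapping.single l e + Poly_Mapping.single l' f" "l \<noteq> l'"
      "e = 1 \<or> e = - 1" "f = 1 \<or> f = - 1" "(l + e) - (l' + f) = 2 * h" "h \<noteq> 0" for l e l' f h
    using ell_series_Xi(3)[OF g that(1-4)] expansion_jump_two_factors[OF g that(3-6)] by simp
  note X = Xi_box_pair_cases[of j k, unfolded Xi_part_def]
  have N: "(of_int j :: node) = of_int k \<longleftrightarrow> 4 dvd ?d" "(of_int k :: node) = of_int j \<longleftrightarrow> 4 dvd ?d"
    "(of_int j :: node) = of_int (k - 1) \<longleftrightarrow> 4 dvd (?d + 1)"
        "(of_int (k - 1) :: node) = of_int j \<longleftrightarrow> 4 dvd (?d + 1)"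
    "(of_int j :: node) \<noteq> of_int (j - 1)" "(of_int (j - 1) :: node) \<noteq> of_int j"
    "(of_int k :: node) \<noteq> of_int (k - 1)" "(of_int (k - 1) :: node) \<noteq> of_int k"
    "(of_int k :: node) = of_int (j - 1) \<longleftrightarrow> 4 dvd (?d - 1)"
        "(of_int (j - 1) :: node) = of_int k \<longleftrightarrow> 4 dvd (?d - 1)"
    "(of_int (k - 1) :: node) = of_int (j - 1) \<longleftrightarrow> 4 dvd ?d"
        "(of_int (j - 1) :: node) = of_int (k - 1) \<longleftrightarrow> 4 dvd ?d"
    unfolding of_int_node_eq_iff by presburger+
  define A B where "A = widen_coeff t ?d * narrow_coeff t (?d + 1)"
      and "B = narrow_coeff t ?d * widen_coeff t (?d - 1)"
  have A0: "A = qint t (?d div 2 + 2) / qint t (?d div 2 + 1)"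
    and B0: "B = qint t (?d div 2) / qint t (?d div 2 + 1)" if "4 dvd ?d"
  proof -
    have "\<not> 4 dvd (?d + 1)" "\<not> 4 dvd (?d - 1)" using that by presburger+
    thus "A = qint t (?d div 2 + 2) / qint t (?d div 2 + 1)"
        "B = qint t (?d div 2) / qint t (?d div 2 + 1)"
      using that kj by (cases "j = k"; simp add: A_def B_def widen_coeff_def narrow_coeff_def)+
  qed
  have A3: "A = qint t ((?d + 1) div 2) / qint t ((?d + 1) div 2 + 1)" if "4 dvd (?d + 1)"
  proof -
    have "\<not> 4 dvd ?d" using that by presburger
    thus ?thesis using that kj by (simp add: A_def widen_coeff_def narrow_coeff_def)
  qed
  have B1: "B = qint t ((?d + 1) div 2 + 1) / qint t ((?d + 1) div 2)" if "4 dvd (?d - 1)"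
  proof -
    have "\<not> 4 dvd ?d" "?d > 0" and e: "(?d - 1) div 2 = (?d + 1) div 2 - 1"
      using that kj by presburger+
    thus ?thesis using that by (simp add: B_def widen_coeff_def narrow_coeff_def e add.commute)
  qed
  have A1: "A = 1" if "\<not> 4 dvd ?d" "\<not> 4 dvd (?d + 1)"
    using that kj by (simp add: A_def widen_coeff_def narrow_coeff_def)
  have B2: "B = 1" if "\<not> 4 dvd ?d" "\<not> 4 dvd (?d - 1)"
  proof -
    have "?d > 1" using that kj by presburger
    thus ?thesis using that by (simp add: B_def widen_coeff_def narrow_coeff_def)
  qed
  note rs = residue_sum_def[of t j k, folded A_def B_def, unfolded Let_def, folded A_def B_def]
  consider (none) "i \<noteq> of_int j" "i \<noteq> of_int k" "i \<noteq> of_int (j - 1)" "i \<noteq> of_int (k - 1)"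
    | (jj) "i = of_int j" "4 dvd ?d" | (jk) "i = of_int j" "4 dvd (?d + 1)"
    | (j) "i = of_int j" "\<not> 4 dvd ?d" "\<not> 4 dvd (?d + 1)"
    | (kj) "i = of_int k" "4 dvd (?d - 1)" | (k) "i = of_int k" "\<not> 4 dvd ?d" "\<not> 4 dvd (?d - 1)"
    | (lowjj) "i = of_int (k - 1)" "4 dvd ?d"
    | (lowk) "i = of_int (k - 1)" "\<not> 4 dvd ?d" "\<not> 4 dvd (?d + 1)"
    | (lowj) "i = of_int (j - 1)" "\<not> 4 dvd ?d" "\<not> 4 dvd (?d - 1)"
    using N by metis
  thus ?thesis
  proof cases
    case none
    hence "snd (box_pair j k) $ i = 0" "residue_sum t j k i n = 0"
      by (simp_all add: snd_box_pair residue_sum_def del: of_int_diff)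
    thus ?thesis using ell_series_Xi(1)[OF g] expansion_jump_simps(1)[of 1] by simp
  next
    case jj
    have n: "\<not> 4 dvd (?d + 1)" using jj by presburger
    have "snd (box_pair j k) $ i = Yv j + Yv (k - 2)" using X(1)[OF jj(2)] jj(1) by simp
    moreover have "(j + 1) - (k - 2 + 1) = 2 * (?d div 2 + 1)" "?d div 2 + 1 \<noteq> 0" "j \<noteq> k - 2"
      using jj(2) kj by presburger+
    ultimately show ?thesis
      using jj(2) n double[of j 1 "k - 2" 1 "?d div 2 + 1"]
          unfolding rs jj(1) N A0[OF jj(2)] B0[OF jj(2)] by (simp add: algebra_simps)
  next
    case jk
    have n: "\<not> 4 dvd ?d" using jk by presburger
    have "snd (box_pair j k) $ i = Yv j + Poly_Mapping.single (k - 1) (- 1)"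
      using X(2)[OF jk(2)] jk(1) by (simp add: single_uminus)
    moreover have "(j + 1) - (k - 1 + - 1) = 2 * ((?d + 1) div 2 + 1)" "(?d + 1) div 2 + 1 \<noteq> 0"
        "j \<noteq> k - 1"
      using jk(2) kj by presburger+
    ultimately show ?thesis
      using jk(2) n double[of j 1 "k - 1" "- 1" "(?d + 1) div 2 + 1"]
          unfolding rs jk(1) N A3[OF jk(2)] by (simp add: algebra_simps)
  next
    case j
    have "snd (box_pair j k) $ i = Yv j" using X(3)[OF j(2,3)] j(1) by simp
    from single[OF this] show ?thesis
      using j(2,3) unfolding rs j(1) N A1[OF j(2,3)] by simp
  next
    case kj
    have n: "\<not> 4 dvd ?d" using kj by presburger
    have "snd (box_pair j k) $ i = Poly_Mapping.single (j + 1) (- 1) + Yv (k - 2)"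
      using X(4)[OF kj(2)] kj(1) by (simp add: single_uminus)
    moreover have "(j + 1 + - 1) - (k - 2 + 1) = 2 * ((?d + 1) div 2)" "(?d + 1) div 2 \<noteq> 0"
        "j + 1 \<noteq> k - 2"
      using kj(2) assms(2) by presburger+
    ultimately show ?thesis
      using kj(2) n double[of "j + 1" "- 1" "k - 2" 1 "(?d + 1) div 2"]
          unfolding rs kj(1) N B1[OF kj(2)] by (simp add: algebra_simps)
  next
    case k
    have "snd (box_pair j k) $ i = Yv (k - 2)" using X(5)[OF k(2,3)] k(1) by simp
    from single[OF this] show ?thesis
      using k(2,3) unfolding rs k(1) N B2[OF k(2,3)] by simp
  next
    case lowjj
    have n: "\<not> 4 dvd (?d + 1)" using lowjj by presburger
    have "snd (box_pair j k) $ i = Poly_Mapping.single (j + 1) (- 1) + Poly_Mapping.single (k - 1) (- 1)"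
      using X(6)[OF lowjj(2)] lowjj(1) by (simp add: single_uminus)
    moreover have "(j + 1 + - 1) - (k - 1 + - 1) = 2 * (?d div 2 + 1)" "?d div 2 + 1 \<noteq> 0" "j + 1 \<noteq> k - 1"
      using lowjj(2) kj by presburger+
    ultimately show ?thesis
      using lowjj(2) n double[of "j + 1" "- 1" "k - 1" "- 1" "?d div 2 + 1"]
          unfolding rs lowjj(1) N A0[OF lowjj(2)] B0[OF lowjj(2)]
          by (simp add: algebra_simps eq_neg_iff_add_eq_0)
  next
    case lowk
    have "snd (box_pair j k) $ i = Poly_Mapping.single (k - 1) (- 1)"
      using X(8)[OF lowk(2,3)] lowk(1) by (simp add: single_uminus)
    from single[OF this] show ?thesis
      using lowk(2,3) unfolding rs lowk(1) N A1[OF lowk(2,3)] by (simp add: algebra_simps)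
  next
    case lowj
    have "snd (box_pair j k) $ i = Poly_Mapping.single (j + 1) (- 1)"
      using X(10)[OF lowj(2,3)] lowj(1) by (simp add: single_uminus)
    from single[OF this] show ?thesis
      using lowj(2,3) unfolding rs lowj(1) N B2[OF lowj(2,3)] by (simp add: algebra_simps)
  qed
qed

lemma phi_difference_on_basis:
  assumes g: "generic t" and m: "m \<in> monomial_group"
  shows "VM_act t (phi_el t Pls i n - phi_el t Mns i n) (basis_vec m)
    = vscale (expansion_jump (\<lambda>s. ell_series t m s i) n) (basis_vec m)"
proof -
  note phi = VM_act_phi[OF qpow_1_diff_nonzero[OF g] m]
  have "VM_act t (phi_el t Pls i n) (basis_vec m)
      = vscale (if n \<ge> 0 then fps_nth (ell_series t m Pls i) (nat n) else 0) (basis_vec m)"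
  proof (cases "n \<ge> 0")
    case True
    thus ?thesis using phi[of Pls i "nat n"] by simp
  qed (simp add: phi_el_def vscale_simps)
  moreover have "VM_act t (phi_el t Mns i n) (basis_vec m)
      = vscale (if n \<le> 0 then fps_nth (ell_series t m Mns i) (nat (- n)) else 0) (basis_vec m)"
  proof (cases "n \<le> 0")
    case True
    thus ?thesis using phi[of Mns i "nat (- n)"] by simp
  qed (simp add: phi_el_def vscale_simps)
  ultimately show ?thesis
    unfolding VM_act_diff_left expansion_jump_def
    by (simp only:) (rule poly_mapping_eqI, simp only: lookup_minus lookup_vscale left_diff_distrib)
qed

text \<open>
  If the two generators move different boxes, the order of the moves does not matter. If they move
  the same box, it returns, which requires the same node and gives one of the four terms of
  \<open>residue_sum\<close>.
\<close>

lemma opposite_on_wvec: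
  assumes g: "generic t"
  shows "drinfeld t Pls i r (drinfeld t Mns i' r' (wvec t j k))
      - drinfeld t Mns i' r' (drinfeld t Pls i r (wvec t j k))
    = vscale (if i = i' then residue_sum t j k i (r + r') else 0) (wvec t j k)"
proof -
  \<comment> \<open>The parts of the four possible moves that depend on the node and the mode: the first box is
      moved by \<open>lowP\<close> and \<open>raiP\<close>, the second one by \<open>lowQ\<close> and \<open>raiQ\<close>.\<close>
  define lowP where "lowP j = (if i' = of_int j then qpow t (of_int (r' * (j + 1))) else 0)" for j :: int
  define lowQ where "lowQ k = (if i' = of_int k then qpow t (of_int (r' * (k - 1))) else 0)" for k :: int
  define raiP where "raiP j = (if i = of_int (j - 1) then qpow t (of_int (r * j)) else 0)" for j :: int
  define raiQ where "raiQ k = (if i = of_int (k - 1) then qpow t (of_int (r * (k - 2))) else 0)"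
      for k :: int
  have low: "drinfeld t Mns i' r' (wvec t j k)
      = vscale (widen_coeff t (j - k) * lowP j) (wvec t (j + 1) k)
          + vscale (narrow_coeff t (j - k) * lowQ k) (wvec t j (k + 1))"
    for j k unfolding lower_wvec[OF g] by (simp add: vwhen_def lowP_def lowQ_def vscale_simps)
  have rai: "drinfeld t Pls i r (wvec t j k)
      = vscale (widen_coeff t (j - k) * raiQ k) (wvec t j (k - 1))
          + vscale (narrow_coeff t (j - k) * raiP j) (wvec t (j - 1) k)"
    for j k unfolding raise_wvec[OF g] by (simp add: vwhen_def raiP_def raiQ_def vscale_simps)
  have e: "j + 1 - k = j - k + 1" "j - (k + 1) = j - k - 1" "j - (k - 1) = j - k + 1"
      "j - 1 - k = j - k - 1"
    "j + 1 - 1 = j" "j - 1 + 1 = j" "k + 1 - 1 = k" "k - 1 + 1 = k" by simp_all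
  have diag: "lowP j * raiP (j + 1) = (if i = i' \<and> i
      = of_int j then qpow t (of_int ((r + r') * (j + 1))) else 0)"
    "raiQ k * lowQ (k - 1) = (if i = i' \<and> i = of_int (k
        - 1) then qpow t (of_int ((r + r') * (k - 2))) else 0)"
    "lowQ k * raiQ (k + 1) = (if i = i' \<and> i = of_int k then qpow t (of_int ((r + r') * (k - 1))) else 0)"
    "raiP j * lowP (j - 1) = (if i = i' \<and> i = of_int (j - 1) then qpow t (of_int ((r + r') * j)) else 0)"
    by (auto simp: lowP_def lowQ_def raiP_def raiQ_def distrib_right add.commute
        simp del: of_int_diff simp flip: qpow_add)
  define A B where "A = widen_coeff t (j - k) * narrow_coeff t (j - k + 1)"
      and "B = narrow_coeff t (j - k) * widen_coeff t (j - k - 1)"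
  have "drinfeld t Pls i r (drinfeld t Mns i' r' (wvec t j k))
      - drinfeld t Mns i' r' (drinfeld t Pls i r (wvec t j k))
    = vscale (A * (lowP j * raiP (j + 1)) - A * (raiQ k * lowQ (k - 1))
      + (B * (lowQ k * raiQ (k + 1)) - B * (raiP j * lowP (j - 1)))) (wvec t j k)"
    unfolding low rai gen_action_add gen_action_scale e A_def B_def
    by (rule poly_mapping_eqI) (simp only: lookup_add lookup_minus lookup_vscale algebra_simps)
  also have "A * (lowP j * raiP (j + 1)) - A * (raiQ k * lowQ (k - 1))
      + (B * (lowQ k * raiQ (k + 1)) - B * (raiP j * lowP (j - 1)))
    = (if i = i' then residue_sum t j k i (r + r') else 0)"
    unfolding diag residue_sum_def Let_def A_def[symmetric] B_def[symmetric] by auto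
  finally show ?thesis .
qed

section \<open>The space and its toroidal module structure\<close>

lemma keys_wvec: "Poly_Mapping.keys (wvec t j k) \<subseteq> (if k \<le> j then {box_pair j k} else {})"
  by (auto simp: wvec_def basis_vec_def in_keys_iff lookup_single when_def split: if_splits)

lemma VM_space_iff: "v \<in> VM_space \<longleftrightarrow> (\<forall>m. Poly_Mapping.lookup v m \<noteq> 0 \<longrightarrow> m \<in> crystal_E)"
  by (auto simp: VM_space_def in_keys_iff)

lemma VM_space_closed:
  "0 \<in> VM_space" "u \<in> VM_space \<Longrightarrow> v \<in> VM_space \<Longrightarrow> u + v \<in> VM_space"
  "u \<in> VM_space \<Longrightarrow> vscale c u \<in> VM_space"
proof -
  show "u + v \<in> VM_space" if "u \<in> VM_space" "v \<in> VM_space"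
    using that keys_add[of u v] by (auto simp: VM_space_def)
qed (auto simp: VM_space_iff)

lemma wvec_in_VM_space: "wvec t j k \<in> VM_space"
  using keys_wvec[of t j k] by (auto simp: VM_space_def crystal_E_eq split: if_splits)

lemma basis_vec_wvec:
  "generic t \<Longrightarrow> k \<le> j \<Longrightarrow> basis_vec (box_pair j k)
      = vscale (if j = k then 1 / qint t 2 else 1) (wvec t j k)"
  using qint_nonzero[of t 2] by (simp add: wvec_def vscale_simps)

text \<open>
  The vectors \<open>wvec t j k\<close> with \<open>k \<le> j\<close> span the space, so linear statements are checked on them.
\<close>

lemma VM_space_linear_induct:
  assumes g: "generic t" and v: "v \<in> VM_space" and zero: "P 0"
    and add: "\<And>u v. P u \<Longrightarrow> P v \<Longrightarrow> P (u + v)"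
    and wvec: "\<And>c j k. k \<le> j \<Longrightarrow> P (vscale c (wvec t j k))"
  shows "P v"
proof -
  have "P (\<Sum>m\<in>S. Poly_Mapping.single m (Poly_Mapping.lookup v m))" if "S \<subseteq> crystal_E" "finite S" for S
    using that(2,1)
  proof (induction S rule: finite_induct)
    case (insert m S)
    then obtain j k where jk: "k \<le> j" "m = box_pair j k" by (auto simp: crystal_E_eq)
    have "Poly_Mapping.single m (Poly_Mapping.lookup v m)
        = vscale (Poly_Mapping.lookup v m) (basis_vec m)"
      by (rule poly_mapping_eqI) (simp add: basis_vec_def lookup_single when_def)
    hence "P (Poly_Mapping.single m (Poly_Mapping.lookup v m))"
      using wvec[OF jk(1)] by (simp add: jk(2) basis_vec_wvec[OF g jk(1)] vscale_simps)
    thus ?case using insert by (simp add: add)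
  qed (simp add: zero)
  from this[of "Poly_Mapping.keys v"] v show ?thesis
    by (simp add: VM_space_def flip: poly_mapping_sum_single)
qed

lemma diagonal_wvec:
  "gen_action t (Gen_k h) (wvec t j k) = vscale (qpow t (pairing (wt (box_pair j k)) h)) (wvec t j k)"
  "gen_action t (Gen_h i n) (wvec t j k) = vscale (h_scalar t i n (box_pair j k)) (wvec t j k)"
  by (auto simp: wvec_def gen_action_scale vscale_simps mult.commute)

lemma vwhen_in_VM_space: "u \<in> VM_space \<Longrightarrow> vwhen P c u \<in> VM_space"
  by (simp add: vwhen_def VM_space_closed)

lemma gen_action_closed:
  assumes g: "generic t" and v: "v \<in> VM_space"
  shows "gen_action t x v \<in> VM_space"
  using v
proof (induction rule: VM_space_linear_induct[OF g, consumes 1, case_names zero add wvec])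
  case (wvec c j k)
  have "gen_action t x (wvec t j k) \<in> VM_space"
  proof (cases x)
    case (Gen_x s i r)
    thus ?thesis
      by (cases s) (auto simp: lower_wvec[OF g] raise_wvec[OF g] intro!: VM_space_closed
          vwhen_in_VM_space wvec_in_VM_space)
  qed (auto simp: diagonal_wvec intro!: VM_space_closed wvec_in_VM_space)
  thus ?case by (simp add: gen_action_scale VM_space_closed)
qed (simp_all add: gen_action_add VM_space_closed)

lemma VM_act_closed:
  assumes g: "generic t" and v: "v \<in> VM_space"
  shows "VM_act t a v \<in> VM_space"
proof -
  have "foldr (gen_action t) gs v \<in> VM_space" for gs
    by (induction gs) (auto simp: v gen_action_closed[OF g])
  moreover have "(\<Sum>w\<in>S. f w) \<in> VM_space" if "\<And>w. f w \<in> VM_space" for f and S :: "word set"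
    using that by (induction S rule: infinite_finite_induct) (auto intro: VM_space_closed)
  ultimately show ?thesis unfolding VM_act_def by (simp add: VM_space_closed)
qed

lemma wvec_as_uvec: "wvec t j k = uvec t s (case s of Mns \<Rightarrow> j | Pls \<Rightarrow> 1
    - k) (case s of Mns \<Rightarrow> k | Pls \<Rightarrow> 1 - j)"
  by (cases s) (simp_all add: uvec_def)

lemma wt_box_pair_shift:
  "pairing (wt (box_pair (j + 1) k)) h = pairing (wt (box_pair j k)) h
      - pairing (simple_root (of_int j)) h"
  "pairing (wt (box_pair j (k + 1))) h = pairing (wt (box_pair j k)) h
      - pairing (simple_root (of_int k)) h"
  using pairing_add[of _ "- simple_root _"]
  by (simp_all add: wt_box_pair box_weight_step pairing_add pairing_uminus flip: add_diff_eq
      add_uminus_conv_diff)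

text \<open>
  The part of the eigenvalue of $h_{i,n}$ that depends on the monomial, as an additive function of
  the exponents.
\<close>

definition exp_sum :: "complex \<Rightarrow> int \<Rightarrow> (int \<Rightarrow>\<^sub>0 int) \<Rightarrow> complex" where
  "exp_sum t n f = (\<Sum>l\<in>Poly_Mapping.keys f. of_int (Poly_Mapping.lookup f l) * qpow t (of_int (n * l)))"

lemma exp_sum_simps:
  "exp_sum t n (f + f') = exp_sum t n f + exp_sum t n f'"
  "exp_sum t n (- f) = - exp_sum t n f"
  "exp_sum t n (f - f') = exp_sum t n f - exp_sum t n f'"
  "exp_sum t n 0 = 0"
  "exp_sum t n (Poly_Mapping.single a c) = of_int c * qpow t (of_int (n * a))"
proof -
  show add: "exp_sum t n (f + f') = exp_sum t n f + exp_sum t n f'" for f f'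
  proof -
    let ?S = "Poly_Mapping.keys f \<union> Poly_Mapping.keys f'"
    have *: "exp_sum t n h = (\<Sum>l\<in>?S. of_int (Poly_Mapping.lookup h l) * qpow t (of_int (n * l)))"
      if "Poly_Mapping.keys h \<subseteq> ?S" for h
      unfolding exp_sum_def using that by (intro sum.mono_neutral_left) (auto simp: in_keys_iff)
    show ?thesis
      using *[of f] *[of f'] *[OF keys_add] by (simp add: lookup_add sum.distrib distrib_right)
  qed
  show zero: "exp_sum t n 0 = 0" by (simp add: exp_sum_def)
  show neg: "exp_sum t n (- f) = - exp_sum t n f" for f using add[of f "- f"] zero
      by (simp add: add_eq_0_iff)
  show "exp_sum t n (f - f') = exp_sum t n f - exp_sum t n f'" using add[of f "- f'"] neg[of f'] by simp
  show "exp_sum t n (Poly_Mapping.single a c) = of_int c * qpow t (of_int (n * a))"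
    by (simp add: exp_sum_def)
qed

lemma h_scalar_exp_sum: "h_scalar t i n m = exp_sum t n (snd m $ i) * qint t n / of_int n"
  by (simp add: h_scalar_def exp_sum_def expo_def)

lemma snd_A_mon: "snd (A_mon i l) $ j =
    (if j = i then Yv (l - 1) + Yv (l + 1) else if j = i + 1 \<or> j = i - 1 then - Yv l else 0)"
  using exhaust_4[of i] exhaust_4[of j]
  by (auto simp: A_mon_def e_mon_def Y_mon_def axis_def)

text \<open>
  The $q$-analogue of the Cartan matrix appears as the eigenvalue on $A_{j,l}$; hence multiplication
  by $A_{j,l}^{\pm 1}$ changes eigenvalues exactly as the relation between $h_{i,n}$ and
  $x_{j,r}^{\pm}$ demands.
\<close>

lemma h_scalar_A_mon:
  assumes "generic t"
  shows "h_scalar t i n (A_mon j l) = qint t (n * cartan_matrix i j) / of_int n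
      * qpow t (of_int (n * l))"
proof -
  have c: "cartan_matrix i j = (if i = j then 2 else if i = j + 1 \<or> i = j - 1 then - 1 else 0)"
    unfolding cartan_matrix_def using exhaust_4[of i] exhaust_4[of j] by (elim disjE) simp_all
  have "qint t n * (qpow t (of_int n) + qpow t (- of_int n)) = qint t (n * 2)"
  proof -
    have "qpow t (of_int (n * 2)) = qpow t (of_int n) * qpow t (of_int n)"
      "qpow t (- of_int (n * 2)) = qpow t (- of_int n) * qpow t (- of_int n)"
      by (simp_all add: mult_2_right flip: qpow_add)
    thus ?thesis by (simp only: qint_def times_divide_eq_left) (simp add: algebra_simps)
  qed
  hence E: "qint t n * (qpow t (of_int n) * y + qpow t (- of_int n) * y) = qint t (n * 2) * y" for y
    by (simp only: distrib_right[symmetric] mult.assoc[symmetric])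
  have e: "qpow t (of_int (n * (l - 1))) = qpow t (- of_int n) * qpow t (of_int (n * l))"
    "qpow t (of_int (n * (l + 1))) = qpow t (of_int n) * qpow t (of_int (n * l))"
    by (simp_all add: algebra_simps flip: qpow_add)
  show ?thesis
  proof (cases "i = j")
    case True
    have "exp_sum t n (Yv (l - 1) + Yv (l + 1)) * qint t n = qint t (n * 2) * qpow t (of_int (n * l))"
      unfolding exp_sum_simps e E[symmetric] by
          (simp only: of_int_1 mult_1_left mult.commute add.commute)
    thus ?thesis using True unfolding h_scalar_exp_sum snd_A_mon c by simp
  next
    case False
    thus ?thesis unfolding h_scalar_exp_sum snd_A_mon c
      by (simp add: exp_sum_simps qint_uminus mult.commute)
  qed
qed

lemma h_scalar_shift:
  assumes "generic t"
  shows "h_scalar t i n (box_pair (j + 1) k) = h_scalar t i n (box_pair j k)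
      - qint t (n * cartan_matrix i (of_int j)) / of_int n * qpow t (of_int (n * (j + 1)))"
    "h_scalar t i n (box_pair j (k + 1)) = h_scalar t i n (box_pair j k)
      - qint t (n * cartan_matrix i (of_int k)) / of_int n * qpow t (of_int (n * (k - 1)))"
  unfolding box_pair_step_fst box_pair_step_snd h_scalar_A_mon[OF assms, symmetric]
  by (simp_all add: h_scalar_exp_sum exp_sum_simps algebra_simps diff_divide_distrib)

lemma k_x_on_wvec:
  assumes g: "generic t"
  shows "gen_action t (Gen_k h) (drinfeld t s i r (gen_action t (Gen_k (- h)) (wvec t j k)))
    = vscale (qpow t (of_int (sg s) * pairing (simple_root i) h)) (drinfeld t s i r (wvec t j k))"
proof -
  have neg: "pairing l (- h) = - pairing l h" for l by (simp add: pairing_def sum_negf)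
  have up: "pairing (wt (box_pair (j - 1) k)) h
      = pairing (wt (box_pair j k)) h + pairing (simple_root (of_int (j - 1))) h"
    "pairing (wt (box_pair j (k - 1))) h = pairing (wt (box_pair j k)) h
        + pairing (simple_root (of_int (k - 1))) h"
    using wt_box_pair_shift(1)[of "j - 1" k h] wt_box_pair_shift(2)[of j "k - 1" h] by simp_all
  have cancel: "qpow t (- p) * (x * qpow t (p - y)) = qpow t (- y) * x"
    "qpow t (- p) * (x * qpow t (p + y)) = qpow t y * x" for p x y
    by (simp_all add: mult.left_commute[of _ x] mult.commute[of x] flip: qpow_add)
  show ?thesis
  proof (cases s)
    case Mns
    show ?thesis unfolding Mns diagonal_wvec gen_action_scale lower_wvec[OF g]
      by (auto simp: vwhen_def gen_action_add gen_action_scale diagonal_wvec vscale_simps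
          wt_box_pair_shift neg cancel)
  next
    case Pls
    show ?thesis unfolding Pls diagonal_wvec gen_action_scale raise_wvec[OF g]
      by (auto simp: vwhen_def gen_action_add gen_action_scale diagonal_wvec vscale_simps up neg cancel
          simp del: of_int_diff)
  qed
qed

lemma h_x_on_wvec:
  assumes g: "generic t"
  shows "gen_action t (Gen_h i m) (drinfeld t s j r (wvec t a b))
      - drinfeld t s j r (gen_action t (Gen_h i m) (wvec t a b))
    = vscale (of_int (sg s) / of_int m * qint t (m * cartan_matrix i j)) (drinfeld t s j (m
        + r) (wvec t a b))"
proof -
  have up: "h_scalar t i m (box_pair (a - 1) b) = h_scalar t i m (box_pair a b)
      + qint t (m * cartan_matrix i (of_int (a - 1))) / of_int m * qpow t (of_int (m * a))"
    "h_scalar t i m (box_pair a (b - 1)) = h_scalar t i m (box_pair a b)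
      + qint t (m * cartan_matrix i (of_int (b - 1))) / of_int m * qpow t (of_int (m * (b - 2)))"
    subgoal using h_scalar_shift(1)[OF g, of i m "a - 1" b] by simp
    subgoal using h_scalar_shift(2)[OF g, of i m a "b - 1"] by simp
    done
  have q: "qpow t (of_int ((m + r) * x)) = qpow t (of_int (m * x)) * qpow t (of_int (r * x))" for x
    by (simp add: distrib_right flip: qpow_add)
  show ?thesis
  proof (cases s)
    case Mns
    show ?thesis unfolding Mns diagonal_wvec gen_action_scale lower_wvec[OF g] q
      unfolding vwhen_def gen_action_add
      by (rule poly_mapping_eqI) (auto simp: lookup_add lookup_minus gen_action_scale diagonal_wvec
          h_scalar_shift[OF g]
          simp del: of_int_mult; simp add: algebra_simps add_divide_distrib del: of_int_mult)
  next
    case Pls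
    show ?thesis unfolding Pls diagonal_wvec gen_action_scale raise_wvec[OF g] q
      unfolding vwhen_def gen_action_add
      by (rule poly_mapping_eqI) (auto simp: lookup_add lookup_minus gen_action_scale diagonal_wvec
          up algebra_simps
          simp del: of_int_mult of_int_diff)
  qed
qed

lemma relation_on_wvec:
  assumes g: "generic t" and rel: "toroidal_rel t a b" and kj: "k \<le> j"
  shows "VM_act t a (wvec t j k) = VM_act t b (wvec t j k)"
  using rel
proof cases
  case (h_dummy i)
  thus ?thesis by (simp add: diagonal_wvec h_scalar_def vscale_simps)
next
  case (k_mult h h')
  have "pairing l (h + h') = pairing l h + pairing l h'" for l
    by (simp add: pairing_def distrib_left sum.distrib algebra_simps)
  with k_mult show ?thesis
    by (simp add: VM_act_mult diagonal_wvec gen_action_scale vscale_simps qpow_add mult.commute)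
next
  case k_zero
  thus ?thesis by (simp add: diagonal_wvec pairing_def vscale_simps)
next
  case (k_h m h i)
  thus ?thesis by (simp add: VM_act_mult diagonal_wvec gen_action_scale vscale_simps mult.commute)
next
  case (h_h m m' i i')
  thus ?thesis by (simp add: VM_act_mult diagonal_wvec gen_action_scale vscale_simps mult.commute)
next
  case (k_x h s i r)
  thus ?thesis using k_x_on_wvec[OF g] by (simp add: VM_act_mult)
next
  case (h_x m i s i' r)
  thus ?thesis using h_x_on_wvec[OF g, of i m s i' r j k] by (simp add: VM_act_mult VM_act_diff_left)
next
  case (x_x_opposite i r i' r')
  have m: "box_pair j k \<in> monomial_group"
    using kj crystal_E_subset_monomial_group by (auto simp: crystal_E_eq)
  have "VM_act t (phi_el t Pls i n - phi_el t Mns i n) (wvec t j k)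
      = vscale ((qpow t 1 - qpow t (- 1)) * residue_sum t j k i n) (wvec t j k)" for n
    using phi_difference_on_basis[OF g m, of i n] expansion_jump_residue_sum[OF g kj, of i n] kj
    by (auto simp: wvec_def VM_act_scale vscale_simps mult.commute)
  thus ?thesis
    using x_x_opposite opposite_on_wvec[OF g, of i r i' r' j k] qpow_1_diff_nonzero[OF g]
    by (auto simp: VM_act_mult VM_act_diff_left VM_act_scale vscale_simps mult.commute split: if_splits)
next
  case (x_x_quadratic q s i i' r r')
  show ?thesis
    using x_x_quadratic quadratic_on_uvec[OF g refl, where s = s and i = i and j = i' and r
        = r and r' = r'] wvec_as_uvec[of t j k s]
    by (simp add: VM_act_mult VM_act_diff_left mult.assoc)
next
  case (serre i' i c s r1 r2 r')
  show ?thesis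
    using serre serre_on_uvec[OF g, where s = s and i = i and j = i' and r' = r' and ?r1.0
        = r1 and ?r2.0 = r2] wvec_as_uvec[of t j k s]
    by (simp add: VM_act_mult VM_act_diff_left VM_act_add_left mult.assoc qint_2[OF g])
next
  case (x_x_commute i i' s r r')
  thus ?thesis
    using commute_on_uvec[OF g, of i i' s r r'] wvec_as_uvec[of t j k s]
    by (simp add: VM_act_mult)
qed

lemma toroidal_module_VM:
  assumes g: "generic t"
  shows "toroidal_module t vscale VM_space (VM_act t)"
proof -
  interpret vector_space vscale by (rule vector_space_vscale)
  have "subspace VM_space" by (rule subspaceI) (simp_all add: VM_space_closed)
  moreover have "VM_act t a v = VM_act t b v" if "toroidal_rel t a b" "v \<in> VM_space" for a b v
    using that(2)
    by (induction rule: VM_space_linear_induct[OF g, consumes 1, case_names zero add wvec])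
       (simp_all add: VM_act_add VM_act_scale relation_on_wvec[OF g that(1)]
           VM_act_sum[of t _ _ "{}", simplified])
  ultimately show ?thesis
    unfolding toroidal_module_def
    using vector_space_vscale VM_act_closed[OF g]
    by (simp add: VM_act_add VM_act_scale VM_act_add_left VM_act_mult)
qed

section \<open>Weights and integrability\<close>

text \<open>
  A weight takes rational values on the coroots and $d$, so weight spaces are separated by rational
  powers of $q$; raising to the power of the denominator reduces to integers.
\<close>

lemma qpow_rat_eq_1:
  assumes g: "generic t" and x: "qpow t x = 1"
  shows "x = 0"
proof -
  obtain a b where ab: "quotient_of x = (a, b)" by (cases "quotient_of x")
  hence b: "b > 0" and xab: "x = of_int a / of_int b"
    using quotient_of_denom_pos[of x] quotient_of_div[of x] by auto
  have "qpow t (of_int a) = qpow t (of_nat (nat b) * x)" using b xab by simp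
  also have "\<dots> = 1" by (simp add: x flip: qpow_power)
  finally have "a = 0" using g by (auto simp: generic_def)
  thus ?thesis using xab by simp
qed

lemma lookup_gen_k: "Poly_Mapping.lookup (gen_action t (Gen_k h) v) m
    = qpow t (pairing (wt m) h) * Poly_Mapping.lookup v m"
proof -
  have "Poly_Mapping.lookup (gen_action t (Gen_k h) v) m
      = (\<Sum>m'\<in>Poly_Mapping.keys v. if m' = m then qpow t (pairing (wt m) h)
          * Poly_Mapping.lookup v m else 0)"
    unfolding gen_action_def lookup_sum
    by (intro sum.cong) (auto simp: basis_vec_def lookup_single when_def)
  thus ?thesis by (simp add: sum.delta in_keys_iff)
qed

lemma weight_eqI:
  assumes "\<And>h. pairing l h = pairing l' h"
  shows "l = l'"
proof -
  have "fst l $ i = fst l' $ i" for i using assms[of "coroot i"] by (simp add: pairing_coroot)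
  moreover have "snd l = snd l'" using assms[of "(0, 1)"] by (simp add: pairing_def)
  ultimately show ?thesis by (simp add: prod_eq_iff vec_eq_iff)
qed

lemma weight_space_VM_iff:
  assumes g: "generic t"
  shows "v \<in> weight_space t vscale VM_space (VM_act t) l \<longleftrightarrow>
    v \<in> VM_space \<and> (\<forall>m. Poly_Mapping.lookup v m \<noteq> 0 \<longrightarrow> wt m = l)"
proof -
  have "(\<forall>h. gen_action t (Gen_k h) v = vscale (qpow t (pairing l h)) v)
      \<longleftrightarrow> (\<forall>m. Poly_Mapping.lookup v m \<noteq> 0 \<longrightarrow> wt m = l)" (is "?L \<longleftrightarrow> ?R")
  proof
    assume L: ?L
    show ?R
    proof (intro allI impI)
      fix m assume nz: "Poly_Mapping.lookup v m \<noteq> 0"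
      show "wt m = l"
      proof (rule weight_eqI)
        fix h
        have "qpow t (pairing (wt m) h) * Poly_Mapping.lookup v m
            = qpow t (pairing l h) * Poly_Mapping.lookup v m"
          using L by (metis lookup_gen_k lookup_vscale)
        hence "qpow t (pairing (wt m) h) = qpow t (pairing l h)" using nz by simp
        moreover have "qpow t (pairing (wt m) h)
            = qpow t (pairing l h) * qpow t (pairing (wt m) h - pairing l h)"
          by (simp flip: qpow_add)
        ultimately have "qpow t (pairing (wt m) h - pairing l h) = 1" by simp
        from qpow_rat_eq_1[OF g this] show "pairing (wt m) h = pairing l h" by simp
      qed
    qed
  next
    assume R: ?R
    show ?L
      by (intro allI poly_mapping_eqI) (use R in \<open>force simp: lookup_gen_k\<close>)
  qed
  thus ?thesis by (simp add: weight_space_def)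
qed

lemma wt_crystal_E: "m \<in> crystal_E \<Longrightarrow> wt m \<in> weight_lattice"
  using crystal_E_subset_monomial_group by (auto simp: monomial_group_def)

text \<open>
  The component of weight \<open>l\<close> is forced to be the restriction of the combination to the monomials of
  weight \<open>l\<close>.
\<close>

lemma weight_decomposition:
  assumes g: "generic t" and v: "v \<in> VM_space"
  shows "\<exists>!f :: weight \<Rightarrow>\<^sub>0 combination. Poly_Mapping.keys f \<subseteq> weight_lattice
    \<and> (\<forall>l\<in>weight_lattice. Poly_Mapping.lookup f l \<in> weight_space t vscale VM_space (VM_act t) l)
    \<and> v = (\<Sum>l\<in>Poly_Mapping.keys f. Poly_Mapping.lookup f l)"
proof -
  let ?ok = "\<lambda>f :: weight \<Rightarrow>\<^sub>0 combination. Poly_Mapping.keys f \<subseteq> weight_lattice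
    \<and> (\<forall>l\<in>weight_lattice. Poly_Mapping.lookup f l \<in> weight_space t vscale VM_space (VM_act t) l)
    \<and> v = (\<Sum>l\<in>Poly_Mapping.keys f. Poly_Mapping.lookup f l)"
  let ?comp = "\<lambda>f :: weight \<Rightarrow>\<^sub>0 combination. \<forall>l m. Poly_Mapping.lookup (Poly_Mapping.lookup f l) m
      = (if wt m = l then Poly_Mapping.lookup v m else 0)"
  \<comment> \<open>The three conditions together prescribe every coefficient of every component.\<close>
  have ok_iff: "?ok f \<longleftrightarrow> ?comp f" for f
  proof
    assume ok: "?ok f"
    show "?comp f"
    proof (intro allI)
      fix l m
      have off: "Poly_Mapping.lookup (Poly_Mapping.lookup f l') m = 0" if "wt m \<noteq> l'" for l'
      proof (cases "l' \<in> weight_lattice")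
        case True
        hence "Poly_Mapping.lookup f l' \<in> weight_space t vscale VM_space (VM_act t) l'" using ok by blast
        thus ?thesis using that unfolding weight_space_VM_iff[OF g] by blast
      next
        case False
        hence "l' \<notin> Poly_Mapping.keys f" using ok by blast
        thus ?thesis by (simp add: in_keys_iff)
      qed
      have "Poly_Mapping.lookup v m = (\<Sum>l'\<in>Poly_Mapping.keys f. Poly_Mapping.lookup
          (Poly_Mapping.lookup f l') m)"
        using ok by (metis (no_types, lifting) lookup_sum sum.cong)
      also have "\<dots> = (\<Sum>l'\<in>Poly_Mapping.keys f.
          if l' = wt m then Poly_Mapping.lookup (Poly_Mapping.lookup f (wt m)) m else 0)"
        by (intro sum.cong) (auto simp: off)
      also have "\<dots> = Poly_Mapping.lookup (Poly_Mapping.lookup f (wt m)) m"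
        by (simp add: sum.delta in_keys_iff)
      finally show "Poly_Mapping.lookup (Poly_Mapping.lookup f l) m
          = (if wt m = l then Poly_Mapping.lookup v m else 0)"
        using off by auto
    qed
  next
    assume comp: "?comp f"
    have E: "m \<in> crystal_E" if "Poly_Mapping.lookup v m \<noteq> 0" for m
      using v that unfolding VM_space_iff by blast
    have "l \<in> weight_lattice" if l: "l \<in> Poly_Mapping.keys f" for l
    proof -
      have "Poly_Mapping.lookup f l \<noteq> 0" using l by (simp add: in_keys_iff)
      then obtain m where "Poly_Mapping.lookup (Poly_Mapping.lookup f l) m \<noteq> 0"
        by (metis lookup_zero poly_mapping_eqI)
      hence "wt m = l" "Poly_Mapping.lookup v m \<noteq> 0" using comp by (metis)+
      thus ?thesis using E wt_crystal_E by blast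
    qed
    moreover have "Poly_Mapping.lookup f l \<in> weight_space t vscale VM_space (VM_act t) l" for l
      unfolding weight_space_VM_iff[OF g] VM_space_iff using comp E by metis
    moreover have "v = (\<Sum>l\<in>Poly_Mapping.keys f. Poly_Mapping.lookup f l)"
    proof (rule poly_mapping_eqI)
      fix m
      have "wt m \<notin> Poly_Mapping.keys f \<Longrightarrow> Poly_Mapping.lookup v m = 0"
        using comp by (metis in_keys_iff lookup_zero)
      hence "Poly_Mapping.lookup v m = (\<Sum>l\<in>Poly_Mapping.keys f.
          if l = wt m then Poly_Mapping.lookup v m else 0)"
        by (simp add: sum.delta)
      also have "\<dots> = (\<Sum>l\<in>Poly_Mapping.keys f. Poly_Mapping.lookup (Poly_Mapping.lookup f l) m)"
        by (intro sum.cong refl) (rule trans[OF _ comp[rule_format, symmetric]], simp add: eq_commute)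
      finally show "Poly_Mapping.lookup v m = Poly_Mapping.lookup
          (\<Sum>l\<in>Poly_Mapping.keys f. Poly_Mapping.lookup f l) m"
        by (simp add: lookup_sum)
    qed
    ultimately show "?ok f" by blast
  qed
  define F :: "weight \<Rightarrow>\<^sub>0 combination" where "F
      = (\<Sum>m\<in>Poly_Mapping.keys v. Poly_Mapping.single (wt m)
      (Poly_Mapping.single m (Poly_Mapping.lookup v m)))"
  have "?comp F"
  proof (intro allI)
    fix l m
    have "Poly_Mapping.lookup (Poly_Mapping.lookup F l) m
      = (\<Sum>m'\<in>Poly_Mapping.keys v. if m' = m then (if wt m
          = l then Poly_Mapping.lookup v m else 0) else 0)"
      unfolding F_def lookup_sum by (intro sum.cong) (auto simp: lookup_single when_def)
    thus "Poly_Mapping.lookup (Poly_Mapping.lookup F l) m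
        = (if wt m = l then Poly_Mapping.lookup v m else 0)"
      by (simp add: sum.delta in_keys_iff)
  qed
  moreover have "f = f'" if "?comp f" "?comp f'" for f f'
    using that by (intro poly_mapping_eqI) metis
  ultimately show ?thesis unfolding ok_iff by blast
qed

lemma integrable_VM:
  assumes g: "generic t"
  shows "integrable_module t vscale VM_space (VM_act t)"
proof -
  have "VM_act t (x_el s i 0 ^ 3) v = 0" if "v \<in> VM_space" for s i v
    using that
  proof (induction rule: VM_space_linear_induct[OF g, consumes 1, case_names zero add wvec])
    case (wvec c j k)
    have "VM_act t (x_el s i 0 ^ 3) (wvec t j k) = 0"
      using cube_on_uvec[OF g, of s i 0 0 0] wvec_as_uvec[of t j k s]
      by (simp add: power3_eq_cube VM_act_mult)
    thus ?case by (simp add: VM_act_scale vscale_simps)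
  qed (simp_all add: VM_act_add VM_act_sum[of t _ _ "{}", simplified])
  thus ?thesis unfolding integrable_module_def
    using toroidal_module_VM[OF g] weight_decomposition[OF g] by blast
qed

section \<open>Cyclicity\<close>

text \<open>
  The two moves of a pair have the spectral parameters $q^{a+1}$ and $q^{b-1}$, which differ for
  \<open>b \<le> a\<close>. Subtracting from the mode 1 the multiple of the mode 0 by one of these parameters kills
  one move and leaves a non-zero multiple of the other.
\<close>

lemma isolate_move:
  assumes g: "generic t" and R: "\<And>x v. v \<in> R \<Longrightarrow> gen_action t x v \<in> R"
    "\<And>u v. u \<in> R \<Longrightarrow> v \<in> R \<Longrightarrow> u + v \<in> R" "\<And>c v. v \<in> R \<Longrightarrow> vscale c v \<in> R"
    and ba: "b \<le> a" and u: "uvec t s a b \<in> R"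
  shows "uvec t s (a + 1) b \<in> R" and "b < a \<Longrightarrow> uvec t s a (b + 1) \<in> R"
proof -
  \<comment> \<open>The spectral parameters of the two moves of the pair.\<close>
  define x y where "x = qpow (twist s t) (of_int (a + 1))" and "y = qpow (twist s t) (of_int (b - 1))"
  have ne: "x - y \<noteq> 0" "y - x \<noteq> 0"
    using qpow_int_inj[OF generic_twist[OF g, of s], of "a + 1" "b - 1"] ba by (auto simp: x_def y_def)
  have A: "widen_coeff t (a - b) \<noteq> 0"
    using ba by (auto simp: widen_coeff_def intro!: qint_nonzero[OF g])
  have B: "b < a \<Longrightarrow> narrow_coeff t (a - b) \<noteq> 0"
    by (auto simp: narrow_coeff_def intro!: qint_nonzero[OF g])
  have act: "drinfeld t s i 1 (uvec t s a b) + vscale c (drinfeld t s i 0 (uvec t s a b)) \<in> R" for i c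
    by (intro R u)
  have "drinfeld t s (move_node s a) 1 (uvec t s a b)
      + vscale (- y) (drinfeld t s (move_node s a) 0 (uvec t s a b))
      = vscale (widen_coeff t (a - b) * (x - y)) (uvec t s (a + 1) b)"
    unfolding gen_action_uvec[OF g]
    by (rule poly_mapping_eqI)
       (simp add: lookup_add widen_move_def narrow_move_def algebra_simps flip: x_def[simplified]
           y_def[simplified])
  hence "vscale (widen_coeff t (a - b) * (x - y)) (uvec t s (a + 1) b) \<in> R" by (metis act)
  from R(3)[OF this, of "1 / (widen_coeff t (a - b) * (x - y))"] show "uvec t s (a + 1) b \<in> R"
    using A ne by (simp add: vscale_simps)
  have "drinfeld t s (move_node s b) 1 (uvec t s a b)
      + vscale (- x) (drinfeld t s (move_node s b) 0 (uvec t s a b))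
      = vscale (narrow_coeff t (a - b) * (y - x)) (uvec t s a (b + 1))"
    unfolding gen_action_uvec[OF g]
    by (rule poly_mapping_eqI)
       (simp add: lookup_add widen_move_def narrow_move_def algebra_simps flip: x_def[simplified]
           y_def[simplified])
  hence *: "vscale (narrow_coeff t (a - b) * (y - x)) (uvec t s a (b + 1)) \<in> R" by (metis act)
  show "uvec t s a (b + 1) \<in> R" if "b < a"
    using R(3)[OF *, of "1 / (narrow_coeff t (a - b) * (y - x))"] B[OF that] ne
        by (simp add: vscale_simps)
qed

text \<open>
  From the pair \<open>(1, 1)\<close> widen it until the target lies inside, then narrow it to the target; in
  this order the condition \<open>k \<le> j\<close> is never violated.
\<close>

lemma VM_cyclic:
  assumes g: "generic t"
  shows "range (\<lambda>a. VM_act t a (basis_vec (box_pair 1 1))) = VM_space"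
proof -
  define R where "R = range (\<lambda>a. VM_act t a (basis_vec (box_pair 1 1)))"
  have M: "basis_vec (box_pair 1 1) \<in> VM_space"
    using crystal_E_eq by (auto simp: VM_space_def basis_vec_def)
  have R_act: "gen_action t x v \<in> R" "vscale c v \<in> R" if v: "v \<in> R" for x v c
  proof -
    obtain a where a: "v = VM_act t a (basis_vec (box_pair 1 1))" using v unfolding R_def by blast
    have "gen_action t x v = VM_act t (gen_elt x * a) (basis_vec (box_pair 1 1))"
      "vscale c v = VM_act t (cst c * a) (basis_vec (box_pair 1 1))"
      by (simp_all add: VM_act_mult a)
    thus "gen_action t x v \<in> R" "vscale c v \<in> R" unfolding R_def by blast+
  qed
  have R_add: "u + v \<in> R" if "u \<in> R" "v \<in> R" for u v
    using that unfolding R_def by (auto simp flip: VM_act_add_left)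
  note iso = isolate_move[OF g R_act(1) R_add R_act(2)]
  have "basis_vec (box_pair 1 1) \<in> R" using VM_act_one[of t "basis_vec (box_pair 1 1)"]
      unfolding R_def by (metis rangeI)
  hence start: "wvec t 1 1 \<in> R" using R_act(2) by (simp add: wvec_def)
  have P_up: "wvec t (j + 1) k \<in> R" if "k \<le> j" "wvec t j k \<in> R" for j k
    using iso(1)[of k j Mns] that by (simp add: uvec_def)
  have Q_up: "wvec t j (k + 1) \<in> R" if "k < j" "wvec t j k \<in> R" for j k
    using iso(2)[of k j Mns] that by (simp add: uvec_def)
  have Q_down: "wvec t j (k - 1) \<in> R" if "k \<le> j" "wvec t j k \<in> R" for j k
    using iso(1)[of "1 - j" "1 - k" Pls] that by (simp add: uvec_def)
  have P_down: "wvec t (j - 1) k \<in> R" if "k < j" "wvec t j k \<in> R" for j k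
    using iso(2)[of "1 - j" "1 - k" Pls] that by (simp add: uvec_def)
  have P_ups: "wvec t (j + int n) k \<in> R" if "k \<le> j" "wvec t j k \<in> R" for j k n
    using that by (induction n) (use P_up[of k "j + int _"] in \<open>auto simp: add_ac\<close>)
  have Q_ups: "wvec t j (k + int n) \<in> R" if "k + int n \<le> j" "wvec t j k \<in> R" for j k n
    using that by (induction n) (use Q_up[of "k + int _" j] in \<open>auto simp: add_ac\<close>)
  have Q_downs: "wvec t j (k - int n) \<in> R" if "k \<le> j" "wvec t j k \<in> R" for j k n
    using that by (induction n) (use Q_down[of "k - int _" j] in \<open>auto simp: algebra_simps\<close>)
  have P_downs: "wvec t (j - int n) k \<in> R" if "k \<le> j - int n" "wvec t j k \<in> R" for j k n
    using that by (induction n) (use P_down[of k "j - int _"] in \<open>auto simp: algebra_simps\<close>)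
  have all: "wvec t j k \<in> R" if kj: "k \<le> j" for j k
  proof -
    obtain j' k' where j': "1 \<le> j'" "j \<le> j'" and k': "k' \<le> 1" "k' \<le> k"
      using that by (metis max.cobounded1 max.cobounded2 min.cobounded1 min.cobounded2)
    have "wvec t j' 1 \<in> R" using P_ups[OF _ start, of "nat (j' - 1)"] j' by simp
    from Q_downs[OF _ this, of "nat (1 - k')"] j' k' have "wvec t j' k' \<in> R" by simp
    from P_downs[OF _ this, of "nat (j' - j)"] j' k' kj have "wvec t j k' \<in> R" by simp
    from Q_ups[OF _ this, of "nat (k - k')"] j' k' kj show ?thesis by simp
  qed
  show ?thesis unfolding R_def[symmetric]
  proof
    show "R \<subseteq> VM_space" using VM_act_closed[OF g M] unfolding R_def by blast
    show "VM_space \<subseteq> R"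
    proof
      fix v assume "v \<in> VM_space"
      thus "v \<in> R"
      proof (induction rule: VM_space_linear_induct[OF g, consumes 1, case_names zero add wvec])
        case zero
        show ?case using VM_act_zero[of t "basis_vec (box_pair 1 1)"] unfolding R_def by (metis rangeI)
      qed (auto intro: R_add R_act(2) all)
    qed
  qed
qed

section \<open>Extremal vectors\<close>

text \<open>
  The coroots determine the number of the box modulo 4, and $d$ determines the remaining quotient.
\<close>

lemma box_weight_inject:
  assumes "box_weight j + box_weight j = box_weight k + box_weight k"
  shows "j = k"
proof -
  have e: "box_weight j = box_weight k"
  proof -
    have "fst (box_weight j) $ i = fst (box_weight k) $ i" for i
      using arg_cong[OF assms, of "\<lambda>l. fst l $ i"] by simp
    moreover have "snd (box_weight j) = snd (box_weight k)"
      using arg_cong[OF assms, of snd] by simp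
    ultimately show ?thesis by (simp add: prod_eq_iff vec_eq_iff)
  qed
  have at: "fst (box_weight k) $ i = (if i = of_int k then 1 else
      if i = of_int k - 1 then - 1 else 0)" for k i
    by (simp add: box_weight_def axis_nth')
  have "of_int j = (of_int k :: node)"
  proof (rule ccontr)
    assume "of_int j \<noteq> (of_int k :: node)"
    hence "fst (box_weight k) $ of_int j \<le> 0" unfolding at by simp
    moreover have "fst (box_weight j) $ of_int j = 1" unfolding at by simp
    ultimately show False using e by simp
  qed
  hence "4 dvd (j - k)" by (simp add: of_int_node_eq_iff)
  moreover have "(j - 1) div 4 = (k - 1) div 4"
    using e by (simp add: box_weight_def)
  ultimately show ?thesis by presburger
qed

lemma pairing_diagonal:
  "pairing (wt (box_pair j j)) (coroot i) = (if i = of_int j then 2 else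
      if i = of_int (j - 1) then - 2 else 0)"
  by (simp add: pairing_coroot wt_box_pair box_weight_def axis_nth')

lemma reflection_diagonal:
  "reflection i (wt (box_pair j j)) =
    (if i = of_int j then wt (box_pair (j + 1) (j + 1)) else
        if i = of_int (j - 1) then wt (box_pair (j - 1) (j - 1)) else wt (box_pair j j))"
proof -
  have s: "wscale 2 l = l + l" "wscale (- 2) l = - l - l" "wscale 0 l = 0" for l
    by (simp_all add: wscale_def prod_eq_iff vec_eq_iff)
  have d: "box_weight (j - 1) = box_weight j + simple_root (of_int (j - 1))"
    using box_weight_step[of "j - 1"] by simp
  show ?thesis unfolding reflection_def pairing_diagonal
    by (auto simp: s wt_box_pair box_weight_step d simp del: of_int_diff)
qed

lemma weyl_orbit: "w \<in> weyl_group \<Longrightarrow> \<exists>j. w (wt (box_pair 1 1)) = wt (box_pair j j)"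
proof (induction rule: weyl_group.induct)
  case id_mem
  show ?case by (auto intro: exI[of _ 1])
next
  case (refl_mem w i)
  thus ?case by (auto simp: reflection_diagonal)
qed

text \<open>
  One box has to move before the other, since a diagonal pair cannot be narrowed. The first move has
  the coefficient $[2]_q$ and the second one the coefficient 1.
\<close>

lemma diagonal_square:
  assumes g: "generic t"
  shows "drinfeld t s (move_node s a) 0 (drinfeld t s (move_node s a) 0 (uvec t s a a))
      = vscale (qint t 2) (uvec t s (a + 1) (a + 1))"
proof -
  have "widen_coeff t 0 = qint t 2" "narrow_coeff t 1 = 1" "narrow_coeff t 0 = 0"
    using qint_1[OF g] by (simp_all add: widen_coeff_def narrow_coeff_def)
  thus ?thesis unfolding two_moves[OF g]
    using move_node_step[of s a] by (auto simp: widen_move_def narrow_move_def vscale_simps)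
qed

lemma diagonal_zero:
  assumes g: "generic t"
  shows "i \<noteq> of_int j \<Longrightarrow> drinfeld t Mns i r (wvec t j j) = 0"
    "i \<noteq> of_int (j - 1) \<Longrightarrow> drinfeld t Pls i r (wvec t j j) = 0"
  unfolding lower_wvec[OF g] raise_wvec[OF g] by (simp_all add: vwhen_def)

text \<open>
  The vector attached to \<open>w\<close> depends only on the weight \<open>w\<close> sends the weight of \<open>M\<close> to; it is the
  diagonal pair of that weight. The factors $[2]_q$ from the square, from its divided power and from
  the normalisation of the diagonal cancel.
\<close>

lemma VM_extremal:
  assumes g: "generic t"
  shows "extremal_vector t vscale VM_space (VM_act t) (basis_vec (box_pair 1 1)) (wt (box_pair 1 1))"
proof -
  have E: "box_pair j j \<in> crystal_E" for j by (auto simp: crystal_E_eq)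
  have n2: "qint t 2 \<noteq> 0" using qint_nonzero[OF g] by simp
  have q2: "qfact t 2 = qint t 2" using qint_1[OF g] by (simp add: qfact_def numeral_2_eq_2)
  have inV: "basis_vec (box_pair j j) \<in> VM_space" for j using E
      by (auto simp: VM_space_def basis_vec_def)
  have bw: "basis_vec (box_pair j j) = vscale (1 / qint t 2) (wvec t j j)" for j
    using basis_vec_wvec[OF g, of j j] by simp
  \<comment> \<open>Unique by \<open>box_weight_inject\<close>, so \<open>vw\<close> depends on \<open>w\<close> through the weight only.\<close>
  define idx where "idx l = (THE j. l = wt (box_pair j j))" for l
  have idx: "idx (wt (box_pair j j)) = j" for j
    unfolding idx_def by (rule the_equality) (auto simp: wt_box_pair intro: box_weight_inject)
  define vw where "vw w = basis_vec (box_pair (idx (w (wt (box_pair 1 1))))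
      (idx (w (wt (box_pair 1 1)))))" for w :: "weight \<Rightarrow> weight"
  have step: "VM_act t (x_el s i 0) (basis_vec (box_pair j j)) = 0
      \<and> VM_act t (cst (1 / qfact t n) * x_el (opp s) i 0 ^ n) (basis_vec (box_pair j j))
        = basis_vec (box_pair (idx (reflection i (wt (box_pair j j))))
            (idx (reflection i (wt (box_pair j j)))))"
    if n: "of_int (sg s) * pairing (wt (box_pair j j)) (coroot i) = of_nat n" for s i n j
  proof -
    have ndiff: "of_int j \<noteq> (of_int (j - 1) :: node)" by (simp only: of_int_node_eq_iff) simp
    consider "i = of_int j" | "i = of_int (j - 1)" | "i \<noteq> of_int j" "i \<noteq> of_int (j - 1)" by blast
    thus ?thesis
    proof cases
      case 1
      have "s = Pls" using n 1 by (cases s) (auto simp: pairing_diagonal)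
      moreover have "n = 2" using n 1 calculation by (simp add: pairing_diagonal)
      moreover have "drinfeld t Mns i 0 (drinfeld t Mns i 0 (wvec t j j))
          = vscale (qint t 2) (wvec t (j + 1) (j + 1))"
        using diagonal_square[OF g, of Mns j] 1 by (simp add: move_node_def uvec_def)
      ultimately show ?thesis
        using 1 ndiff n2 diagonal_zero(2)[OF g, of i j 0]
        by (simp add: reflection_diagonal idx q2 VM_act_mult VM_act_scale bw vscale_simps
            power2_eq_square
            gen_action_scale del: of_int_diff)
    next
      case 2
      have "s = Mns" using n 2 ndiff by (cases s) (auto simp: pairing_diagonal simp del: of_int_diff)
      moreover have "n = 2" using n 2 calculation ndiff by (simp add: pairing_diagonal del: of_int_diff)
      moreover have "drinfeld t Pls i 0 (drinfeld t Pls i 0 (wvec t j j))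
          = vscale (qint t 2) (wvec t (j - 1) (j - 1))"
        using diagonal_square[OF g, of Pls "1 - j"] 2 by (simp add: move_node_def uvec_def)
      ultimately show ?thesis
        using 2 ndiff n2 diagonal_zero(1)[OF g, of i j 0]
        by (simp add: reflection_diagonal idx q2 VM_act_mult VM_act_scale bw vscale_simps
            power2_eq_square
            gen_action_scale del: of_int_diff)
    next
      case 3
      have "n = 0" using n 3 by (simp add: pairing_diagonal del: of_int_diff)
      thus ?thesis using 3 diagonal_zero[OF g, of i j 0]
        by (cases s) (simp_all add: reflection_diagonal idx qfact_def bw gen_action_scale
            vscale_simps del: of_int_diff)
    qed
  qed
  have "vw id = basis_vec (box_pair 1 1)" by (simp add: vw_def idx)
  moreover have "vw w \<in> VM_space" for w by (simp add: vw_def inV)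
  moreover have "VM_act t (x_el s i 0) (vw w) = 0
      \<and> VM_act t (cst (1 / qfact t n) * x_el (opp s) i 0 ^ n) (vw w) = vw (reflection i \<circ> w)"
    if w: "w \<in> weyl_group" and n: "of_int (sg s) * pairing (w (wt (box_pair 1 1))) (coroot i)
        = of_nat n" for w i s n
  proof -
    obtain j where j: "w (wt (box_pair 1 1)) = wt (box_pair j j)" using weyl_orbit[OF w] by blast
    show ?thesis using step[of s j i n] n unfolding vw_def o_apply j idx by simp
  qed
  moreover have "basis_vec (box_pair 1 1) \<in> weight_space t vscale VM_space (VM_act t)
      (wt (box_pair 1 1))"
    using inV by (auto simp: weight_space_VM_iff[OF g] basis_vec_def lookup_single when_def split:
        if_splits)
  ultimately show ?thesis
    unfolding extremal_vector_def using wt_crystal_E[OF E] by (intro conjI exI[of _ vw]) auto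
qed

section \<open>Finiteness for the vertical subalgebras\<close>

text \<open>
  A box crosses from \<open>l\<close> to \<open>l + 1\<close> or back only at the node of \<open>l\<close>. So the vectors with both
  indices between two integers of the residue of the omitted node span a stable subspace of finite
  dimension, and every vector lies in such a subspace for a long enough interval.
\<close>

lemma vertical_finite:
  assumes g: "generic t" and v: "v \<in> VM_space"
  shows "\<exists>B. finite B \<and> (\<lambda>a. VM_act t a v) ` vertical_subalgebra i0 \<subseteq> module.span vscale B"
proof -
  interpret vector_space vscale by (rule vector_space_vscale)
  obtain e where e: "i0 = of_int e" using node_of_int_exists by blast
  define B where "B N = (\<lambda>(j, k). wvec t j k) ` ({e + 1 - 4 * int N..e + 4 * int N} \<times> {e + 1 - 4
      * int N..e + 4 * int N})" for N
  have wB: "wvec t j k \<in> span (B N)"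
    if "e + 1 - 4 * int N \<le> j" "j \<le> e + 4 * int N" "e + 1 - 4 * int N \<le> k" "k \<le> e + 4 * int N" for j k N
    using that by (intro span_base) (auto simp: B_def)
  \<comment> \<open>Leaving the interval at either end would need a generator of the omitted node.\<close>
  have top: "of_int (e + 4 * int N) = i0" and bot: "of_int (e + 1 - 4 * int N - 1) = i0" for N
    unfolding e of_int_node_eq_iff by simp_all
  have stable: "VM_act t a u \<in> span (B N)" if "a \<in> vertical_subalgebra i0" "u \<in> span (B N)" for a u N
    using that unfolding vertical_subalgebra_def
  proof (induction arbitrary: u rule: subalgebra.induct)
    case (gen_mem a)
    have on_B: "VM_act t a b \<in> span (B N)" if b: "b \<in> B N" for b
    proof -
      obtain j k where jk: "b = wvec t j k" "e + 1 - 4 * int N \<le> j" "j \<le> e + 4 * int N"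
        "e + 1 - 4 * int N \<le> k" "k \<le> e + 4 * int N" using b by (auto simp: B_def)
      consider (x) s i r where "a = x_el s i r"
          "i \<noteq> i0" | (h) i m where "a = h_el i m" | (k) h where "a = k_el h"
        using gen_mem(1) by blast
      thus ?thesis
      proof cases
        case (x s i r)
        have up: "of_int l \<noteq> i \<or> l + 1 \<le> e + 4 * int N" if "l \<le> e + 4 * int N" for l
          using that top[of N] x(2) by (cases "l = e + 4 * int N") auto
        have down: "of_int (l - 1) \<noteq> i \<or> e + 1 - 4 * int N \<le> l - 1" if "e + 1 - 4 * int N \<le> l" for l
          using that bot[of N] x(2) by (cases "l = e + 1 - 4 * int N") auto
        have z: "vwhen P c w \<in> span (B N)" if "P \<Longrightarrow> w \<in> span (B N)" for P c w
          using that by (auto simp: vwhen_def span_zero intro: span_scale)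
        show ?thesis
        proof (cases s)
          case Mns
          show ?thesis unfolding x Mns jk(1) VM_act_gen lower_wvec[OF g]
            by (intro span_add z wB) (use jk up[OF jk(3)] up[OF jk(5)] in auto)
        next
          case Pls
          show ?thesis unfolding x Pls jk(1) VM_act_gen raise_wvec[OF g]
            by (intro span_add z wB) (use jk down[OF jk(2)] down[OF jk(4)] in auto)
        qed
      qed (simp_all add: jk(1) diagonal_wvec span_scale wB jk)
    qed
    show ?case using gen_mem(2)
    proof (induction rule: span_induct_alt)
      case base
      show ?case using VM_act_scale[of t a 0 0] by (simp add: vscale_simps span_zero)
    next
      case (step c b u)
      thus ?case by (simp add: VM_act_add VM_act_scale span_add span_scale on_B)
    qed
  qed (auto simp: span_scale VM_act_add_left VM_act_mult intro: span_add)
  have mono: "span (B N) \<subseteq> span (B N')" if "N \<le> N'" for N N'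
    by (rule span_mono) (use that in \<open>auto simp: B_def intro!: image_mono\<close>)
  have "\<exists>N. v \<in> span (B N)"
    using v
  proof (induction rule: VM_space_linear_induct[OF g, consumes 1, case_names zero add wvec])
    case zero
    show ?case by (simp add: span_zero)
  next
    case (add u v)
    then obtain N N' where "u \<in> span (B N)" "v \<in> span (B N')" by blast
    hence "u \<in> span (B (max N N'))" "v \<in> span (B (max N N'))"
      using mono[of N "max N N'"] mono[of N' "max N N'"] by auto
    thus ?case by (blast intro: span_add)
  next
    case (wvec c j k)
    \<comment> \<open>Large enough for the interval of \<open>B N\<close> to contain both indices.\<close>
    define N where "N = nat \<bar>j\<bar> + nat \<bar>k\<bar> + nat \<bar>e\<bar> + 1"
    have "wvec t j k \<in> span (B N)" by (rule wB) (auto simp: N_def)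
    thus ?case by (blast intro: span_scale)
  qed
  then obtain N where N: "v \<in> span (B N)" by blast
  have "finite (B N)" by (simp add: B_def)
  thus ?thesis using stable[OF _ N] by blast
qed

section \<open>The extremal loop weight module\<close>

theorem theorem5p11:
  fixes t :: complex and M :: monom
  assumes q_not_root_of_unity: "\<And>n::nat. n > 0 \<Longrightarrow> exp t ^ n \<noteq> 1"
    and M_eq: "M = e_mon (wscale 2 varpi1) + Y_mon 1 1 + Y_mon 1 (- 1) - Y_mon 0 2 - Y_mon 0 0"
  shows "extremal_loop_weight_module t vscale VM_space (VM_act t) (basis_vec M) M"
proof -
  have g: "generic t" using q_not_root_of_unity by (rule genericI)
  have M: "M = box_pair 1 1"
    using M_shift_eq_box_pair[of 0] unfolding M_eq M_shift_def
    by (simp add: wscale_def zero_prod_def[symmetric])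
  have E: "M \<in> crystal_E" by (auto simp: M crystal_E_eq)
  have "has_ell_weight t vscale VM_space (VM_act t) (basis_vec M) M"
  proof -
    have "basis_vec M \<noteq> 0" by (metis basis_vec_def lookup_single_eq lookup_zero zero_neq_one)
    moreover have "basis_vec M \<in> weight_space t vscale VM_space (VM_act t) (wt M)"
      using VM_extremal[OF g] by (simp add: extremal_vector_def M)
    moreover have "VM_act t ((phi_el t s i (sg s * int n)
        - cst (fps_nth (ell_series t M s i) n)) ^ 1) (basis_vec M) = 0"
      for s i n
      using VM_act_phi[OF qpow_1_diff_nonzero[OF g], of M s i n] E crystal_E_subset_monomial_group
      by (auto simp: VM_act_diff_left)
    ultimately show ?thesis unfolding has_ell_weight_def by blast
  qed
  thus ?thesis unfolding extremal_loop_weight_module_def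
    using integrable_VM[OF g] VM_cyclic[OF g] VM_extremal[OF g] vertical_finite[OF g] by (simp add: M)
qed

end
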